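(* Let $n\in\omega$ be fixed. Let $T$ be a consistent first-order theory formulated in a finite language $\mathcal{L}$ such that $T$ is sequential and $T$ is axiomatized by a set of $\Sigma_n^{*}$-sentences (i.e., there is a set $A$ of $\Sigma_n^{*}$-sentences of $\mathcal{L}$ such that for every $\mathcal{L}$-sentence $\psi$, $\psi\in T$ iff $A\vdash\psi$). Then $T$ is incomplete, i.e., there is an $\mathcal{L}$-sentence $\psi$ such that neither $T\vdash\psi$ nor $T\vdash\neg\psi$.
   Context: A theory $T$ is sequential if there is a formula $N(x)$, together with formulae providing interpretations of equality and of successor, addition and multiplication on the elements satisfying $N(x)$, such that $T$ proves the translations of the axioms of Robinson's arithmetic $\mathsf{Q}$ relativized to $N$; and additionally there is a formula $\beta(x,i,w)$ (intended meaning: $x$ is the $i$-th element of the sequence $w$) such that $T$ proves $\forall w,x,k\ \exists w'\ \forall i,y\ [ (N(k)\wedge i\le k)\rightarrow (\beta(y,i,w')\leftrightarrow [(i<k\wedge\beta(y,i,w))\vee(i=k\wedge y=x)])]$. The classes $\Sigma_n^{*},\Pi_n^{*}$ measure depth of quantifier alternation (not requiring prenex form): $\Sigma_0^{*}=\Pi_0^{*}$ consists of the quantifier-free formulae; $\Sigma_{n+1}^{*}$ is the smallest class containing $\Pi_n^{*}$ (hence $\Sigma_n^*$) and closed under $\wedge$, $\vee$, existential quantification, under forming $\neg\varphi$ for $\varphi\in\Pi_{n+1}^{*}$, and under forming $\varphi\to\psi$ for $\varphi\in\Pi_{n+1}^{*}$, $\psi\in\Sigma_{n+1}^{*}$; $\Pi_{n+1}^{*}$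 is defined dually (containing $\Sigma_n^{*}$, closed under $\wedge$, $\vee$, universal quantification, $\neg\varphi$ for $\varphi\in\Sigma_{n+1}^{*}$, and $\varphi\to\psi$ for $\varphi\in\Sigma_{n+1}^{*}$, $\psi\in\Pi_{n+1}^{*}$). *)

theory Defs
  imports Main
begin

section \<open>First-order syntax (de Bruijn indices)\<close>

datatype 'f tm = Var nat | Fun 'f "'f tm list"

datatype ('f, 'p) fm =
    Rel 'p "'f tm list"
  | Eq "'f tm" "'f tm"
  | Neg "('f, 'p) fm"
  | Conj "('f, 'p) fm" "('f, 'p) fm"
  | Disj "('f, 'p) fm" "('f, 'p) fm"
  | Imp "('f, 'p) fm" "('f, 'p) fm"
  | Forall "('f, 'p) fm"
  | Exists "('f, 'p) fm"

abbreviation Iff :: "('f, 'p) fm \<Rightarrow> ('f, 'p) fm \<Rightarrow> ('f, 'p) fm" where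
  "Iff \<phi> \<psi> \<equiv> Conj (Imp \<phi> \<psi>) (Imp \<psi> \<phi>)"

primrec fv_tm :: "'f tm \<Rightarrow> nat set" where
  "fv_tm (Var i) = {i}"
| "fv_tm (Fun f ts) = \<Union> (set (map fv_tm ts))"

primrec fv :: "('f, 'p) fm \<Rightarrow> nat set" where
  "fv (Rel p ts) = \<Union> (set (map fv_tm ts))"
| "fv (Eq s t) = fv_tm s \<union> fv_tm t"
| "fv (Neg \<phi>) = fv \<phi>"
| "fv (Conj \<phi> \<psi>) = fv \<phi> \<union> fv \<psi>"
| "fv (Disj \<phi> \<psi>) = fv \<phi> \<union> fv \<psi>"
| "fv (Imp \<phi> \<psi>) = fv \<phi> \<union> fv \<psi>"
| "fv (Forall \<phi>) = {i. Suc i \<in> fv \<phi>}"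
| "fv (Exists \<phi>) = {i. Suc i \<in> fv \<phi>}"

primrec subst_tm :: "(nat \<Rightarrow> 'f tm) \<Rightarrow> 'f tm \<Rightarrow> 'f tm" where
  "subst_tm \<sigma> (Var i) = \<sigma> i"
| "subst_tm \<sigma> (Fun f ts) = Fun f (map (subst_tm \<sigma>) ts)"

abbreviation lift_tm :: "'f tm \<Rightarrow> 'f tm" where
  "lift_tm \<equiv> subst_tm (\<lambda>i. Var (Suc i))"

definition up_subst :: "(nat \<Rightarrow> 'f tm) \<Rightarrow> nat \<Rightarrow> 'f tm" where
  "up_subst \<sigma> = case_nat (Var 0) (\<lambda>i. lift_tm (\<sigma> i))"

primrec subst :: "(nat \<Rightarrow> 'f tm) \<Rightarrow> ('f, 'p) fm \<Rightarrow> ('f, 'p) fm" where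
  "subst \<sigma> (Rel p ts) = Rel p (map (subst_tm \<sigma>) ts)"
| "subst \<sigma> (Eq s t) = Eq (subst_tm \<sigma> s) (subst_tm \<sigma> t)"
| "subst \<sigma> (Neg \<phi>) = Neg (subst \<sigma> \<phi>)"
| "subst \<sigma> (Conj \<phi> \<psi>) = Conj (subst \<sigma> \<phi>) (subst \<sigma> \<psi>)"
| "subst \<sigma> (Disj \<phi> \<psi>) = Disj (subst \<sigma> \<phi>) (subst \<sigma> \<psi>)"
| "subst \<sigma> (Imp \<phi> \<psi>) = Imp (subst \<sigma> \<phi>) (subst \<sigma> \<psi>)"
| "subst \<sigma> (Forall \<phi>) = Forall (subst (up_subst \<sigma>) \<phi>)"
| "subst \<sigma> (Exists \<phi>) = Exists (subst (up_subst \<sigma>) \<phi>)"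

abbreviation lift :: "('f, 'p) fm \<Rightarrow> ('f, 'p) fm" where
  "lift \<equiv> subst (\<lambda>i. Var (Suc i))"

abbreviation subst_top :: "'f tm \<Rightarrow> ('f, 'p) fm \<Rightarrow> ('f, 'p) fm" where
  "subst_top t \<equiv> subst (case_nat t Var)"

text \<open>\<open>app \<phi> [t\<^sub>0, \<dots>, t\<^sub>k]\<close> is \<open>\<phi>(t\<^sub>0, \<dots>, t\<^sub>k)\<close>, where the argument places of \<open>\<phi>\<close> are its
  free variables \<open>0, \<dots>, k\<close>.\<close>

definition app :: "('f, 'p) fm \<Rightarrow> 'f tm list \<Rightarrow> ('f, 'p) fm" where
  "app \<phi> ts = subst (\<lambda>i. if i < length ts then ts ! i else Var i) \<phi>"

definition exs :: "nat \<Rightarrow> ('f, 'p) fm \<Rightarrow> ('f, 'p) fm" where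
  "exs k = Exists ^^ k"


section \<open>Languages and provability\<close>

text \<open>A language consists of function symbols (constants have arity 0) and relation symbols, each
  given together with its arity; equality is a logical symbol.\<close>

record ('f, 'p) lang =
  funs :: "('f \<times> nat) set"
  rels :: "('p \<times> nat) set"

definition finite_lang :: "('f, 'p) lang \<Rightarrow> bool" where
  "finite_lang L \<longleftrightarrow> finite (funs L) \<and> finite (rels L)"

primrec in_lang_tm :: "('f, 'p) lang \<Rightarrow> 'f tm \<Rightarrow> bool" where
  "in_lang_tm L (Var i) \<longleftrightarrow> True"
| "in_lang_tm L (Fun f ts) \<longleftrightarrow> (f, length ts) \<in> funs L \<and> list_all (in_lang_tm L) ts"

primrec in_lang :: "('f, 'p) lang \<Rightarrow> ('f, 'p) fm \<Rightarrow> bool" where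
  "in_lang L (Rel p ts) \<longleftrightarrow> (p, length ts) \<in> rels L \<and> list_all (in_lang_tm L) ts"
| "in_lang L (Eq s t) \<longleftrightarrow> in_lang_tm L s \<and> in_lang_tm L t"
| "in_lang L (Neg \<phi>) \<longleftrightarrow> in_lang L \<phi>"
| "in_lang L (Conj \<phi> \<psi>) \<longleftrightarrow> in_lang L \<phi> \<and> in_lang L \<psi>"
| "in_lang L (Disj \<phi> \<psi>) \<longleftrightarrow> in_lang L \<phi> \<and> in_lang L \<psi>"
| "in_lang L (Imp \<phi> \<psi>) \<longleftrightarrow> in_lang L \<phi> \<and> in_lang L \<psi>"
| "in_lang L (Forall \<phi>) \<longleftrightarrow> in_lang L \<phi>"
| "in_lang L (Exists \<phi>) \<longleftrightarrow> in_lang L \<phi>"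

definition sentences :: "('f, 'p) lang \<Rightarrow> ('f, 'p) fm set" where
  "sentences L = {\<phi>. in_lang L \<phi> \<and> fv \<phi> = {}}"

text \<open>Classical natural deduction with equality, all formulae being \<open>L\<close>-formulae. The eigenvariable
  conditions of \<open>AllI\<close> and \<open>ExE\<close> are expressed by lifting, which makes index 0 fresh.\<close>

inductive prv :: "('f, 'p) lang \<Rightarrow> ('f, 'p) fm set \<Rightarrow> ('f, 'p) fm \<Rightarrow> bool" for L where
  Asm: "\<phi> \<in> \<Gamma> \<Longrightarrow> in_lang L \<phi> \<Longrightarrow> prv L \<Gamma> \<phi>"
| NegI: "in_lang L \<phi> \<Longrightarrow> prv L (insert \<phi> \<Gamma>) \<psi> \<Longrightarrow> prv L (insert \<phi> \<Gamma>) (Neg \<psi>) \<Longrightarrow> prv L \<Gamma> (Neg \<phi>)"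
| Classical: "in_lang L \<phi> \<Longrightarrow> prv L (insert (Neg \<phi>) \<Gamma>) \<psi> \<Longrightarrow> prv L (insert (Neg \<phi>) \<Gamma>) (Neg \<psi>)
    \<Longrightarrow> prv L \<Gamma> \<phi>"
| ConjI: "prv L \<Gamma> \<phi> \<Longrightarrow> prv L \<Gamma> \<psi> \<Longrightarrow> prv L \<Gamma> (Conj \<phi> \<psi>)"
| ConjE1: "prv L \<Gamma> (Conj \<phi> \<psi>) \<Longrightarrow> prv L \<Gamma> \<phi>"
| ConjE2: "prv L \<Gamma> (Conj \<phi> \<psi>) \<Longrightarrow> prv L \<Gamma> \<psi>"
| DisjI1: "prv L \<Gamma> \<phi> \<Longrightarrow> in_lang L \<psi> \<Longrightarrow> prv L \<Gamma> (Disj \<phi> \<psi>)"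
| DisjI2: "prv L \<Gamma> \<psi> \<Longrightarrow> in_lang L \<phi> \<Longrightarrow> prv L \<Gamma> (Disj \<phi> \<psi>)"
| DisjE: "prv L \<Gamma> (Disj \<phi> \<psi>) \<Longrightarrow> prv L (insert \<phi> \<Gamma>) \<chi> \<Longrightarrow> prv L (insert \<psi> \<Gamma>) \<chi> \<Longrightarrow> prv L \<Gamma> \<chi>"
| ImpI: "in_lang L \<phi> \<Longrightarrow> prv L (insert \<phi> \<Gamma>) \<psi> \<Longrightarrow> prv L \<Gamma> (Imp \<phi> \<psi>)"
| ImpE: "prv L \<Gamma> (Imp \<phi> \<psi>) \<Longrightarrow> prv L \<Gamma> \<phi> \<Longrightarrow> prv L \<Gamma> \<psi>"
| AllI: "prv L (lift ` \<Gamma>) \<phi> \<Longrightarrow> prv L \<Gamma> (Forall \<phi>)"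
| AllE: "prv L \<Gamma> (Forall \<phi>) \<Longrightarrow> in_lang_tm L t \<Longrightarrow> prv L \<Gamma> (subst_top t \<phi>)"
| ExI: "in_lang L \<phi> \<Longrightarrow> in_lang_tm L t \<Longrightarrow> prv L \<Gamma> (subst_top t \<phi>) \<Longrightarrow> prv L \<Gamma> (Exists \<phi>)"
| ExE: "prv L \<Gamma> (Exists \<phi>) \<Longrightarrow> prv L (insert \<phi> (lift ` \<Gamma>)) (lift \<psi>) \<Longrightarrow> prv L \<Gamma> \<psi>"
| EqI: "in_lang_tm L t \<Longrightarrow> prv L \<Gamma> (Eq t t)"
| EqE: "in_lang L \<phi> \<Longrightarrow> prv L \<Gamma> (Eq s t) \<Longrightarrow> prv L \<Gamma> (subst_top s \<phi>) \<Longrightarrow> prv L \<Gamma> (subst_top t \<phi>)"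

definition consistent :: "('f, 'p) lang \<Rightarrow> ('f, 'p) fm set \<Rightarrow> bool" where
  "consistent L T \<longleftrightarrow> \<not> (\<exists>\<phi>. prv L T \<phi> \<and> prv L T (Neg \<phi>))"


section \<open>The classes \<open>\<Sigma>\<^sub>n\<^sup>*\<close> and \<open>\<Pi>\<^sub>n\<^sup>*\<close>\<close>

primrec quantifier_free :: "('f, 'p) fm \<Rightarrow> bool" where
  "quantifier_free (Rel p ts) \<longleftrightarrow> True"
| "quantifier_free (Eq s t) \<longleftrightarrow> True"
| "quantifier_free (Neg \<phi>) \<longleftrightarrow> quantifier_free \<phi>"
| "quantifier_free (Conj \<phi> \<psi>) \<longleftrightarrow> quantifier_free \<phi> \<and> quantifier_free \<psi>"
| "quantifier_free (Disj \<phi> \<psi>) \<longleftrightarrow> quantifier_free \<phi> \<and> quantifier_free \<psi>"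
| "quantifier_free (Imp \<phi> \<psi>) \<longleftrightarrow> quantifier_free \<phi> \<and> quantifier_free \<psi>"
| "quantifier_free (Forall \<phi>) \<longleftrightarrow> False"
| "quantifier_free (Exists \<phi>) \<longleftrightarrow> False"

inductive SigmaStar :: "nat \<Rightarrow> ('f, 'p) fm \<Rightarrow> bool"
  and PiStar :: "nat \<Rightarrow> ('f, 'p) fm \<Rightarrow> bool" where
  Sigma_0: "quantifier_free \<phi> \<Longrightarrow> SigmaStar 0 \<phi>"
| Sigma_Pi: "PiStar n \<phi> \<Longrightarrow> SigmaStar (Suc n) \<phi>"
| Sigma_Conj: "SigmaStar (Suc n) \<phi> \<Longrightarrow> SigmaStar (Suc n) \<psi> \<Longrightarrow> SigmaStar (Suc n) (Conj \<phi> \<psi>)"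
| Sigma_Disj: "SigmaStar (Suc n) \<phi> \<Longrightarrow> SigmaStar (Suc n) \<psi> \<Longrightarrow> SigmaStar (Suc n) (Disj \<phi> \<psi>)"
| Sigma_Ex: "SigmaStar (Suc n) \<phi> \<Longrightarrow> SigmaStar (Suc n) (Exists \<phi>)"
| Sigma_Neg: "PiStar (Suc n) \<phi> \<Longrightarrow> SigmaStar (Suc n) (Neg \<phi>)"
| Sigma_Imp: "PiStar (Suc n) \<phi> \<Longrightarrow> SigmaStar (Suc n) \<psi> \<Longrightarrow> SigmaStar (Suc n) (Imp \<phi> \<psi>)"
| Pi_0: "quantifier_free \<phi> \<Longrightarrow> PiStar 0 \<phi>"
| Pi_Sigma: "SigmaStar n \<phi> \<Longrightarrow> PiStar (Suc n) \<phi>"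
| Pi_Conj: "PiStar (Suc n) \<phi> \<Longrightarrow> PiStar (Suc n) \<psi> \<Longrightarrow> PiStar (Suc n) (Conj \<phi> \<psi>)"
| Pi_Disj: "PiStar (Suc n) \<phi> \<Longrightarrow> PiStar (Suc n) \<psi> \<Longrightarrow> PiStar (Suc n) (Disj \<phi> \<psi>)"
| Pi_All: "PiStar (Suc n) \<phi> \<Longrightarrow> PiStar (Suc n) (Forall \<phi>)"
| Pi_Neg: "SigmaStar (Suc n) \<phi> \<Longrightarrow> PiStar (Suc n) (Neg \<phi>)"
| Pi_Imp: "SigmaStar (Suc n) \<phi> \<Longrightarrow> PiStar (Suc n) \<psi> \<Longrightarrow> PiStar (Suc n) (Imp \<phi> \<psi>)"


section \<open>Relative interpretations\<close>

text \<open>A one-dimensional, parameter-free relative interpretation of a language with symbols in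
  \<open>'g, 'q\<close> in a language with symbols in \<open>'f, 'p\<close>; equality need not be interpreted as identity.
  A \<open>k\<close>-ary function symbol is interpreted by a formula for its graph: the arguments are the
  variables \<open>0, \<dots>, k - 1\<close> and the value is the variable \<open>k\<close>.\<close>

record ('g, 'q, 'f, 'p) interp =
  i_dom :: "('f, 'p) fm"
  i_eq :: "('f, 'p) fm"
  i_fun :: "'g \<Rightarrow> nat \<Rightarrow> ('f, 'p) fm"
  i_rel :: "'q \<Rightarrow> nat \<Rightarrow> ('f, 'p) fm"

abbreviation vars :: "nat \<Rightarrow> nat \<Rightarrow> 'f tm list" where
  "vars m k \<equiv> map Var [m..<m + k]"

definition in_dom :: "('g, 'q, 'f, 'p) interp \<Rightarrow> nat \<Rightarrow> ('f, 'p) fm" where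
  "in_dom I v = app (i_dom I) [Var v]"

definition eq_at :: "('g, 'q, 'f, 'p) interp \<Rightarrow> nat \<Rightarrow> nat \<Rightarrow> ('f, 'p) fm" where
  "eq_at I u v = app (i_eq I) [Var u, Var v]"

text \<open>\<open>ex_args I [V\<^sub>0, \<dots>, V\<^sub>k] d \<phi>\<close> says that \<open>\<phi>\<close> holds of some elements of the domain, bound as
  variables \<open>0, \<dots>, k\<close>, which are values of the terms with value formulae \<open>V\<^sub>0, \<dots>, V\<^sub>k\<close>.
  \<open>val I t d v\<close> says that the variable \<open>v\<close> is a value of the term \<open>t\<close>, where \<open>t\<close> has been moved
  under \<open>d\<close> additional quantifiers.\<close>

definition ex_args ::
  "('g, 'q, 'f, 'p) interp \<Rightarrow> (nat \<Rightarrow> nat \<Rightarrow> ('f, 'p) fm) list \<Rightarrow> nat \<Rightarrow> ('f, 'p) fm \<Rightarrow> ('f, 'p) fm" where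
  "ex_args I Vs d \<phi> = (let k = length Vs in
     exs k (foldr Conj (map (\<lambda>j. Conj (in_dom I j) ((Vs ! j) (d + k) j)) [0..<k]) \<phi>))"

primrec val :: "('g, 'q, 'f, 'p) interp \<Rightarrow> 'g tm \<Rightarrow> nat \<Rightarrow> nat \<Rightarrow> ('f, 'p) fm" where
  "val I (Var i) = (\<lambda>d v. eq_at I (i + d) v)"
| "val I (Fun f ts) = (\<lambda>d v. let k = length ts in
     ex_args I (map (val I) ts) d (app (i_fun I f k) (vars 0 k @ [Var (v + k)])))"

primrec tr :: "('g, 'q, 'f, 'p) interp \<Rightarrow> ('g, 'q) fm \<Rightarrow> ('f, 'p) fm" where
  "tr I (Rel p ts) = (let k = length ts in
     ex_args I (map (val I) ts) 0 (app (i_rel I p k) (vars 0 k)))"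
| "tr I (Eq s t) = ex_args I [val I s, val I t] 0 (eq_at I 0 1)"
| "tr I (Neg \<phi>) = Neg (tr I \<phi>)"
| "tr I (Conj \<phi> \<psi>) = Conj (tr I \<phi>) (tr I \<psi>)"
| "tr I (Disj \<phi> \<psi>) = Disj (tr I \<phi>) (tr I \<psi>)"
| "tr I (Imp \<phi> \<psi>) = Imp (tr I \<phi>) (tr I \<psi>)"
| "tr I (Forall \<phi>) = Forall (Imp (in_dom I 0) (tr I \<phi>))"
| "tr I (Exists \<phi>) = Exists (Conj (in_dom I 0) (tr I \<phi>))"

definition alls_dom :: "('g, 'q, 'f, 'p) interp \<Rightarrow> nat \<Rightarrow> ('f, 'p) fm \<Rightarrow> ('f, 'p) fm" where
  "alls_dom I k = (\<lambda>\<phi>. Forall (Imp (in_dom I 0) \<phi>)) ^^ k"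

definition interp_wf :: "('f, 'p) lang \<Rightarrow> ('g, 'q) lang \<Rightarrow> ('g, 'q, 'f, 'p) interp \<Rightarrow> bool" where
  "interp_wf L K I \<longleftrightarrow>
     in_lang L (i_dom I) \<and> fv (i_dom I) \<subseteq> {0} \<and>
     in_lang L (i_eq I) \<and> fv (i_eq I) \<subseteq> {0, 1} \<and>
     (\<forall>(f, k) \<in> funs K. in_lang L (i_fun I f k) \<and> fv (i_fun I f k) \<subseteq> {..k}) \<and>
     (\<forall>(p, k) \<in> rels K. in_lang L (i_rel I p k) \<and> fv (i_rel I p k) \<subseteq> {..<k})"

text \<open>\<open>congruence_ax I k \<phi>\<close>: the \<open>k\<close>-place formula \<open>\<phi>\<close> respects the interpreted equality.\<close>

definition congruence_ax ::
  "('g, 'q, 'f, 'p) interp \<Rightarrow> nat \<Rightarrow> ('f, 'p) fm \<Rightarrow> ('f, 'p) fm" where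
  "congruence_ax I k \<phi> = alls_dom I (2 * k)
     (foldr Imp (map (\<lambda>j. eq_at I j (j + k)) [0..<k]) (Imp (app \<phi> (vars 0 k)) (app \<phi> (vars k k))))"

text \<open>In \<open>total_ax\<close> and \<open>unique_ax\<close> the values are bound innermost, so that the \<open>k\<close> arguments are
  shifted by one and by two, respectively.\<close>

definition total_ax ::
  "('g, 'q, 'f, 'p) interp \<Rightarrow> nat \<Rightarrow> ('f, 'p) fm \<Rightarrow> ('f, 'p) fm" where
  "total_ax I k \<phi> = alls_dom I k (Exists (Conj (in_dom I 0) (app \<phi> (vars 1 k @ [Var 0]))))"

definition unique_ax ::
  "('g, 'q, 'f, 'p) interp \<Rightarrow> nat \<Rightarrow> ('f, 'p) fm \<Rightarrow> ('f, 'p) fm" where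
  "unique_ax I k \<phi> = alls_dom I (k + 2)
     (Imp (Conj (app \<phi> (vars 2 k @ [Var 0])) (app \<phi> (vars 2 k @ [Var 1]))) (eq_at I 0 1))"

definition interp_axs :: "('g, 'q) lang \<Rightarrow> ('g, 'q, 'f, 'p) interp \<Rightarrow> ('f, 'p) fm set" where
  "interp_axs K I =
     {Exists (in_dom I 0),
      alls_dom I 1 (eq_at I 0 0),
      alls_dom I 2 (Imp (eq_at I 0 1) (eq_at I 1 0)),
      alls_dom I 3 (Imp (Conj (eq_at I 0 1) (eq_at I 1 2)) (eq_at I 0 2))} \<union>
     (\<Union>(p, k) \<in> rels K. {congruence_ax I k (i_rel I p k)}) \<union>
     (\<Union>(f, k) \<in> funs K. {congruence_ax I (Suc k) (i_fun I f k),
        total_ax I k (i_fun I f k), unique_ax I k (i_fun I f k)})"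

definition interprets ::
  "('f, 'p) lang \<Rightarrow> ('f, 'p) fm set \<Rightarrow> ('g, 'q) lang \<Rightarrow> ('g, 'q) fm set
    \<Rightarrow> ('g, 'q, 'f, 'p) interp \<Rightarrow> bool"
  where
  "interprets L T K U I \<longleftrightarrow>
     interp_wf L K I \<and> (\<forall>\<phi> \<in> interp_axs K I. prv L T \<phi>) \<and> (\<forall>\<phi> \<in> U. prv L T (tr I \<phi>))"


section \<open>Robinson arithmetic and sequential theories\<close>

datatype arith = Zero | Succ | Plus | Times

text \<open>The arithmetical language has no relation symbols; \<open>unit\<close> is a dummy.\<close>

definition arith_lang :: "(arith, unit) lang" where
  "arith_lang = \<lparr>funs = {(Zero, 0), (Succ, 1), (Plus, 2), (Times, 2)}, rels = {}\<rparr>"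

abbreviation zero_tm :: "arith tm" where "zero_tm \<equiv> Fun Zero []"
abbreviation succ_tm :: "arith tm \<Rightarrow> arith tm" where "succ_tm t \<equiv> Fun Succ [t]"
abbreviation plus_tm :: "arith tm \<Rightarrow> arith tm \<Rightarrow> arith tm" where "plus_tm s t \<equiv> Fun Plus [s, t]"
abbreviation times_tm :: "arith tm \<Rightarrow> arith tm \<Rightarrow> arith tm" where "times_tm s t \<equiv> Fun Times [s, t]"

definition Q :: "(arith, unit) fm set" where
  "Q = {Forall (Neg (Eq (succ_tm (Var 0)) zero_tm)),
        Forall (Forall (Imp (Eq (succ_tm (Var 1)) (succ_tm (Var 0))) (Eq (Var 1) (Var 0)))),
        Forall (Disj (Eq (Var 0) zero_tm) (Exists (Eq (Var 1) (succ_tm (Var 0))))),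
        Forall (Eq (plus_tm (Var 0) zero_tm) (Var 0)),
        Forall (Forall (Eq (plus_tm (Var 1) (succ_tm (Var 0))) (succ_tm (plus_tm (Var 1) (Var 0))))),
        Forall (Eq (times_tm (Var 0) zero_tm) zero_tm),
        Forall (Forall (Eq (times_tm (Var 1) (succ_tm (Var 0))) (plus_tm (times_tm (Var 1) (Var 0)) (Var 1))))}"

text \<open>Robinson arithmetic has no primitive order; as usual, \<open>s \<le> t\<close> is \<open>\<exists>z. z + s = t\<close> and \<open>s < t\<close> is
  \<open>s \<le> t \<and> s \<noteq> t\<close>.\<close>

definition le_fm :: "arith tm \<Rightarrow> arith tm \<Rightarrow> (arith, unit) fm" where
  "le_fm s t = Exists (Eq (plus_tm (Var 0) (lift_tm s)) (lift_tm t))"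

definition lt_fm :: "arith tm \<Rightarrow> arith tm \<Rightarrow> (arith, unit) fm" where
  "lt_fm s t = Conj (le_fm s t) (Neg (Eq s t))"

text \<open>The places \<open>0, 1, 2\<close> of \<open>\<beta>\<close> are the element, the index and the sequence. Under the quantifiers
  \<open>\<forall>w x k. \<exists>w'. \<forall>i y\<close> the indices are \<open>y = 0\<close>, \<open>i = 1\<close>, \<open>w' = 2\<close>, \<open>k = 3\<close>, \<open>x = 4\<close>, \<open>w = 5\<close>.
  Relations between the numbers \<open>i\<close> and \<open>k\<close> are the interpreted ones, and the comparison \<open>i \<le> k\<close>
  includes that \<open>i\<close> is a number; \<open>y = x\<close> is identity.\<close>

definition sequence_ax :: "(arith, unit, 'f, 'p) interp \<Rightarrow> ('f, 'p) fm \<Rightarrow> ('f, 'p) fm" where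
  "sequence_ax I \<beta> = Forall (Forall (Forall (Exists (Forall (Forall
     (Imp (Conj (in_dom I 3) (Conj (in_dom I 1) (tr I (le_fm (Var 1) (Var 3)))))
       (Iff (app \<beta> [Var 0, Var 1, Var 2])
         (Disj (Conj (tr I (lt_fm (Var 1) (Var 3))) (app \<beta> [Var 0, Var 1, Var 5]))
               (Conj (tr I (Eq (Var 1) (Var 3))) (Eq (Var 0) (Var 4)))))))))))"

definition sequential :: "('f, 'p) lang \<Rightarrow> ('f, 'p) fm set \<Rightarrow> bool" where
  "sequential L T \<longleftrightarrow>
     (\<exists>I \<beta>. interprets L T arith_lang Q I \<and>
        in_lang L \<beta> \<and> fv \<beta> \<subseteq> {0, 1, 2} \<and> prv L T (sequence_ax I \<beta>))"

end

theory Submission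
  imports Defs "HOL-Library.Countable_Set" "HOL-Library.Nat_Bijection"
begin

text \<open>Suppose that \<open>T\<close> is complete and let \<open>S\<close> be a model of \<open>T\<close>. Sequences make truth of
  \<open>\<Sigma>\<^sub>n\<^sup>*\<close>-formulae with standard codes definable in \<open>S\<close>. As \<open>T\<close> follows from \<open>\<Sigma>\<^sub>n\<^sup>*\<close>-sentences, a
  sentence is false in \<open>S\<close> if and only if it is refutable from the true \<open>\<Sigma>\<^sub>n\<^sup>*\<close>-sentences, and a
  refutation is a standard finite object, coded by a sequence. Hence exactly one of a sentence and its
  negation has a standard refutation, and comparing the sizes of (possibly nonstandard) refutations, as
  in Rosser's theorem, defines truth of arbitrary standard sentences in \<open>S\<close>, contradicting Tarski's
  theorem. The diagonalization is done directly for a formula that says ``my first component is refuted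
  before my second one'' of a pair of codes, instantiated with the pair of its own code and that of its
  negation.

  All arguments are semantic. For refutability a tableau calculus on formulae with explicit
  environments is used, which avoids arithmetizing substitution; natural deduction enters only
  through its soundness and completeness.\<close>

section \<open>Semantics\<close>

text \<open>The axiom set A may fail to be recursively enumerable, so a provability predicate for it
  is not at hand. It is absorbed by a definable set: all sentences of a fixed level that are true in
  S. A structure satisfying these is a model of A, hence of T, and completeness of T, used only
  here, makes it agree with S on every sentence. The obstacle on the other side is that the numbers
  of S are only known to satisfy Q: no induction, no commutativity of addition, possibly nonstandard
  elements. Every induction therefore runs outside the model, on standard numbers, formulae or
  derivations. Two facts about Q carry the transfer: whatever lies below a standard number is
  standard, and every number is comparable with every standard one. The level is
  \<open>n + 2\<close>: writing atoms with nested terms as relational atoms costs an existential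
  block, and having them on both sides of the hierarchy costs one level more.\<close>

record ('a, 'f, 'p) struct =
  eqr :: "'a \<Rightarrow> 'a \<Rightarrow> bool"
  fint :: "'f \<Rightarrow> 'a list \<Rightarrow> 'a"
  rint :: "'p \<Rightarrow> 'a list \<Rightarrow> bool"

primrec eval :: "('a, 'f, 'p) struct \<Rightarrow> (nat \<Rightarrow> 'a) \<Rightarrow> 'f tm \<Rightarrow> 'a" where
  "eval S e (Var i) = e i"
| "eval S e (Fun f ts) = fint S f (map (eval S e) ts)"

primrec sat :: "('a, 'f, 'p) struct \<Rightarrow> (nat \<Rightarrow> 'a) \<Rightarrow> ('f, 'p) fm \<Rightarrow> bool" where
  "sat S e (Rel p ts) \<longleftrightarrow> rint S p (map (eval S e) ts)"
| "sat S e (Eq s t) \<longleftrightarrow> eqr S (eval S e s) (eval S e t)"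
| "sat S e (Neg \<phi>) \<longleftrightarrow> \<not> sat S e \<phi>"
| "sat S e (Conj \<phi> \<psi>) \<longleftrightarrow> sat S e \<phi> \<and> sat S e \<psi>"
| "sat S e (Disj \<phi> \<psi>) \<longleftrightarrow> sat S e \<phi> \<or> sat S e \<psi>"
| "sat S e (Imp \<phi> \<psi>) \<longleftrightarrow> (sat S e \<phi> \<longrightarrow> sat S e \<psi>)"
| "sat S e (Forall \<phi>) \<longleftrightarrow> (\<forall>a. sat S (case_nat a e) \<phi>)"
| "sat S e (Exists \<phi>) \<longleftrightarrow> (\<exists>a. sat S (case_nat a e) \<phi>)"

text \<open>Equality is interpreted by a congruence, which saves all quotient constructions.\<close>

definition cong_struct :: "('a, 'f, 'p) struct \<Rightarrow> bool" where
  "cong_struct S \<longleftrightarrow> equivp (eqr S) \<and>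
     (\<forall>f as bs. list_all2 (eqr S) as bs \<longrightarrow> eqr S (fint S f as) (fint S f bs)) \<and>
     (\<forall>p as bs. list_all2 (eqr S) as bs \<longrightarrow> rint S p as = rint S p bs)"

lemma eval_fv: "(\<And>i. i \<in> fv_tm t \<Longrightarrow> e i = e' i) \<Longrightarrow> eval S e t = eval S e' t"
  by (induction t) (auto intro!: arg_cong[where f = "fint S _"] map_cong)

lemma sat_fv: "(\<And>i. i \<in> fv \<phi> \<Longrightarrow> e i = e' i) \<Longrightarrow> sat S e \<phi> = sat S e' \<phi>"
proof (induction \<phi> arbitrary: e e')
  case (Rel p ts)
  have "map (eval S e) ts = map (eval S e') ts"
    using Rel by (auto intro!: eval_fv)
  then show ?case by (simp del: map_eq_conv)
next
  case (Eq s t)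
  have "eval S e s = eval S e' s" "eval S e t = eval S e' t"
    using Eq by (auto intro!: eval_fv)
  then show ?case by simp
next
  case (Conj a b)
  have "sat S e a = sat S e' a" "sat S e b = sat S e' b"
    using Conj.prems by (auto intro!: Conj.IH)
  then show ?case by simp
next
  case (Disj a b)
  have "sat S e a = sat S e' a" "sat S e b = sat S e' b"
    using Disj.prems by (auto intro!: Disj.IH)
  then show ?case by simp
next
  case (Imp a b)
  have "sat S e a = sat S e' a" "sat S e b = sat S e' b"
    using Imp.prems by (auto intro!: Imp.IH)
  then show ?case by simp
next
  case (Neg a)
  have "sat S e a = sat S e' a" using Neg.prems by (auto intro!: Neg.IH)
  then show ?case by simp
next
  case (Forall a)
  have "sat S (case_nat x e) a = sat S (case_nat x e') a" for x
    using Forall.prems by (intro Forall.IH) (auto split: nat.split)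
  then show ?case by simp
next
  case (Exists a)
  have "sat S (case_nat x e) a = sat S (case_nat x e') a" for x
    using Exists.prems by (intro Exists.IH) (auto split: nat.split)
  then show ?case by simp
qed

lemma eval_subst_tm: "eval S e (subst_tm \<sigma> t) = eval S (\<lambda>i. eval S e (\<sigma> i)) t"
  by (induction t) (auto intro!: arg_cong[where f = "fint S _"] map_cong)

lemma sat_subst: "sat S e (subst \<sigma> \<phi>) = sat S (\<lambda>i. eval S e (\<sigma> i)) \<phi>"
proof (induction \<phi> arbitrary: e \<sigma>)
  case (Forall a)
  have "(\<lambda>i. eval S (case_nat x e) (up_subst \<sigma> i)) = case_nat x (\<lambda>i. eval S e (\<sigma> i))" for x
    by (auto simp: up_subst_def eval_subst_tm fun_eq_iff split: nat.split)
  then show ?case by (simp add: Forall)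
next
  case (Exists a)
  have "(\<lambda>i. eval S (case_nat x e) (up_subst \<sigma> i)) = case_nat x (\<lambda>i. eval S e (\<sigma> i))" for x
    by (auto simp: up_subst_def eval_subst_tm fun_eq_iff split: nat.split)
  then show ?case by (simp add: Exists)
qed (auto simp: eval_subst_tm comp_def)

lemma sat_subst_top: "sat S e (subst_top t \<phi>) = sat S (case_nat (eval S e t) e) \<phi>"
proof -
  have "(\<lambda>i. eval S e (case_nat t Var i)) = case_nat (eval S e t) e"
    by (auto simp: fun_eq_iff split: nat.split)
  then show ?thesis by (simp add: sat_subst)
qed

lemma sat_lift: "sat S e (lift \<phi>) = sat S (\<lambda>i. e (Suc i)) \<phi>"
  by (simp add: sat_subst)

lemma sat_app: "sat S e (app \<phi> ts) = sat S (\<lambda>i. if i < length ts then eval S e (ts ! i) else e i) \<phi>"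
  unfolding app_def sat_subst by (rule arg_cong[where f = "\<lambda>x. sat S x \<phi>"]) auto

context
  fixes S :: "('a, 'f, 'p) struct"
  assumes S: "cong_struct S"
begin

lemma eqr_refl [simp]: "eqr S a a"
  using S by (auto simp: cong_struct_def elim: equivp_reflp)

lemma eqr_sym: "eqr S a b \<Longrightarrow> eqr S b a"
  using S by (auto simp: cong_struct_def elim: equivp_symp)

lemma eqr_trans: "eqr S a b \<Longrightarrow> eqr S b c \<Longrightarrow> eqr S a c"
  using S by (auto simp: cong_struct_def elim: equivp_transp)

lemma eval_cong: "(\<And>i. eqr S (e i) (e' i)) \<Longrightarrow> eqr S (eval S e t) (eval S e' t)"
proof (induction t)
  case (Fun f ts)
  then have "list_all2 (eqr S) (map (eval S e) ts) (map (eval S e') ts)"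
    by (auto simp: list_all2_conv_all_nth)
  then show ?case using S by (auto simp: cong_struct_def)
qed simp

lemma sat_cong: "(\<And>i. eqr S (e i) (e' i)) \<Longrightarrow> sat S e \<phi> = sat S e' \<phi>"
proof (induction \<phi> arbitrary: e e')
  case (Rel p ts)
  then have "list_all2 (eqr S) (map (eval S e) ts) (map (eval S e') ts)"
    by (auto simp: list_all2_conv_all_nth intro!: eval_cong)
  then show ?case using S by (auto simp: cong_struct_def)
next
  case (Eq s t)
  have "eqr S (eval S e s) (eval S e' s)" "eqr S (eval S e t) (eval S e' t)"
    using Eq by (auto intro: eval_cong)
  then show ?case by simp (meson eqr_sym eqr_trans)
next
  case (Forall a)
  have "sat S (case_nat x e) a = sat S (case_nat x e') a" for x
    using Forall.prems by (intro Forall.IH) (auto split: nat.split)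
  then show ?case by simp
next
  case (Exists a)
  have "sat S (case_nat x e) a = sat S (case_nat x e') a" for x
    using Exists.prems by (intro Exists.IH) (auto split: nat.split)
  then show ?case by simp
next
  case (Conj a b)
  show ?case using Conj.IH(1)[OF Conj.prems] Conj.IH(2)[OF Conj.prems] by simp
next
  case (Disj a b)
  show ?case using Disj.IH(1)[OF Disj.prems] Disj.IH(2)[OF Disj.prems] by simp
next
  case (Imp a b)
  show ?case using Imp.IH(1)[OF Imp.prems] Imp.IH(2)[OF Imp.prems] by simp
next
  case (Neg a)
  show ?case using Neg.IH[OF Neg.prems] by simp
qed

theorem prv_sound: "prv L \<Gamma> \<phi> \<Longrightarrow> (\<And>\<gamma>. \<gamma> \<in> \<Gamma> \<Longrightarrow> sat S e \<gamma>) \<Longrightarrow> sat S e \<phi>"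
proof (induction arbitrary: e rule: prv.induct)
  case (Classical \<phi> \<Gamma> \<psi>)
  show ?case
  proof (rule ccontr)
    assume "\<not> sat S e \<phi>"
    then have "\<And>\<gamma>. \<gamma> \<in> insert (Neg \<phi>) \<Gamma> \<Longrightarrow> sat S e \<gamma>" using Classical.prems by auto
    from Classical.IH(1)[OF this] Classical.IH(2)[OF this] show False by simp
  qed
next
  case (NegI \<phi> \<Gamma> \<psi>)
  show ?case
  proof (rule ccontr)
    assume "\<not> sat S e (Neg \<phi>)"
    then have "\<And>\<gamma>. \<gamma> \<in> insert \<phi> \<Gamma> \<Longrightarrow> sat S e \<gamma>" using NegI.prems by auto
    from NegI.IH(1)[OF this] NegI.IH(2)[OF this] show False by simp
  qed
next
  case (DisjE \<Gamma> \<phi> \<psi> \<chi>)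
  have "sat S e \<phi> \<or> sat S e \<psi>" using DisjE.IH(1)[OF DisjE.prems] by simp
  then show ?case
  proof
    assume "sat S e \<phi>"
    then have "\<And>\<gamma>. \<gamma> \<in> insert \<phi> \<Gamma> \<Longrightarrow> sat S e \<gamma>" using DisjE.prems by auto
    from DisjE.IH(2)[OF this] show ?thesis .
  next
    assume "sat S e \<psi>"
    then have "\<And>\<gamma>. \<gamma> \<in> insert \<psi> \<Gamma> \<Longrightarrow> sat S e \<gamma>" using DisjE.prems by auto
    from DisjE.IH(3)[OF this] show ?thesis .
  qed
next
  case (ImpI \<phi> \<Gamma> \<psi>)
  have "sat S e \<psi>" if "sat S e \<phi>"
  proof -
    from that have "\<And>\<gamma>. \<gamma> \<in> insert \<phi> \<Gamma> \<Longrightarrow> sat S e \<gamma>" using ImpI.prems by auto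
    from ImpI.IH[OF this] show ?thesis .
  qed
  then show ?case by simp
next
  case (ImpE \<Gamma> \<phi> \<psi>)
  show ?case using ImpE.IH(1)[OF ImpE.prems] ImpE.IH(2)[OF ImpE.prems] by simp
next
  case (ConjE1 \<Gamma> \<phi> \<psi>)
  show ?case using ConjE1.IH[OF ConjE1.prems] by simp
next
  case (ConjE2 \<Gamma> \<phi> \<psi>)
  show ?case using ConjE2.IH[OF ConjE2.prems] by simp
next
  case (AllI \<Gamma> \<phi>)
  have "sat S (case_nat a e) \<phi>" for a
    by (rule AllI.IH) (use AllI.prems in \<open>auto simp: sat_lift\<close>)
  then show ?case by simp
next
  case (AllE \<Gamma> \<phi> t)
  show ?case using AllE.IH[OF AllE.prems] by (simp add: sat_subst_top)
next
  case (ExI \<phi> t \<Gamma>)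
  show ?case using ExI.IH[OF ExI.prems] by (auto simp: sat_subst_top)
next
  case (ExE \<Gamma> \<phi> \<psi>)
  obtain a where "sat S (case_nat a e) \<phi>" using ExE.IH(1)[OF ExE.prems] by auto
  then have "sat S (case_nat a e) (lift \<psi>)"
    by (intro ExE.IH(2)) (use ExE.prems in \<open>auto simp: sat_lift\<close>)
  then show ?case by (simp add: sat_lift)
next
  case (EqE \<phi> \<Gamma> s t)
  have "eqr S (eval S e s) (eval S e t)" using EqE.IH(1)[OF EqE.prems] by simp
  then have "sat S (case_nat (eval S e s) e) \<phi> = sat S (case_nat (eval S e t) e) \<phi>"
    by (intro sat_cong) (auto split: nat.split)
  then show ?case using EqE.IH(2)[OF EqE.prems] by (simp add: sat_subst_top)
qed simp_all

end

section \<open>Substitution and structural properties of natural deduction\<close>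

lemma subst_tm_comp: "subst_tm \<sigma> (subst_tm \<tau> t) = subst_tm (\<lambda>i. subst_tm \<sigma> (\<tau> i)) t"
  by (induction t) auto

lemma subst_tm_fv: "(\<And>i. i \<in> fv_tm t \<Longrightarrow> \<sigma> i = \<tau> i) \<Longrightarrow> subst_tm \<sigma> t = subst_tm \<tau> t"
  by (induction t) auto

lemma subst_tm_Var [simp]: "subst_tm Var t = t"
  by (induction t) (auto intro: map_idI)

lemma up_subst_comp: "subst_tm (up_subst \<sigma>) (up_subst \<tau> i) = up_subst (\<lambda>i. subst_tm \<sigma> (\<tau> i)) i"
  by (cases i) (auto simp: up_subst_def subst_tm_comp)

lemma up_subst_Var [simp]: "up_subst Var = Var"
  by (auto simp: up_subst_def fun_eq_iff split: nat.split)

lemma subst_comp: "subst \<sigma> (subst \<tau> \<phi>) = subst (\<lambda>i. subst_tm \<sigma> (\<tau> i)) \<phi>"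
  by (induction \<phi> arbitrary: \<sigma> \<tau>) (auto simp: subst_tm_comp up_subst_comp)

lemma subst_fv: "(\<And>i. i \<in> fv \<phi> \<Longrightarrow> \<sigma> i = \<tau> i) \<Longrightarrow> subst \<sigma> \<phi> = subst \<tau> \<phi>"
proof (induction \<phi> arbitrary: \<sigma> \<tau>)
  case (Forall \<phi>)
  have "subst (up_subst \<sigma>) \<phi> = subst (up_subst \<tau>) \<phi>"
    by (rule Forall.IH) (use Forall.prems in \<open>auto simp: up_subst_def split: nat.split\<close>)
  then show ?case by simp
next
  case (Exists \<phi>)
  have "subst (up_subst \<sigma>) \<phi> = subst (up_subst \<tau>) \<phi>"
    by (rule Exists.IH) (use Exists.prems in \<open>auto simp: up_subst_def split: nat.split\<close>)
  then show ?case by simp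
next
  case (Conj \<phi> \<psi>)
  have "subst \<sigma> \<phi> = subst \<tau> \<phi>" "subst \<sigma> \<psi> = subst \<tau> \<psi>"
    using Conj.prems by (auto intro!: Conj.IH)
  then show ?case by simp
next
  case (Disj \<phi> \<psi>)
  have "subst \<sigma> \<phi> = subst \<tau> \<phi>" "subst \<sigma> \<psi> = subst \<tau> \<psi>"
    using Disj.prems by (auto intro!: Disj.IH)
  then show ?case by simp
next
  case (Imp \<phi> \<psi>)
  have "subst \<sigma> \<phi> = subst \<tau> \<phi>" "subst \<sigma> \<psi> = subst \<tau> \<psi>"
    using Imp.prems by (auto intro!: Imp.IH)
  then show ?case by simp
next
  case (Neg \<phi>)
  have "subst \<sigma> \<phi> = subst \<tau> \<phi>"
    using Neg.prems by (auto intro!: Neg.IH)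
  then show ?case by simp
qed (auto intro!: subst_tm_fv)

lemma subst_Var [simp]: "subst Var \<phi> = \<phi>"
  by (induction \<phi>) (auto intro: map_idI)

lemma subst_up_lift: "subst (up_subst \<sigma>) (lift \<phi>) = lift (subst \<sigma> \<phi>)"
  by (simp add: subst_comp up_subst_def)

lemma subst_subst_top: "subst \<sigma> (subst_top t \<phi>) = subst_top (subst_tm \<sigma> t) (subst (up_subst \<sigma>) \<phi>)"
  unfolding subst_comp
  by (rule subst_fv) (auto simp: up_subst_def subst_tm_comp split: nat.split)

lemma in_lang_subst_tm: "(\<And>i. in_lang_tm L (\<sigma> i)) \<Longrightarrow> in_lang_tm L t \<Longrightarrow> in_lang_tm L (subst_tm \<sigma> t)"
  by (induction t) (auto simp: list_all_iff)

lemma in_lang_subst_tm_rev: "in_lang_tm L (subst_tm \<sigma> t) \<Longrightarrow> in_lang_tm L t"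
  by (induction t) (auto simp: list_all_iff)

lemma in_lang_up: "(\<And>i. in_lang_tm L (\<sigma> i)) \<Longrightarrow> in_lang_tm L (up_subst \<sigma> i)"
  by (auto simp: up_subst_def in_lang_subst_tm split: nat.split)

lemma in_lang_subst: "(\<And>i. in_lang_tm L (\<sigma> i)) \<Longrightarrow> in_lang L \<phi> \<Longrightarrow> in_lang L (subst \<sigma> \<phi>)"
  by (induction \<phi> arbitrary: \<sigma>) (auto simp: list_all_iff in_lang_subst_tm in_lang_up)

lemma in_lang_subst_rev: "in_lang L (subst \<sigma> \<phi>) \<Longrightarrow> in_lang L \<phi>"
  by (induction \<phi> arbitrary: \<sigma>) (auto simp: list_all_iff in_lang_subst_tm_rev)

lemma in_lang_lift [simp]: "in_lang L (lift \<phi>) = in_lang L \<phi>"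
  by (auto intro: in_lang_subst in_lang_subst_rev)

lemma in_lang_subst_top: "in_lang_tm L t \<Longrightarrow> in_lang L \<phi> \<Longrightarrow> in_lang L (subst_top t \<phi>)"
  by (rule in_lang_subst) (auto split: nat.split)

lemma in_lang_app: "list_all (in_lang_tm L) ts \<Longrightarrow> in_lang L \<phi> \<Longrightarrow> in_lang L (app \<phi> ts)"
  unfolding app_def by (rule in_lang_subst) (auto simp: list_all_iff)

lemma prv_in_lang: "prv L \<Gamma> \<phi> \<Longrightarrow> in_lang L \<phi>"
  by (induction rule: prv.induct) (auto intro: in_lang_subst_top)

lemma prv_mono: "prv L \<Gamma> \<phi> \<Longrightarrow> \<Gamma> \<subseteq> \<Delta> \<Longrightarrow> prv L \<Delta> \<phi>"
proof (induction arbitrary: \<Delta> rule: prv.induct)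
  case (Asm \<phi> \<Gamma>)
  then show ?case by (auto intro: prv.Asm)
next
  case (NegI \<phi> \<Gamma> \<psi>)
  from NegI.prems have s: "insert \<phi> \<Gamma> \<subseteq> insert \<phi> \<Delta>" by auto
  show ?case by (rule prv.NegI[OF NegI.hyps(1) NegI.IH(1)[OF s] NegI.IH(2)[OF s]])
next
  case (Classical \<phi> \<Gamma> \<psi>)
  from Classical.prems have s: "insert (Neg \<phi>) \<Gamma> \<subseteq> insert (Neg \<phi>) \<Delta>" by auto
  show ?case by (rule prv.Classical[OF Classical.hyps(1) Classical.IH(1)[OF s] Classical.IH(2)[OF s]])
next
  case (DisjE \<Gamma> \<phi> \<psi> \<chi>)
  from DisjE.prems have s: "insert \<phi> \<Gamma> \<subseteq> insert \<phi> \<Delta>" "insert \<psi> \<Gamma> \<subseteq> insert \<psi> \<Delta>" by auto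
  show ?case by (rule prv.DisjE[OF DisjE.IH(1)[OF DisjE.prems] DisjE.IH(2)[OF s(1)] DisjE.IH(3)[OF s(2)]])
next
  case (ImpI \<phi> \<Gamma> \<psi>)
  from ImpI.prems have "insert \<phi> \<Gamma> \<subseteq> insert \<phi> \<Delta>" by auto
  then show ?case by (rule prv.ImpI[OF ImpI.hyps(1) ImpI.IH])
next
  case (AllI \<Gamma> \<phi>)
  from AllI.prems have "lift ` \<Gamma> \<subseteq> lift ` \<Delta>" by auto
  then show ?case by (rule prv.AllI[OF AllI.IH])
next
  case (ExE \<Gamma> \<phi> \<psi>)
  from ExE.prems have "insert \<phi> (lift ` \<Gamma>) \<subseteq> insert \<phi> (lift ` \<Delta>)" by auto
  then show ?case by (rule prv.ExE[OF ExE.IH(1)[OF ExE.prems] ExE.IH(2)])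
next
  case (ImpE \<Gamma> \<phi> \<psi>)
  show ?case by (rule prv.ImpE[OF ImpE.IH(1)[OF ImpE.prems] ImpE.IH(2)[OF ImpE.prems]])
next
  case (ConjE1 \<Gamma> \<phi> \<psi>)
  show ?case by (rule prv.ConjE1[OF ConjE1.IH[OF ConjE1.prems]])
next
  case (ConjE2 \<Gamma> \<phi> \<psi>)
  show ?case by (rule prv.ConjE2[OF ConjE2.IH[OF ConjE2.prems]])
next
  case (AllE \<Gamma> \<phi> t)
  show ?case by (rule prv.AllE[OF AllE.IH[OF AllE.prems] AllE.hyps(2)])
next
  case (EqE \<phi> \<Gamma> s t)
  show ?case by (rule prv.EqE[OF EqE.hyps(1) EqE.IH(1)[OF EqE.prems] EqE.IH(2)[OF EqE.prems]])
next
  case (ConjI \<Gamma> \<phi> \<psi>)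
  show ?case by (rule prv.ConjI[OF ConjI.IH(1)[OF ConjI.prems] ConjI.IH(2)[OF ConjI.prems]])
next
  case (DisjI1 \<Gamma> \<phi> \<psi>)
  show ?case by (rule prv.DisjI1[OF DisjI1.IH[OF DisjI1.prems] DisjI1.hyps(2)])
next
  case (DisjI2 \<Gamma> \<psi> \<phi>)
  show ?case by (rule prv.DisjI2[OF DisjI2.IH[OF DisjI2.prems] DisjI2.hyps(2)])
next
  case (ExI \<phi> t \<Gamma>)
  show ?case by (rule prv.ExI[OF ExI.hyps(1,2) ExI.IH[OF ExI.prems]])
qed (rule prv.EqI)

lemma prv_finite:
  "prv L \<Gamma> \<phi> \<Longrightarrow> \<exists>\<Delta>. finite \<Delta> \<and> \<Delta> \<subseteq> \<Gamma> \<and> prv L \<Delta> \<phi>"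
proof (induction rule: prv.induct)
  case (Asm \<phi> \<Gamma>)
  then show ?case by (intro exI[of _ "{\<phi>}"]) (auto intro: prv.Asm)
next
  case (NegI \<phi> \<Gamma> \<psi>)
  then obtain A B where "finite A" "A \<subseteq> insert \<phi> \<Gamma>" "prv L A \<psi>" "finite B" "B \<subseteq> insert \<phi> \<Gamma>" "prv L B (Neg \<psi>)"
    by blast
  then show ?case using NegI.hyps
    by (intro exI[of _ "(A \<union> B) - {\<phi>}"])
      (auto intro!: prv.NegI[of L \<phi> _ \<psi>] elim!: prv_mono)
next
  case (Classical \<phi> \<Gamma> \<psi>)
  then obtain A B where "finite A" "A \<subseteq> insert (Neg \<phi>) \<Gamma>" "prv L A \<psi>" "finite B" "B \<subseteq> insert (Neg \<phi>) \<Gamma>" "prv L B (Neg \<psi>)"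
    by blast
  then show ?case using Classical.hyps
    by (intro exI[of _ "(A \<union> B) - {Neg \<phi>}"])
      (auto intro!: prv.Classical[of L \<phi> _ \<psi>] elim!: prv_mono)
next
  case (ConjI \<Gamma> \<phi> \<psi>)
  then obtain A B where "finite A" "A \<subseteq> \<Gamma>" "prv L A \<phi>" "finite B" "B \<subseteq> \<Gamma>" "prv L B \<psi>"
    by blast
  then show ?case by (intro exI[of _ "A \<union> B"]) (auto intro!: prv.ConjI elim!: prv_mono)
next
  case (DisjE \<Gamma> \<phi> \<psi> \<chi>)
  then obtain A B C where *: "finite A" "A \<subseteq> \<Gamma>" "prv L A (Disj \<phi> \<psi>)"
    "finite B" "B \<subseteq> insert \<phi> \<Gamma>" "prv L B \<chi>" "finite C" "C \<subseteq> insert \<psi> \<Gamma>" "prv L C \<chi>"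
    by blast
  let ?D = "A \<union> (B - {\<phi>}) \<union> (C - {\<psi>})"
  have "prv L ?D (Disj \<phi> \<psi>)" "prv L (insert \<phi> ?D) \<chi>" "prv L (insert \<psi> ?D) \<chi>"
    by (rule prv_mono[OF *(3)], blast) (rule prv_mono[OF *(6)], blast, rule prv_mono[OF *(9)], blast)
  then have "prv L ?D \<chi>" by (rule prv.DisjE)
  moreover have "finite ?D" "?D \<subseteq> \<Gamma>" using *(1,2,4,5,7,8) by auto
  ultimately show ?case by (intro exI[of _ ?D] conjI)
next
  case (ImpI \<phi> \<Gamma> \<psi>)
  then obtain A where "finite A" "A \<subseteq> insert \<phi> \<Gamma>" "prv L A \<psi>"
    by blast
  then show ?case using ImpI.hyps
    by (intro exI[of _ "A - {\<phi>}"]) (auto intro!: prv.ImpI elim!: prv_mono)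
next
  case (ImpE \<Gamma> \<phi> \<psi>)
  then obtain A B where "finite A" "A \<subseteq> \<Gamma>" "prv L A (Imp \<phi> \<psi>)" "finite B" "B \<subseteq> \<Gamma>" "prv L B \<phi>"
    by blast
  then show ?case
    by (intro exI[of _ "A \<union> B"]) (auto intro!: prv.ImpE[of L _ \<phi> \<psi>] elim!: prv_mono)
next
  case (AllI \<Gamma> \<phi>)
  then obtain A where "finite A" "A \<subseteq> lift ` \<Gamma>" "prv L A \<phi>" by blast
  then obtain B where "finite B" "B \<subseteq> \<Gamma>" "A = lift ` B" by (metis finite_subset_image)
  with \<open>prv L A \<phi>\<close> show ?case by (auto intro: prv.AllI)
next
  case (ExE \<Gamma> \<phi> \<psi>)
  then obtain A C where A: "finite A" "A \<subseteq> insert \<phi> (lift ` \<Gamma>)" "prv L A (lift \<psi>)"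
    and C: "finite C" "C \<subseteq> \<Gamma>" "prv L C (Exists \<phi>)" by blast
  have "A - {\<phi>} \<subseteq> lift ` \<Gamma>" "finite (A - {\<phi>})" using A by auto
  then obtain B where B: "finite B" "B \<subseteq> \<Gamma>" "A - {\<phi>} = lift ` B" by (metis finite_subset_image)
  have "prv L (insert \<phi> (lift ` (B \<union> C))) (lift \<psi>)"
    using A(3) by (rule prv_mono) (use B in auto)
  moreover have "prv L (B \<union> C) (Exists \<phi>)" using C(3) by (rule prv_mono) auto
  ultimately have "prv L (B \<union> C) \<psi>" by (rule prv.ExE[rotated])
  then show ?case using B C by blast
next
  case (EqE \<phi> \<Gamma> s t)
  then obtain A B where "finite A" "A \<subseteq> \<Gamma>" "prv L A (Eq s t)" "finite B" "B \<subseteq> \<Gamma>" "prv L B (subst_top s \<phi>)"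
    by blast
  then show ?case using EqE.hyps
    by (intro exI[of _ "A \<union> B"]) (auto intro!: prv.EqE[of L _ _ s t] elim!: prv_mono)
next
  case (EqI t \<Gamma>)
  then show ?case by (intro exI[of _ "{}"]) (auto intro: prv.EqI)
qed (blast intro: prv.intros)+

text \<open>Substitution commutes with \<open>lift\<close> and with instantiation, so each rule is
  mapped to an instance of itself. The lemma serves to rename a fresh variable in
  \<open>prv_fresh\<close> and to carry a derivation under a quantifier.\<close>

lemma prv_subst:
  "prv L \<Gamma> \<phi> \<Longrightarrow> (\<And>i. in_lang_tm L (\<sigma> i)) \<Longrightarrow> prv L (subst \<sigma> ` \<Gamma>) (subst \<sigma> \<phi>)"
proof (induction arbitrary: \<sigma> rule: prv.induct)
  case (Asm \<phi> \<Gamma>)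
  then show ?case by (auto intro: prv.Asm in_lang_subst)
next
  case (NegI \<phi> \<Gamma> \<psi>)
  show ?case
    using NegI.IH[of \<sigma>, OF NegI.prems] in_lang_subst[of L \<sigma>, OF NegI.prems NegI.hyps(1)]
    by (auto intro: prv.NegI)
next
  case (Classical \<phi> \<Gamma> \<psi>)
  show ?case
    using Classical.IH[of \<sigma>, OF Classical.prems] in_lang_subst[of L \<sigma>, OF Classical.prems Classical.hyps(1)]
    by (auto intro: prv.Classical)
next
  case (DisjE \<Gamma> \<phi> \<psi> \<chi>)
  show ?case using DisjE.IH[of \<sigma>, OF DisjE.prems] by (auto intro: prv.DisjE)
next
  case (ImpI \<phi> \<Gamma> \<psi>)
  show ?case
    using ImpI.IH[of \<sigma>, OF ImpI.prems] in_lang_subst[of L \<sigma>, OF ImpI.prems ImpI.hyps(1)]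
    by (auto intro: prv.ImpI)
next
  case (ImpE \<Gamma> \<phi> \<psi>)
  show ?case using ImpE.IH[of \<sigma>, OF ImpE.prems] by (auto intro: prv.ImpE)
next
  case (AllI \<Gamma> \<phi>)
  have "prv L (subst (up_subst \<sigma>) ` lift ` \<Gamma>) (subst (up_subst \<sigma>) \<phi>)"
    by (rule AllI.IH) (rule in_lang_up[OF AllI.prems])
  moreover have "subst (up_subst \<sigma>) ` lift ` \<Gamma> = lift ` subst \<sigma> ` \<Gamma>"
    by (simp add: image_image subst_up_lift)
  ultimately show ?case by (auto intro: prv.AllI)
next
  case (AllE \<Gamma> \<phi> t)
  have "prv L (subst \<sigma> ` \<Gamma>) (Forall (subst (up_subst \<sigma>) \<phi>))"
    using AllE.IH[of \<sigma>, OF AllE.prems] by simp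
  from prv.AllE[OF this in_lang_subst_tm[of L \<sigma>, OF AllE.prems AllE.hyps(2)]] show ?case
    by (simp add: subst_subst_top)
next
  case (ExI \<phi> t \<Gamma>)
  show ?case
    using ExI.IH[of \<sigma>, OF ExI.prems] in_lang_subst_tm[of L \<sigma>, OF ExI.prems ExI.hyps(2)]
      in_lang_subst[of L "up_subst \<sigma>", OF in_lang_up[OF ExI.prems] ExI.hyps(1)]
    by (auto intro: prv.ExI simp: subst_subst_top)
next
  case (ExE \<Gamma> \<phi> \<psi>)
  have "prv L (subst (up_subst \<sigma>) ` (insert \<phi> (lift ` \<Gamma>))) (subst (up_subst \<sigma>) (lift \<psi>))"
    by (rule ExE.IH) (rule in_lang_up[OF ExE.prems])
  then have "prv L (insert (subst (up_subst \<sigma>) \<phi>) (lift ` subst \<sigma> ` \<Gamma>)) (lift (subst \<sigma> \<psi>))"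
    by (simp add: image_image subst_up_lift)
  moreover have "prv L (subst \<sigma> ` \<Gamma>) (Exists (subst (up_subst \<sigma>) \<phi>))"
    using ExE.IH(1)[OF ExE.prems] by simp
  ultimately show ?case by (rule prv.ExE[rotated])
next
  case (EqI t \<Gamma>)
  show ?case using in_lang_subst_tm[of L \<sigma>, OF EqI.prems EqI.hyps] by (auto intro: prv.EqI)
next
  case (EqE \<phi> \<Gamma> s t)
  have "prv L (subst \<sigma> ` \<Gamma>) (subst_top (subst_tm \<sigma> t) (subst (up_subst \<sigma>) \<phi>))"
    using EqE.IH[of \<sigma>, OF EqE.prems] in_lang_subst[of L "up_subst \<sigma>", OF in_lang_up[OF EqE.prems] EqE.hyps(1)]
    by (auto intro: prv.EqE simp: subst_subst_top)
  then show ?case by (simp add: subst_subst_top)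
next
  case (ConjI \<Gamma> \<phi> \<psi>)
  show ?case using ConjI.IH[of \<sigma>, OF ConjI.prems] by (auto intro: prv.ConjI)
next
  case (ConjE1 \<Gamma> \<phi> \<psi>)
  show ?case using ConjE1.IH[of \<sigma>, OF ConjE1.prems] by (auto intro: prv.ConjE1)
next
  case (ConjE2 \<Gamma> \<phi> \<psi>)
  show ?case using ConjE2.IH[of \<sigma>, OF ConjE2.prems] by (auto intro: prv.ConjE2)
next
  case (DisjI1 \<Gamma> \<phi> \<psi>)
  show ?case
    using DisjI1.IH[of \<sigma>, OF DisjI1.prems] in_lang_subst[of L \<sigma>, OF DisjI1.prems DisjI1.hyps(2)]
    by (auto intro: prv.DisjI1)
next
  case (DisjI2 \<Gamma> \<psi> \<phi>)
  show ?case
    using DisjI2.IH[of \<sigma>, OF DisjI2.prems] in_lang_subst[of L \<sigma>, OF DisjI2.prems DisjI2.hyps(2)]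
    by (auto intro: prv.DisjI2)
qed

section \<open>Completeness\<close>

lemma consistent_insert:
  assumes "consistent L \<Gamma>" "in_lang L \<phi>"
  shows "consistent L (insert \<phi> \<Gamma>) \<or> consistent L (insert (Neg \<phi>) \<Gamma>)"
proof (rule ccontr)
  assume *: "\<not> ?thesis"
  then obtain \<psi> where "prv L (insert \<phi> \<Gamma>) \<psi>" "prv L (insert \<phi> \<Gamma>) (Neg \<psi>)"
    by (auto simp: consistent_def)
  from prv.NegI[OF assms(2) this] have "prv L \<Gamma> (Neg \<phi>)" .
  from * obtain \<psi> where "prv L (insert (Neg \<phi>) \<Gamma>) \<psi>" "prv L (insert (Neg \<phi>) \<Gamma>) (Neg \<psi>)"
    by (auto simp: consistent_def)
  from prv.Classical[OF assms(2) this] have "prv L \<Gamma> \<phi>" .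
  with \<open>prv L \<Gamma> (Neg \<phi>)\<close> assms(1) show False by (auto simp: consistent_def)
qed

lemma inconsistent_prv:
  assumes "\<not> consistent L \<Gamma>" "in_lang L \<phi>"
  shows "prv L \<Gamma> \<phi>"
proof -
  obtain \<psi> where "prv L \<Gamma> \<psi>" "prv L \<Gamma> (Neg \<psi>)" using assms(1) by (auto simp: consistent_def)
  then have "prv L (insert (Neg \<phi>) \<Gamma>) \<psi>" "prv L (insert (Neg \<phi>) \<Gamma>) (Neg \<psi>)"
    by (auto elim: prv_mono)
  then show ?thesis by (rule prv.Classical[OF assms(2)])
qed

text \<open>\<open>AllI\<close> knows only index 0 as a fresh variable; here any fresh k will do.
  The renaming that sends k to 0 and shifts all other variables acts as \<open>lift\<close> on
  \<Gamma> and undoes the instantiation of \<phi> at k.\<close>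

lemma prv_fresh:
  assumes "prv L \<Gamma> (subst_top (Var k) \<phi>)"
    and "\<And>\<gamma>. \<gamma> \<in> \<Gamma> \<Longrightarrow> k \<notin> fv \<gamma>" and "Suc k \<notin> fv \<phi>"
  shows "prv L \<Gamma> (Forall \<phi>)"
proof -
  let ?\<sigma> = "\<lambda>i. if i = k then Var 0 else Var (Suc i)"
  have "prv L (subst ?\<sigma> ` \<Gamma>) (subst ?\<sigma> (subst_top (Var k) \<phi>))"
    by (rule prv_subst[OF assms(1)]) simp
  moreover have "subst ?\<sigma> ` \<Gamma> = lift ` \<Gamma>"
    by (rule image_cong[OF refl], rule subst_fv) (use assms(2) in auto)
  moreover have "subst ?\<sigma> (subst_top (Var k) \<phi>) = subst Var \<phi>"
    unfolding subst_comp by (rule subst_fv) (use assms(3) in \<open>auto split: nat.split\<close>)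
  ultimately show ?thesis by (auto intro: prv.AllI)
qed

text \<open>A refutation of the instance at a fresh variable generalizes to
  \<open>Forall (Neg \<phi>)\<close>, which contradicts \<open>Exists \<phi>\<close>.\<close>

lemma consistent_witness:
  assumes "consistent L \<Gamma>" "Exists \<phi> \<in> \<Gamma>" "in_lang L \<phi>" and "\<And>\<gamma>. \<gamma> \<in> \<Gamma> \<Longrightarrow> k \<notin> fv \<gamma>"
  shows "consistent L (insert (subst_top (Var k) \<phi>) \<Gamma>)"
proof (rule ccontr)
  let ?\<psi> = "subst_top (Var k) \<phi>"
  assume "\<not> ?thesis"
  then obtain \<psi> where "prv L (insert ?\<psi> \<Gamma>) \<psi>" "prv L (insert ?\<psi> \<Gamma>) (Neg \<psi>)"
    by (auto simp: consistent_def)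
  moreover have "in_lang L ?\<psi>" using assms(3) by (simp add: in_lang_subst_top)
  ultimately have "prv L \<Gamma> (Neg ?\<psi>)" by (auto intro: prv.NegI)
  then have "prv L \<Gamma> (Forall (Neg \<phi>))"
    using assms by (intro prv_fresh[of _ _ k]) fastforce+
  \<comment> \<open>In this context \<open>ExE\<close> has to derive its conclusion. The lifted
    universal statement, instantiated at index 0, yields the negation of \<phi> there, so everything
    is derivable.\<close>
  let ?\<Delta> = "insert \<phi> (lift ` \<Gamma>)"
  have "prv L (lift ` \<Gamma>) (lift (Forall (Neg \<phi>)))"
    by (rule prv_subst) (fact, simp)
  then have "prv L ?\<Delta> (Forall (Neg (subst (up_subst (\<lambda>i. Var (Suc i))) \<phi>)))"
    by (auto elim: prv_mono)
  from prv.AllE[OF this, of "Var 0"]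
  have "prv L ?\<Delta> (Neg (subst_top (Var 0) (subst (up_subst (\<lambda>i. Var (Suc i))) \<phi>)))" by simp
  moreover have "subst_top (Var 0) (subst (up_subst (\<lambda>i. Var (Suc i))) \<phi>) = subst Var \<phi>"
    unfolding subst_comp by (rule subst_fv) (auto simp: up_subst_def split: nat.split)
  ultimately have "prv L ?\<Delta> (Neg \<phi>)" by simp
  moreover have "prv L ?\<Delta> \<phi>" using assms(3) by (auto intro: prv.Asm)
  ultimately have inc: "\<not> consistent L ?\<Delta>" by (auto simp: consistent_def)
  have ex: "prv L \<Gamma> (Exists \<phi>)" using assms(2,3) by (auto intro: prv.Asm)
  have "prv L \<Gamma> (Exists \<phi>)" "prv L \<Gamma> (Neg (Exists \<phi>))"
    by (rule ex) (rule prv.ExE[OF ex inconsistent_prv[OF inc]],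
        use in_lang_lift[of L "Neg (Exists \<phi>)"] assms(3) in simp)
  with assms(1) show False by (auto simp: consistent_def)
qed

lemma consistent_counterexample:
  assumes "consistent L \<Gamma>" "Neg (Forall \<phi>) \<in> \<Gamma>" "in_lang L \<phi>" and "\<And>\<gamma>. \<gamma> \<in> \<Gamma> \<Longrightarrow> k \<notin> fv \<gamma>"
  shows "consistent L (insert (Neg (subst_top (Var k) \<phi>)) \<Gamma>)"
proof (rule ccontr)
  let ?\<psi> = "subst_top (Var k) \<phi>"
  assume "\<not> ?thesis"
  then obtain \<psi> where "prv L (insert (Neg ?\<psi>) \<Gamma>) \<psi>" "prv L (insert (Neg ?\<psi>) \<Gamma>) (Neg \<psi>)"
    by (auto simp: consistent_def)
  moreover have "in_lang L ?\<psi>" using assms(3) by (simp add: in_lang_subst_top)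
  ultimately have "prv L \<Gamma> ?\<psi>" by (auto intro: prv.Classical)
  then have "prv L \<Gamma> (Forall \<phi>)"
    using assms by (intro prv_fresh[of _ _ k]) fastforce+
  moreover have "prv L \<Gamma> (Neg (Forall \<phi>))" using assms(2,3) by (auto intro: prv.Asm)
  ultimately show False using assms(1) by (auto simp: consistent_def)
qed

lemma finite_fv_tm: "finite (fv_tm t)"
  by (induction t) auto

lemma finite_fv: "finite (fv \<phi>)"
  by (induction \<phi>) (auto simp: finite_fv_tm simp flip: vimage_def intro: finite_vimageI)

instance tm :: (countable) countable by countable_datatype
instance fm :: (countable, countable) countable by countable_datatype

text \<open>The symbol types themselves may be uncountable. The finitely many symbols of L are
  renamed to numbers, formulae over numbers are countable, and renaming back is the identity on
  L-formulae.\<close>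

lemma countable_lang:
  assumes "finite_lang L"
  shows "countable {\<phi>. in_lang L \<phi>}"
proof -
  define F P where "F = fst ` funs L" and "P = fst ` rels L"
  have "countable F" "countable P"
    using assms by (auto simp: finite_lang_def F_def P_def intro: countable_finite)
  let ?f = "from_nat_into F" and ?p = "from_nat_into P"
  let ?f' = "to_nat_on F" and ?p' = "to_nat_on P"
  have tm: "map_tm ?f (map_tm ?f' t) = t" if "in_lang_tm L t" for t
    using that
  proof (induction t)
    case (Fun f ts)
    then have "f \<in> F" by (force simp: F_def)
    then show ?case using Fun \<open>countable F\<close> by (auto simp: list_all_iff map_idI)
  qed simp
  have "map_fm ?f ?p (map_fm ?f' ?p' \<phi>) = \<phi>" if "in_lang L \<phi>" for \<phi>
    using that
  proof (induction \<phi>)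
    case (Rel p ts)
    then have "p \<in> P" by (force simp: P_def)
    then show ?case using Rel \<open>countable P\<close> tm by (auto simp: list_all_iff map_idI)
  qed (auto simp: tm)
  then have "{\<phi>. in_lang L \<phi>} \<subseteq> range (map_fm ?f ?p)" by (metis (mono_tags) mem_Collect_eq rangeI subsetI)
  then show ?thesis by (meson countableI_type countable_image countable_subset)
qed

text \<open>Variables play the role of Henkin constants, so the language is never extended: T
  consists of sentences and each stage adds finitely many free variables. Negated universal formulae
  have a clause of their own because both quantifiers are primitive.\<close>

definition henkin :: "('f, 'p) lang \<Rightarrow> ('f, 'p) fm set \<Rightarrow> bool" where
  "henkin L H \<longleftrightarrow> consistent L H \<and> (\<forall>\<phi>. in_lang L \<phi> \<longrightarrow> \<phi> \<in> H \<or> Neg \<phi> \<in> H) \<and>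
     (\<forall>\<phi>. Exists \<phi> \<in> H \<longrightarrow> in_lang L \<phi> \<longrightarrow> (\<exists>k. subst_top (Var k) \<phi> \<in> H)) \<and>
     (\<forall>\<phi>. Neg (Forall \<phi>) \<in> H \<longrightarrow> in_lang L \<phi> \<longrightarrow> (\<exists>k. Neg (subst_top (Var k) \<phi>) \<in> H))"

lemma henkin_step:
  assumes "consistent L \<Gamma>" "finite (\<Union> (fv ` \<Gamma>))" "in_lang L \<phi>"
  shows "\<exists>\<Delta>. \<Gamma> \<subseteq> \<Delta> \<and> consistent L \<Delta> \<and> finite (\<Union> (fv ` \<Delta>)) \<and> (\<phi> \<in> \<Delta> \<or> Neg \<phi> \<in> \<Delta>) \<and>
    (\<forall>\<psi>. \<phi> = Exists \<psi> \<longrightarrow> \<phi> \<in> \<Delta> \<longrightarrow> (\<exists>k. subst_top (Var k) \<psi> \<in> \<Delta>)) \<and>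
    (\<forall>\<psi>. \<phi> = Forall \<psi> \<longrightarrow> Neg \<phi> \<in> \<Delta> \<longrightarrow> (\<exists>k. Neg (subst_top (Var k) \<psi>) \<in> \<Delta>))"
proof -
  obtain \<chi> where \<chi>: "\<chi> = \<phi> \<or> \<chi> = Neg \<phi>" "consistent L (insert \<chi> \<Gamma>)"
    using consistent_insert[OF assms(1,3)] by auto
  define \<Delta> where "\<Delta> = insert \<chi> \<Gamma>"
  have fin: "finite (\<Union> (fv ` \<Delta>))" using assms(2) by (simp add: \<Delta>_def finite_fv)
  then obtain k where k: "k \<notin> \<Union> (fv ` \<Delta>)" using ex_new_if_finite infinite_UNIV_nat by blast
  have other: "\<not> (\<phi> \<in> \<Delta>' \<and> Neg \<phi> \<in> \<Delta>')" if "consistent L \<Delta>'" for \<Delta>'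
    using that assms(3) unfolding consistent_def by (metis in_lang.simps(3) prv.Asm)
  \<comment> \<open>In the two cases without a witness, the clause for the opposite sign is vacuous,
    since a consistent set does not contain both \<phi> and its negation.\<close>
  consider (ex) \<psi> where "\<chi> = Exists \<psi>" "\<chi> = \<phi>" | (all) \<psi> where "\<chi> = Neg (Forall \<psi>)" "\<chi> = Neg \<phi>"
    | (none) "\<chi> = \<phi>" "\<forall>\<psi>. \<phi> \<noteq> Exists \<psi>" | (none') "\<chi> = Neg \<phi>" "\<forall>\<psi>. \<phi> \<noteq> Forall \<psi>"
    using \<chi>(1) by blast
  then show ?thesis
  proof cases
    case ex
    have "consistent L (insert (subst_top (Var k) \<psi>) \<Delta>)"
      by (rule consistent_witness) (use ex \<chi> assms(3) k in \<open>auto simp: \<Delta>_def\<close>)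
    then show ?thesis using fin ex
      by (intro exI[of _ "insert (subst_top (Var k) \<psi>) \<Delta>"]) (auto simp: \<Delta>_def finite_fv)
  next
    case all
    have "consistent L (insert (Neg (subst_top (Var k) \<psi>)) \<Delta>)"
      by (rule consistent_counterexample) (use all \<chi> assms(3) k in \<open>auto simp: \<Delta>_def\<close>)
    then show ?thesis using fin all
      by (intro exI[of _ "insert (Neg (subst_top (Var k) \<psi>)) \<Delta>"]) (auto simp: \<Delta>_def finite_fv)
  next
    case none
    then show ?thesis using fin \<chi>(2) other[of \<Delta>]
      by (intro exI[of _ \<Delta>]) (auto simp: \<Delta>_def)
  next
    case none'
    then show ?thesis using fin \<chi>(2) other[of \<Delta>]
      by (intro exI[of _ \<Delta>]) (auto simp: \<Delta>_def)
  qed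
qed

lemma henkin_extension:
  assumes "finite_lang L" "T \<subseteq> sentences L" "consistent L T"
  shows "\<exists>H. T \<subseteq> H \<and> henkin L H"
proof -
  define en where "en = from_nat_into {\<phi>. in_lang L \<phi>}"
  have "in_lang L (Eq (Var 0) (Var 0))" by simp
  then have ne: "{\<phi>. in_lang L \<phi>} \<noteq> {}" by blast
  have en: "in_lang L (en n)" for n using from_nat_into[OF ne, of n] by (simp add: en_def)
  have en_surj: "\<exists>n. en n = \<phi>" if "in_lang L \<phi>" for \<phi>
    using from_nat_into_surj[OF countable_lang[OF assms(1)], of \<phi>] that by (simp add: en_def)
  let ?P = "\<lambda>n \<Gamma>. T \<subseteq> \<Gamma> \<and> consistent L \<Gamma> \<and> finite (\<Union> (fv ` \<Gamma>))"
  let ?Q = "\<lambda>n \<Gamma> \<Delta>. \<Gamma> \<subseteq> \<Delta> \<and> (en n \<in> \<Delta> \<or> Neg (en n) \<in> \<Delta>) \<and>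
    (\<forall>\<psi>. en n = Exists \<psi> \<longrightarrow> en n \<in> \<Delta> \<longrightarrow> (\<exists>k. subst_top (Var k) \<psi> \<in> \<Delta>)) \<and>
    (\<forall>\<psi>. en n = Forall \<psi> \<longrightarrow> Neg (en n) \<in> \<Delta> \<longrightarrow> (\<exists>k. Neg (subst_top (Var k) \<psi>) \<in> \<Delta>))"
  have "\<exists>G. \<forall>n. ?P n (G n) \<and> ?Q n (G n) (G (Suc n))"
  proof (rule dependent_nat_choice)
    have "\<Union> (fv ` T) = {}" using assms(2) by (auto simp: sentences_def)
    then show "\<exists>x. ?P 0 x" using assms(3) by (intro exI[of _ T]) (simp del: UN_simps)
  next
    fix \<Gamma> n assume "?P n \<Gamma>"
    then have "consistent L \<Gamma>" "finite (\<Union> (fv ` \<Gamma>))" "T \<subseteq> \<Gamma>" by blast+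
    from henkin_step[OF this(1,2) en[of n]] obtain \<Delta> where
      "consistent L \<Delta> \<and> finite (\<Union> (fv ` \<Delta>)) \<and> ?Q n \<Gamma> \<Delta>" by blast
    with \<open>T \<subseteq> \<Gamma>\<close> show "\<exists>\<Delta>. ?P (Suc n) \<Delta> \<and> ?Q n \<Gamma> \<Delta>"
      by (intro exI[of _ \<Delta>]) blast
  qed
  then obtain G where G: "\<forall>n. ?P n (G n) \<and> ?Q n (G n) (G (Suc n))" ..
  have P: "?P n (G n)" and Q: "?Q n (G n) (G (Suc n))" for n
    using G[rule_format, of n] by blast+
  define H where "H = (\<Union>n. G n)"
  have sub: "G n \<subseteq> H" for n by (auto simp: H_def)
  have mono: "G m \<subseteq> G n" if "m \<le> n" for m n
    using that by (rule lift_Suc_mono_le[rotated]) (use Q in blast)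
  have fin: "\<exists>n. A \<subseteq> G n" if "finite A" "A \<subseteq> H" for A
    using that
  proof (induction A)
    case (insert a A)
    then obtain m n where "A \<subseteq> G m" "a \<in> G n" by (auto simp: H_def)
    then have "insert a A \<subseteq> G (max m n)" using mono[of m "max m n"] mono[of n "max m n"] by auto
    then show ?case by blast
  qed simp
  have con: "consistent L H"
    unfolding consistent_def
  proof
    assume "\<exists>\<phi>. prv L H \<phi> \<and> prv L H (Neg \<phi>)"
    then obtain \<phi> A B where "finite A" "A \<subseteq> H" "prv L A \<phi>" "finite B" "B \<subseteq> H" "prv L B (Neg \<phi>)"
      using prv_finite by meson
    moreover obtain n where "A \<union> B \<subseteq> G n" using fin[of "A \<union> B"] calculation by auto
    ultimately have "prv L (G n) \<phi>" "prv L (G n) (Neg \<phi>)" by (auto elim: prv_mono)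
    with P[of n] show False by (auto simp: consistent_def)
  qed
  have excl: "\<not> (\<phi> \<in> H \<and> Neg \<phi> \<in> H)" if "in_lang L \<phi>" for \<phi>
    using con that unfolding consistent_def by (metis in_lang.simps(3) prv.Asm)
  have "henkin L H"
    unfolding henkin_def
  proof (intro conjI allI impI)
    show "consistent L H" by (rule con)
  next
    fix \<phi> assume "in_lang L \<phi>"
    then show "\<phi> \<in> H \<or> Neg \<phi> \<in> H" using Q sub en_surj by (metis subsetD)
  next
    fix \<phi> assume *: "Exists \<phi> \<in> H" "in_lang L \<phi>"
    then obtain n where n: "en n = Exists \<phi>" using en_surj[of "Exists \<phi>"] by auto
    have "Neg (Exists \<phi>) \<notin> H" using excl[of "Exists \<phi>"] * by auto
    then have "en n \<in> G (Suc n)" using Q[of n] sub[of "Suc n"] n by auto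
    then show "\<exists>k. subst_top (Var k) \<phi> \<in> H" using Q[of n] sub[of "Suc n"] n by blast
  next
    fix \<phi> assume *: "Neg (Forall \<phi>) \<in> H" "in_lang L \<phi>"
    then obtain n where n: "en n = Forall \<phi>" using en_surj[of "Forall \<phi>"] by auto
    have "Forall \<phi> \<notin> H" using excl[of "Forall \<phi>"] * by auto
    then have "Neg (en n) \<in> G (Suc n)" using Q[of n] sub[of "Suc n"] n by auto
    then show "\<exists>k. Neg (subst_top (Var k) \<phi>) \<in> H" using Q[of n] sub[of "Suc n"] n by blast
  qed
  moreover have "T \<subseteq> H" using P[of 0] sub[of 0] by blast
  ultimately show ?thesis by blast
qed

section \<open>The term model of a Henkin set\<close>

context
  fixes L :: "('f, 'p) lang" and H :: "('f, 'p) fm set"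
  assumes henkin: "henkin L H"
begin

lemma henkin_prv: "prv L H \<phi> \<Longrightarrow> \<phi> \<in> H"
  using henkin unfolding henkin_def consistent_def by (metis in_lang.simps(3) prv.Asm prv_in_lang)

lemma henkin_Neg: "in_lang L \<phi> \<Longrightarrow> Neg \<phi> \<in> H \<longleftrightarrow> \<phi> \<notin> H"
  using henkin unfolding henkin_def consistent_def by (metis in_lang.simps(3) prv.Asm)

lemma henkin_Conj: "in_lang L \<phi> \<Longrightarrow> in_lang L \<psi> \<Longrightarrow> Conj \<phi> \<psi> \<in> H \<longleftrightarrow> \<phi> \<in> H \<and> \<psi> \<in> H"
  by (metis henkin_prv in_lang.simps(4) prv.Asm prv.ConjE1 prv.ConjE2 prv.ConjI)

lemma henkin_Disj:
  assumes "in_lang L \<phi>" "in_lang L \<psi>"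
  shows "Disj \<phi> \<psi> \<in> H \<longleftrightarrow> \<phi> \<in> H \<or> \<psi> \<in> H"
proof
  assume *: "Disj \<phi> \<psi> \<in> H"
  show "\<phi> \<in> H \<or> \<psi> \<in> H"
  proof (rule ccontr)
    assume "\<not> ?thesis"
    then have "Neg \<phi> \<in> H" "Neg \<psi> \<in> H" using assms henkin_Neg by auto
    then have "prv L (insert \<psi> H) \<phi>"
      using assms by (intro inconsistent_prv) (auto simp: consistent_def intro!: exI[of _ \<psi>] prv.Asm)
    moreover have "prv L (insert \<phi> H) \<phi>" using assms by (auto intro: prv.Asm)
    moreover have "prv L H (Disj \<phi> \<psi>)" using * assms by (intro prv.Asm) auto
    ultimately have "\<phi> \<in> H" by (intro henkin_prv) (rule prv.DisjE)
    with \<open>\<not> ?thesis\<close> show False by simp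
  qed
next
  assume "\<phi> \<in> H \<or> \<psi> \<in> H"
  then show "Disj \<phi> \<psi> \<in> H" using assms by (auto intro!: henkin_prv intro: prv.intros)
qed

lemma henkin_Imp:
  assumes "in_lang L \<phi>" "in_lang L \<psi>"
  shows "Imp \<phi> \<psi> \<in> H \<longleftrightarrow> (\<phi> \<in> H \<longrightarrow> \<psi> \<in> H)"
proof
  assume "Imp \<phi> \<psi> \<in> H"
  then have imp: "prv L H (Imp \<phi> \<psi>)" using assms by (intro prv.Asm) auto
  show "\<phi> \<in> H \<longrightarrow> \<psi> \<in> H"
    using henkin_prv[OF prv.ImpE[OF imp prv.Asm]] assms by blast
next
  assume *: "\<phi> \<in> H \<longrightarrow> \<psi> \<in> H"
  show "Imp \<phi> \<psi> \<in> H"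
  proof (cases "\<psi> \<in> H")
    case True
    then show ?thesis using assms by (auto intro!: henkin_prv prv.ImpI intro: prv.Asm)
  next
    case False
    then have "Neg \<phi> \<in> H" using * assms henkin_Neg by auto
    then have "prv L (insert \<phi> H) \<psi>"
      using assms by (intro inconsistent_prv) (auto simp: consistent_def intro!: exI[of _ \<phi>] prv.Asm)
    then show ?thesis using assms by (auto intro!: henkin_prv prv.ImpI)
  qed
qed

lemma henkin_Exists:
  assumes "in_lang L \<phi>"
  shows "Exists \<phi> \<in> H \<longleftrightarrow> (\<exists>t. in_lang_tm L t \<and> subst_top t \<phi> \<in> H)"
proof
  assume "Exists \<phi> \<in> H"
  then show "\<exists>t. in_lang_tm L t \<and> subst_top t \<phi> \<in> H"
    using assms henkin unfolding henkin_def by (metis in_lang_tm.simps(1))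
next
  assume "\<exists>t. in_lang_tm L t \<and> subst_top t \<phi> \<in> H"
  then obtain t where "in_lang_tm L t" "subst_top t \<phi> \<in> H" by blast
  then have "prv L H (subst_top t \<phi>)" using assms by (auto intro: prv.Asm in_lang_subst_top)
  then have "prv L H (Exists \<phi>)" by (rule prv.ExI[OF assms \<open>in_lang_tm L t\<close>])
  then show "Exists \<phi> \<in> H" by (rule henkin_prv)
qed

lemma henkin_Forall:
  assumes "in_lang L \<phi>"
  shows "Forall \<phi> \<in> H \<longleftrightarrow> (\<forall>t. in_lang_tm L t \<longrightarrow> subst_top t \<phi> \<in> H)"
proof
  assume "Forall \<phi> \<in> H"
  then have "prv L H (Forall \<phi>)" using assms by (auto intro: prv.Asm)
  then show "\<forall>t. in_lang_tm L t \<longrightarrow> subst_top t \<phi> \<in> H" by (auto intro: henkin_prv prv.AllE)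
next
  assume *: "\<forall>t. in_lang_tm L t \<longrightarrow> subst_top t \<phi> \<in> H"
  show "Forall \<phi> \<in> H"
  proof (rule ccontr)
    assume "Forall \<phi> \<notin> H"
    then have "Neg (Forall \<phi>) \<in> H" using assms henkin_Neg by auto
    then obtain k where "Neg (subst_top (Var k) \<phi>) \<in> H" using assms henkin unfolding henkin_def by blast
    moreover have "in_lang_tm L (Var k)" by simp
    ultimately show False using * henkin_Neg in_lang_subst_top[OF _ assms] by metis
  qed
qed

text \<open>The carrier is the whole type of terms. Terms outside the language become equal to
  \<open>Var 0\<close> in the model, which avoids a subtype.\<close>

definition norm_tm :: "'f tm \<Rightarrow> 'f tm" where
  "norm_tm t = (if in_lang_tm L t then t else Var 0)"

lemma in_lang_norm_tm [simp]: "in_lang_tm L (norm_tm t)"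
  by (simp add: norm_tm_def)

lemma norm_tm_id: "in_lang_tm L t \<Longrightarrow> norm_tm t = t"
  by (simp add: norm_tm_def)

definition term_struct :: "('f tm, 'f, 'p) struct" where
  "term_struct = \<lparr>eqr = \<lambda>s t. Eq (norm_tm s) (norm_tm t) \<in> H,
     fint = \<lambda>f ts. if (f, length ts) \<in> funs L then Fun f (map norm_tm ts) else Var 0,
     rint = \<lambda>p ts. (p, length ts) \<in> rels L \<and> Rel p (map norm_tm ts) \<in> H\<rparr>"

lemma Eq_refl: "in_lang_tm L t \<Longrightarrow> Eq t t \<in> H"
  by (auto intro: henkin_prv prv.EqI)

lemma Eq_replace:
  assumes "in_lang L \<phi>" "in_lang_tm L s" "in_lang_tm L t" "Eq s t \<in> H" "subst_top s \<phi> \<in> H"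
  shows "subst_top t \<phi> \<in> H"
proof -
  have "prv L H (Eq s t)" "prv L H (subst_top s \<phi>)"
    using assms by (auto intro: prv.Asm in_lang_subst_top)
  from prv.EqE[OF assms(1) this] show ?thesis by (rule henkin_prv)
qed

lemma Eq_sym: "in_lang_tm L s \<Longrightarrow> in_lang_tm L t \<Longrightarrow> Eq s t \<in> H \<Longrightarrow> Eq t s \<in> H"
  using Eq_replace[of "Eq (Var 0) (lift_tm s)" s t]
  by (simp add: subst_tm_comp Eq_refl in_lang_subst_tm)

lemma Eq_trans:
  "in_lang_tm L s \<Longrightarrow> in_lang_tm L t \<Longrightarrow> in_lang_tm L u \<Longrightarrow> Eq s t \<in> H \<Longrightarrow> Eq t u \<in> H \<Longrightarrow> Eq s u \<in> H"
  using Eq_replace[of "Eq (lift_tm s) (Var 0)" t u]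
  by (simp add: subst_tm_comp in_lang_subst_tm)

text \<open>Replacing one argument at a time, from left to right, reduces congruence for argument
  lists to the single-place rule \<open>EqE\<close>.\<close>

lemma replace_list:
  assumes "\<And>xs s t ys. eq s t \<Longrightarrow> P (xs @ s # ys) \<Longrightarrow> P (xs @ t # ys)"
  shows "list_all2 eq as bs \<Longrightarrow> P (pre @ as) \<Longrightarrow> P (pre @ bs)"
proof (induction arbitrary: pre rule: list_all2_induct)
  case (Cons a as b bs)
  then have "P (pre @ b # as)" using assms by blast
  then show ?case using Cons(3)[of "pre @ [b]"] by simp
qed

lemma cong_term_struct: "cong_struct term_struct"
  unfolding cong_struct_def
proof (intro conjI allI impI)
  let ?eq = "\<lambda>s t. Eq (norm_tm s) (norm_tm t) \<in> H"
  have sym: "?eq s t \<Longrightarrow> ?eq t s" for s t by (simp add: Eq_sym)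
  show "equivp (eqr term_struct)"
    by (rule equivpI)
      (auto simp: term_struct_def reflp_def symp_def transp_def Eq_refl intro: Eq_sym
        Eq_trans[of "norm_tm _" "norm_tm _" "norm_tm _"])
  fix f :: 'f and as bs assume *: "list_all2 (eqr term_struct) as bs"
  then have l: "length as = length bs" by (rule list_all2_lengthD)
  let ?P = "\<lambda>l. (f, length l) \<in> funs L \<longrightarrow> Eq (Fun f (map norm_tm as)) (Fun f (map norm_tm l)) \<in> H"
  have "?P ([] @ bs)" if f: "(f, length as) \<in> funs L"
  proof (rule replace_list[where eq = ?eq and P = ?P])
    fix xs s t ys assume "?eq s t" "?P (xs @ s # ys)"
    moreover have "in_lang L (Eq (lift_tm (Fun f (map norm_tm as)))
          (Fun f (map (\<lambda>t. lift_tm (norm_tm t)) xs @ Var 0 # map (\<lambda>t. lift_tm (norm_tm t)) ys)))"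
      if "(f, length (xs @ t # ys)) \<in> funs L"
      using f that by (auto simp: list_all_iff intro!: in_lang_subst_tm)
    ultimately show "?P (xs @ t # ys)"
      using Eq_replace[of "Eq (lift_tm (Fun f (map norm_tm as)))
          (Fun f (map (\<lambda>t. lift_tm (norm_tm t)) xs @ Var 0 # map (\<lambda>t. lift_tm (norm_tm t)) ys))" "norm_tm s" "norm_tm t"]
      by (simp add: subst_tm_comp comp_def)
  next
    show "list_all2 ?eq as bs" using * by (simp add: term_struct_def)
    show "?P ([] @ as)" using f by (auto intro!: Eq_refl simp: list_all_iff)
  qed
  then show "eqr term_struct (fint term_struct f as) (fint term_struct f bs)"
    using l by (auto simp: term_struct_def norm_tm_id list_all_iff Eq_refl)
next
  let ?eq = "\<lambda>s t. Eq (norm_tm s) (norm_tm t) \<in> H"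
  fix p :: 'p and as bs assume *: "list_all2 (eqr term_struct) as bs"
  then have l: "length as = length bs" by (rule list_all2_lengthD)
  have one: "Rel p (map norm_tm bs) \<in> H"
    if p: "(p, length as) \<in> rels L" and eq: "list_all2 ?eq as bs" and R: "Rel p (map norm_tm as) \<in> H" for as bs
  proof -
    let ?P = "\<lambda>l. length l = length as \<longrightarrow> Rel p (map norm_tm l) \<in> H"
    have "?P ([] @ bs)"
    proof (rule replace_list[where eq = ?eq and P = ?P])
      fix xs s t ys assume "?eq s t" "?P (xs @ s # ys)"
      moreover have "in_lang L (Rel p (map (\<lambda>t. lift_tm (norm_tm t)) xs @ Var 0 # map (\<lambda>t. lift_tm (norm_tm t)) ys))"
        if "length (xs @ t # ys) = length as"
        using p that by (auto simp: list_all_iff intro!: in_lang_subst_tm)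
      ultimately show "?P (xs @ t # ys)"
        using Eq_replace[of "Rel p (map (\<lambda>t. lift_tm (norm_tm t)) xs @ Var 0 # map (\<lambda>t. lift_tm (norm_tm t)) ys)" "norm_tm s" "norm_tm t"]
        by (simp add: subst_tm_comp comp_def)
    qed (use eq R in auto)
    then show ?thesis using list_all2_lengthD[OF eq] by simp
  qed
  have "list_all2 ?eq as bs" using * by (simp add: term_struct_def)
  moreover from this have "list_all2 ?eq bs as"
    by (auto simp: list_all2_conv_all_nth Eq_sym)
  ultimately show "rint term_struct p as = rint term_struct p bs"
    using one[of as bs] one[of bs as] l by (auto simp: term_struct_def)
qed

lemma eval_term_struct: "in_lang_tm L t \<Longrightarrow> eval term_struct Var t = t"
proof (induction t)
  case (Fun f ts)
  then have "map (eval term_struct Var) ts = ts" "map norm_tm ts = ts"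
    by (auto simp: list_all_iff norm_tm_def intro!: map_idI)
  then show ?case using Fun.prems by (simp add: term_struct_def)
qed simp

text \<open>Instances of a quantified formula are not its subformulae, so the truth lemma goes by
  induction on a size that substitution preserves.\<close>

primrec fm_size :: "('f, 'p) fm \<Rightarrow> nat" where
  "fm_size (Rel p ts) = 0"
| "fm_size (Eq s t) = 0"
| "fm_size (Neg \<phi>) = Suc (fm_size \<phi>)"
| "fm_size (Conj \<phi> \<psi>) = Suc (fm_size \<phi> + fm_size \<psi>)"
| "fm_size (Disj \<phi> \<psi>) = Suc (fm_size \<phi> + fm_size \<psi>)"
| "fm_size (Imp \<phi> \<psi>) = Suc (fm_size \<phi> + fm_size \<psi>)"
| "fm_size (Forall \<phi>) = Suc (fm_size \<phi>)"
| "fm_size (Exists \<phi>) = Suc (fm_size \<phi>)"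

lemma fm_size_subst [simp]: "fm_size (subst \<sigma> \<phi>) = fm_size \<phi>"
  by (induction \<phi> arbitrary: \<sigma>) auto

lemma sat_term_struct: "in_lang L \<phi> \<Longrightarrow> sat term_struct Var \<phi> \<longleftrightarrow> \<phi> \<in> H"
proof (induction "fm_size \<phi>" arbitrary: \<phi> rule: less_induct)
  case less
  note norm = norm_tm_id
  \<comment> \<open>An arbitrary element of the carrier is first exchanged for its normal form,
    about which H has something to say; congruence makes the exchange harmless.\<close>
  have quant: "sat term_struct (case_nat t Var) \<psi> \<longleftrightarrow> subst_top (norm_tm t) \<psi> \<in> H"
    if "in_lang L \<psi>" "fm_size \<psi> < fm_size \<phi>" for \<psi> t
  proof -
    have "eqr term_struct t (norm_tm t)"
      by (simp add: term_struct_def norm Eq_refl)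
    then have "sat term_struct (case_nat t Var) \<psi> \<longleftrightarrow> sat term_struct (case_nat (norm_tm t) Var) \<psi>"
      by (intro sat_cong cong_term_struct)
        (auto split: nat.split simp: eqr_refl[OF cong_term_struct])
    also have "\<dots> \<longleftrightarrow> sat term_struct Var (subst_top (norm_tm t) \<psi>)"
      by (simp add: sat_subst_top eval_term_struct)
    also have "\<dots> \<longleftrightarrow> subst_top (norm_tm t) \<psi> \<in> H"
      using less.hyps[of "subst_top (norm_tm t) \<psi>"] that in_lang_subst_top[of L "norm_tm t" \<psi>] by simp
    finally show ?thesis .
  qed
  have all: "(\<forall>t. P (norm_tm t)) \<longleftrightarrow> (\<forall>t. in_lang_tm L t \<longrightarrow> P t)"
    and ex: "(\<exists>t. P (norm_tm t)) \<longleftrightarrow> (\<exists>t. in_lang_tm L t \<and> P t)" for P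
    using norm in_lang_norm_tm by metis+
  show ?case
  proof (cases \<phi>)
    case (Rel p ts)
    then have "map norm_tm ts = ts" "map (eval term_struct Var) ts = ts"
      using less.prems by (auto simp: list_all_iff norm eval_term_struct intro!: map_idI)
    then show ?thesis using Rel less.prems by (simp add: term_struct_def)
  next
    case (Eq s t)
    then show ?thesis using less.prems by (simp add: eval_term_struct) (simp add: term_struct_def norm)
  next
    case (Forall \<psi>)
    then show ?thesis using quant[of \<psi>] less.prems all by (simp add: henkin_Forall)
  next
    case (Exists \<psi>)
    then show ?thesis using quant[of \<psi>] less.prems ex by (simp add: henkin_Exists)
  qed (use less henkin_Neg henkin_Conj henkin_Disj henkin_Imp in auto)
qed

end

theorem model_existence:
  assumes "finite_lang L" "T \<subseteq> sentences L" "consistent L T"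
  shows "\<exists>S :: ('f tm, 'f, 'p) struct. cong_struct S \<and> (\<forall>\<phi> \<in> T. \<forall>e. sat S e \<phi>)"
proof -
  obtain H where H: "T \<subseteq> H" "henkin L H" using henkin_extension[OF assms] by blast
  have "sat (term_struct L H) e \<phi>" if "\<phi> \<in> T" for \<phi> e
  proof -
    have "sat (term_struct L H) Var \<phi>" "fv \<phi> = {}"
      using sat_term_struct[OF H(2)] that assms(2) H(1) by (auto simp: sentences_def)
    then show ?thesis using sat_fv[of \<phi> e Var] by simp
  qed
  then show ?thesis using cong_term_struct[OF H(2)] by blast
qed

section \<open>Models of sequential theories\<close>

definition cat :: "'a list \<Rightarrow> (nat \<Rightarrow> 'a) \<Rightarrow> nat \<Rightarrow> 'a" where
  "cat as e i = (if i < length as then as ! i else e (i - length as))"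

text \<open>In a block of quantifiers the outermost one is chosen first but has the largest index,
  hence new values are appended at the end.\<close>

lemma cat_case_nat: "cat as (case_nat a e) = cat (as @ [a]) e"
proof
  fix i
  consider "i < length as" | "i = length as" | k where "i = length as + Suc k"
    by (metis less_imp_Suc_add add_Suc_right linorder_neqE_nat)
  then show "cat as (case_nat a e) i = cat (as @ [a]) e i"
    by cases (auto simp: cat_def nth_append)
qed

lemma ex_snoc: "(\<exists>as. length as = Suc k \<and> P as) \<longleftrightarrow> (\<exists>a as. length as = k \<and> P (as @ [a]))"
  by (metis length_Suc_conv_rev length_append_singleton)

lemma sat_exs: "sat S e (exs k \<phi>) \<longleftrightarrow> (\<exists>as. length as = k \<and> sat S (cat as e) \<phi>)"
proof (induction k arbitrary: e)
  case 0
  then show ?case by (simp add: exs_def cat_def)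
next
  case (Suc k)
  then show ?case by (simp add: exs_def cat_case_nat ex_snoc)
qed

lemma in_lang_exs [simp]: "in_lang L (exs k \<phi>) = in_lang L \<phi>"
  by (induction k) (auto simp: exs_def)

definition holds :: "('a, 'f, 'p) struct \<Rightarrow> ('f, 'p) fm \<Rightarrow> 'a list \<Rightarrow> bool" where
  "holds S \<phi> as \<longleftrightarrow> sat S ((!) as) \<phi>"

lemma sat_app_holds:
  "fv \<phi> \<subseteq> {..<length ts} \<Longrightarrow> sat S e (app \<phi> ts) \<longleftrightarrow> holds S \<phi> (map (eval S e) ts)"
  unfolding sat_app holds_def by (rule sat_fv) auto

lemma sat_foldr_Conj: "sat S e (foldr Conj \<phi>s \<psi>) \<longleftrightarrow> (\<forall>\<phi>\<in>set \<phi>s. sat S e \<phi>) \<and> sat S e \<psi>"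
  by (induction \<phi>s) auto

lemma sat_foldr_Imp: "sat S e (foldr Imp \<phi>s \<psi>) \<longleftrightarrow> ((\<forall>\<phi>\<in>set \<phi>s. sat S e \<phi>) \<longrightarrow> sat S e \<psi>)"
  by (induction \<phi>s) auto

lemma map_cat_vars: "map (cat (as @ bs) e) [length as..<length as + length bs] = bs"
  by (auto simp: cat_def intro!: nth_equalityI)

lemma map_cat_vars0: "map (cat as e) [0..<length as] = as"
  by (auto simp: cat_def intro!: nth_equalityI)

locale sequential_model =
  fixes L :: "('f, 'p) lang" and S :: "('a, 'f, 'p) struct"
    and I :: "(arith, unit, 'f, 'p) interp" and \<beta> :: "('f, 'p) fm"
  assumes cong: "cong_struct S"
    and wf: "interp_wf L arith_lang I"
    and axs: "\<And>\<phi> e. \<phi> \<in> interp_axs arith_lang I \<Longrightarrow> sat S e \<phi>"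
    and arith: "\<And>\<phi> e. \<phi> \<in> Q \<Longrightarrow> sat S e (tr I \<phi>)"
    and beta: "in_lang L \<beta>" "fv \<beta> \<subseteq> {0, 1, 2}"
    and seq: "\<And>e. sat S e (sequence_ax I \<beta>)"
begin

definition N :: "'a \<Rightarrow> bool" where "N a \<longleftrightarrow> holds S (i_dom I) [a]"

definition eqn :: "'a \<Rightarrow> 'a \<Rightarrow> bool" (infix "\<approx>" 50) where "a \<approx> b \<longleftrightarrow> holds S (i_eq I) [a, b]"

definition elem :: "'a \<Rightarrow> 'a \<Rightarrow> 'a \<Rightarrow> bool" where "elem y i w \<longleftrightarrow> holds S \<beta> [y, i, w]"

definition gr :: "arith \<Rightarrow> 'a list \<Rightarrow> 'a \<Rightarrow> bool" where
  "gr f as b \<longleftrightarrow> holds S (i_fun I f (length as)) (as @ [b])"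

text \<open>Function symbols are interpreted by graphs that are unique only up to the interpreted
  equality. Choosing a value once and for all allows translated arithmetical terms to be evaluated.
  Nothing is claimed about arguments outside N.\<close>

definition num_struct :: "('a, arith, unit) struct" where
  "num_struct = \<lparr>eqr = eqn, fint = \<lambda>f as. SOME b. N b \<and> gr f as b, rint = \<lambda>_ _. False\<rparr>"

abbreviation opr :: "arith \<Rightarrow> 'a list \<Rightarrow> 'a" where "opr \<equiv> fint num_struct"

lemma sat_in_dom [simp]: "sat S e (in_dom I v) \<longleftrightarrow> N (e v)"
  unfolding in_dom_def N_def using wf by (subst sat_app_holds) (auto simp: interp_wf_def)

lemma sat_eq_at [simp]: "sat S e (eq_at I u v) \<longleftrightarrow> e u \<approx> e v"
  unfolding eq_at_def eqn_def using wf by (subst sat_app_holds) (auto simp: interp_wf_def)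

lemma sat_alls_dom:
  "sat S e (alls_dom I k \<phi>) \<longleftrightarrow> (\<forall>as. length as = k \<longrightarrow> (\<forall>a\<in>set as. N a) \<longrightarrow> sat S (cat as e) \<phi>)"
proof (induction k arbitrary: e)
  case 0
  then show ?case by (simp add: alls_dom_def cat_def)
next
  case (Suc k)
  have "(\<forall>as. length as = Suc k \<longrightarrow> (\<forall>a\<in>set as. N a) \<longrightarrow> P as) \<longleftrightarrow>
    (\<forall>a. N a \<longrightarrow> (\<forall>as. length as = k \<longrightarrow> (\<forall>a\<in>set as. N a) \<longrightarrow> P (as @ [a])))" for P
    using ex_snoc[of k "\<lambda>as. (\<forall>a\<in>set as. N a) \<and> \<not> P as"] by auto
  with Suc show ?case by (simp add: alls_dom_def cat_case_nat)
qed

lemma sat_ex_args: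
  "sat S e (ex_args I Vs d \<phi>) \<longleftrightarrow> (\<exists>as. length as = length Vs \<and>
     (\<forall>j<length Vs. N (as ! j) \<and> sat S (cat as e) ((Vs ! j) (d + length Vs) j)) \<and> sat S (cat as e) \<phi>)"
  unfolding ex_args_def Let_def sat_exs sat_foldr_Conj
  by (intro ex_cong1 conj_cong refl) (auto simp: cat_def)

lemma congruence_ax:
  assumes "sat S e (congruence_ax I k \<phi>)" "fv \<phi> \<subseteq> {..<k}"
    and "length as = k" "length bs = k" "\<forall>a\<in>set as. N a" "\<forall>b\<in>set bs. N b"
    and "\<forall>j<k. as ! j \<approx> bs ! j" "holds S \<phi> as"
  shows "holds S \<phi> bs"
proof -
  have "\<forall>a\<in>set (as @ bs). N a" "length (as @ bs) = 2 * k" using assms by auto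
  then have "sat S (cat (as @ bs) e)
     (foldr Imp (map (\<lambda>j. eq_at I j (j + k)) [0..<k]) (Imp (app \<phi> (vars 0 k)) (app \<phi> (vars k k))))"
    using assms(1) unfolding congruence_ax_def sat_alls_dom by blast
  moreover have "map (eval S (cat (as @ bs) e)) (vars 0 k) = as"
    using map_cat_vars0[of "as @ bs" e] assms(3,4) by (auto simp: cat_def nth_append intro!: nth_equalityI)
  moreover have "map (eval S (cat (as @ bs) e)) (vars k k) = bs"
    using map_cat_vars[of as bs e] assms(3,4) by (simp add: comp_def)
  moreover have "\<forall>j<k. cat (as @ bs) e j \<approx> cat (as @ bs) e (j + k)"
    using assms by (auto simp: cat_def nth_append)
  ultimately show ?thesis
    using assms(2,8) by (auto simp: sat_foldr_Imp sat_app_holds)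
qed

lemma total_ax:
  assumes "sat S e (total_ax I k \<phi>)" "fv \<phi> \<subseteq> {..k}" "length as = k" "\<forall>a\<in>set as. N a"
  shows "\<exists>b. N b \<and> holds S \<phi> (as @ [b])"
proof -
  have "sat S (cat as e) (Exists (Conj (in_dom I 0) (app \<phi> (vars 1 k @ [Var 0]))))"
    using assms(1,3,4) unfolding total_ax_def sat_alls_dom by blast
  then obtain b where b: "N b" "sat S (case_nat b (cat as e)) (app \<phi> (vars 1 k @ [Var 0]))"
    by auto
  have "map (eval S (case_nat b (cat as e))) (vars 1 k) = as"
    by (rule nth_equalityI) (simp_all del: upt_Suc add: assms(3) cat_def)
  then have "map (eval S (case_nat b (cat as e))) (vars 1 k @ [Var 0]) = as @ [b]" by simp
  moreover have "fv \<phi> \<subseteq> {..<length (vars 1 k @ [Var 0])}" using assms(2) by auto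
  ultimately show ?thesis using b sat_app_holds by metis
qed

lemma unique_ax:
  assumes "sat S e (unique_ax I k \<phi>)" "fv \<phi> \<subseteq> {..k}" "length as = k" "\<forall>a\<in>set as. N a"
    "N b" "N c" "holds S \<phi> (as @ [b])" "holds S \<phi> (as @ [c])"
  shows "b \<approx> c"
proof -
  let ?as = "[b, c] @ as"
  have "length ?as = k + 2" "\<forall>a\<in>set ?as. N a" using assms by auto
  then have *: "sat S (cat ?as e) (Imp (Conj (app \<phi> (vars 2 k @ [Var 0])) (app \<phi> (vars 2 k @ [Var 1]))) (eq_at I 0 1))"
    using assms(1) unfolding unique_ax_def sat_alls_dom by blast
  have "map (eval S (cat ?as e)) (vars 2 k) = as"
    by (rule nth_equalityI) (simp_all del: upt_Suc add: assms(3) cat_def)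
  then have 1: "map (eval S (cat ?as e)) (vars 2 k @ [Var 0]) = as @ [b]"
    "map (eval S (cat ?as e)) (vars 2 k @ [Var 1]) = as @ [c]"
    unfolding map_append by (simp_all del: upt_Suc add: cat_def)
  have 2: "fv \<phi> \<subseteq> {..<length (vars 2 k @ [Var 0])}" "fv \<phi> \<subseteq> {..<length (vars 2 k @ [Var 1])}"
    using assms(2) by auto
  have "sat S (cat ?as e) (app \<phi> (vars 2 k @ [Var 0]))" "sat S (cat ?as e) (app \<phi> (vars 2 k @ [Var 1]))"
    unfolding sat_app_holds[OF 2(1)] sat_app_holds[OF 2(2)] 1 by fact+
  with * show ?thesis by (simp add: cat_def)
qed

lemma eqn_refl: "N a \<Longrightarrow> a \<approx> a"
  using axs[of "alls_dom I 1 (eq_at I 0 0)"] sat_alls_dom[of _ 1 "eq_at I 0 0"]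
  by (auto simp: interp_axs_def cat_def dest: spec[of _ "[a]"])

lemma eqn_sym: "N a \<Longrightarrow> N b \<Longrightarrow> a \<approx> b \<Longrightarrow> b \<approx> a"
  using axs[of "alls_dom I 2 (Imp (eq_at I 0 1) (eq_at I 1 0))"] sat_alls_dom[of _ 2 "Imp (eq_at I 0 1) (eq_at I 1 0)"]
  by (auto simp: interp_axs_def cat_def dest!: spec[of _ "[a, b]"])

lemma eqn_trans: "N a \<Longrightarrow> N b \<Longrightarrow> N c \<Longrightarrow> a \<approx> b \<Longrightarrow> b \<approx> c \<Longrightarrow> a \<approx> c"
  using axs[of "alls_dom I 3 (Imp (Conj (eq_at I 0 1) (eq_at I 1 2)) (eq_at I 0 2))"]
    sat_alls_dom[of _ 3 "Imp (Conj (eq_at I 0 1) (eq_at I 1 2)) (eq_at I 0 2)"]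
  by (auto simp: interp_axs_def cat_def nth_Cons' dest!: spec[of _ "[a, b, c]"])

context
  fixes f :: arith and as :: "'a list"
  assumes f: "(f, length as) \<in> funs arith_lang" and as: "\<forall>a\<in>set as. N a"
begin

lemma fun_wf: "fv (i_fun I f (length as)) \<subseteq> {..length as}" "in_lang L (i_fun I f (length as))"
  using wf f unfolding interp_wf_def by blast+

lemma fun_ax:
  "sat S e (congruence_ax I (Suc (length as)) (i_fun I f (length as)))"
  "sat S e (total_ax I (length as) (i_fun I f (length as)))"
  "sat S e (unique_ax I (length as) (i_fun I f (length as)))"
proof -
  have "congruence_ax I (Suc k) (i_fun I g k) \<in> interp_axs arith_lang I"
    "total_ax I k (i_fun I g k) \<in> interp_axs arith_lang I" "unique_ax I k (i_fun I g k) \<in> interp_axs arith_lang I"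
    if "(g, k) \<in> funs arith_lang" for g k
    unfolding interp_axs_def by (rule UnI2, rule UN_I[OF that], simp)+
  with f axs show "sat S e (congruence_ax I (Suc (length as)) (i_fun I f (length as)))"
    "sat S e (total_ax I (length as) (i_fun I f (length as)))"
    "sat S e (unique_ax I (length as) (i_fun I f (length as)))" by blast+
qed

lemma opr_graph: "N (opr f as)" "gr f as (opr f as)"
proof -
  have "\<exists>b. N b \<and> gr f as b" using total_ax[OF fun_ax(2) fun_wf(1) refl as] by (simp add: gr_def)
  from someI_ex[OF this] show "N (opr f as)" "gr f as (opr f as)" by (simp_all add: num_struct_def)
qed

lemma gr_cong:
  assumes "length bs = length as" "\<forall>b\<in>set bs. N b" "\<forall>j<length as. as ! j \<approx> bs ! j"
    "N c" "N d" "c \<approx> d" "gr f as c"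
  shows "gr f bs d"
proof -
  have "\<forall>j<Suc (length as). (as @ [c]) ! j \<approx> (bs @ [d]) ! j"
    using assms by (auto simp: nth_append less_Suc_eq)
  then show ?thesis
    using congruence_ax[OF fun_ax(1), of "as @ [c]" "bs @ [d]"] fun_wf(1) assms as
    by (auto simp: gr_def lessThan_Suc_atMost)
qed

lemma gr_opr: "N b \<Longrightarrow> gr f as b \<longleftrightarrow> opr f as \<approx> b"
proof
  assume "N b" "gr f as b"
  then show "opr f as \<approx> b"
    using unique_ax[OF fun_ax(3) fun_wf(1) refl as] opr_graph by (simp add: gr_def)
next
  assume "N b" "opr f as \<approx> b"
  then show "gr f as b" using gr_cong[of as "opr f as" b] opr_graph as by (simp add: eqn_refl)
qed

end

lemma opr_cong:
  assumes "(f, length as) \<in> funs arith_lang" "\<forall>a\<in>set as. N a" "length bs = length as" "\<forall>b\<in>set bs. N b"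
    "\<forall>j<length as. as ! j \<approx> bs ! j"
  shows "opr f as \<approx> opr f bs"
proof -
  have f': "(f, length bs) \<in> funs arith_lang" using assms by simp
  have "gr f bs (opr f as)"
    by (rule gr_cong[OF assms(1,2) assms(3,4,5) _ _ eqn_refl])
      (simp_all add: opr_graph[OF assms(1,2)])
  then have "opr f bs \<approx> opr f as" using gr_opr[OF f' assms(4)] opr_graph[OF assms(1,2)] by simp
  with eqn_sym[OF opr_graph(1)[OF f' assms(4)] opr_graph(1)[OF assms(1,2)]] show ?thesis by simp
qed

lemma N_eval: "in_lang_tm arith_lang t \<Longrightarrow> (\<forall>i\<in>fv_tm t. N (e i)) \<Longrightarrow> N (eval num_struct e t)"
proof (induction t)
  case (Fun f ts)
  then show ?case by (auto intro!: opr_graph simp: list_all_iff)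
qed simp

text \<open>The translation guesses a value for each subterm. By uniqueness any guess is equal to
  the chosen value, and congruence of the graphs makes the outcome independent of the guess.\<close>

lemma sat_val:
  "in_lang_tm arith_lang t \<Longrightarrow> (\<forall>i\<in>fv_tm t. N (e (i + d))) \<Longrightarrow> N (e v) \<Longrightarrow>
    sat S e (val I t d v) \<longleftrightarrow> eval num_struct (\<lambda>i. e (i + d)) t \<approx> e v"
proof (induction t arbitrary: e d v)
  case (Fun f ts)
  let ?k = "length ts" and ?ev = "eval num_struct (\<lambda>i. e (i + d))"
  have f: "(f, length ts) \<in> funs arith_lang" using Fun.prems by simp
  have Nev: "N (?ev t)" if "t \<in> set ts" for t
    using Fun.prems that by (intro N_eval) (auto simp: list_all_iff)
  have IH: "sat S (cat as e) (val I (ts ! j) (d + ?k) j) \<longleftrightarrow> ?ev (ts ! j) \<approx> as ! j"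
    if "length as = ?k" "j < ?k" "N (as ! j)" for as j
  proof -
    have "sat S (cat as e) (val I (ts ! j) (d + ?k) j) \<longleftrightarrow>
      eval num_struct (\<lambda>i. cat as e (i + (d + ?k))) (ts ! j) \<approx> cat as e j"
    proof (rule Fun.IH)
      show "\<forall>i\<in>fv_tm (ts ! j). N (cat as e (i + (d + ?k)))"
        using Fun.prems(2) that by (auto simp: cat_def)
    qed (use Fun.prems that in \<open>auto simp: list_all_iff cat_def\<close>)
    also have "(\<lambda>i. cat as e (i + (d + ?k))) = (\<lambda>i. e (i + d))"
      using that by (auto simp: cat_def fun_eq_iff)
    also have "cat as e j = as ! j" using that by (simp add: cat_def)
    finally show ?thesis .
  qed
  have ap: "sat S (cat as e) (app (i_fun I f ?k) (vars 0 ?k @ [Var (v + ?k)])) \<longleftrightarrow> gr f as (e v)"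
    if as: "length as = ?k" "\<forall>j<?k. N (as ! j)" for as
  proof -
    have that: "length as = ?k" "\<forall>a\<in>set as. N a" using as by (auto simp: in_set_conv_nth)
    have "fv (i_fun I f ?k) \<subseteq> {..<length (vars 0 ?k @ [Var (v + ?k)])}"
      using fun_wf(1)[of f as] f that by auto
    moreover have "map (eval S (cat as e)) (vars 0 ?k @ [Var (v + ?k)]) = as @ [e v]"
      using map_cat_vars0[of as e] that by (simp add: comp_def) (simp add: cat_def)
    ultimately show ?thesis using sat_app_holds that by (metis gr_def)
  qed
  have "sat S e (val I (Fun f ts) d v) \<longleftrightarrow>
    (\<exists>as. length as = ?k \<and> (\<forall>j<?k. N (as ! j) \<and> ?ev (ts ! j) \<approx> as ! j) \<and> gr f as (e v))"
    unfolding val.simps Let_def sat_ex_args length_map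
    by (intro ex_cong1 conj_cong refl) (auto simp: IH ap[simplified])
  also have "\<dots> \<longleftrightarrow> gr f (map ?ev ts) (e v)"
  proof
    assume "\<exists>as. length as = ?k \<and> (\<forall>j<?k. N (as ! j) \<and> ?ev (ts ! j) \<approx> as ! j) \<and> gr f as (e v)"
    then obtain as where as: "length as = ?k" "\<forall>j<?k. N (as ! j) \<and> ?ev (ts ! j) \<approx> as ! j" "gr f as (e v)"
      by blast
    show "gr f (map ?ev ts) (e v)"
      by (rule gr_cong[of f as "map ?ev ts" "e v" "e v"])
        (use as f Nev Fun.prems in \<open>auto simp: all_set_conv_all_nth eqn_refl intro: eqn_sym\<close>)
  next
    assume "gr f (map ?ev ts) (e v)"
    then show "\<exists>as. length as = ?k \<and> (\<forall>j<?k. N (as ! j) \<and> ?ev (ts ! j) \<approx> as ! j) \<and> gr f as (e v)"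
      using Nev by (intro exI[of _ "map ?ev ts"]) (auto simp: eqn_refl)
  qed
  also have "\<dots> \<longleftrightarrow> opr f (map ?ev ts) \<approx> e v"
    using Nev Fun.prems f by (intro gr_opr) auto
  finally show ?case by simp
qed simp

lemma sat_tr_Eq:
  assumes "in_lang_tm arith_lang s" "in_lang_tm arith_lang t" "\<forall>i\<in>fv_tm s \<union> fv_tm t. N (e i)"
  shows "sat S e (tr I (Eq s t)) \<longleftrightarrow> eval num_struct e s \<approx> eval num_struct e t"
proof -
  have N: "N (eval num_struct e s)" "N (eval num_struct e t)" using assms by (auto intro: N_eval)
  have val: "sat S (cat [a, b] e) (val I u 2 j) \<longleftrightarrow> eval num_struct e u \<approx> cat [a, b] e j"
    if "u = s \<or> u = t" "N a" "N b" "j < 2" for a b u j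
    using sat_val[of u "cat [a, b] e" 2 j] that assms by (auto simp: cat_def less_2_cases_iff)
  have two: "(\<exists>as. length as = Suc (Suc 0) \<and> P as) \<longleftrightarrow> (\<exists>a b. P [a, b])" for P :: "'a list \<Rightarrow> bool"
    by (auto simp: length_Suc_conv)
  have all2: "(\<forall>j<Suc (Suc 0). P j) \<longleftrightarrow> P 0 \<and> P (Suc 0)" for P
    by (auto simp: less_Suc_eq)
  have "sat S e (tr I (Eq s t)) \<longleftrightarrow>
    (\<exists>a b. (N a \<and> sat S (cat [a, b] e) (val I s 2 0)) \<and> (N b \<and> sat S (cat [a, b] e) (val I t 2 1)) \<and> a \<approx> b)"
    unfolding tr.simps sat_ex_args by (simp add: two all2 numeral_2_eq_2 cat_def conj_assoc)
  also have "\<dots> \<longleftrightarrow>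
    (\<exists>a b. N a \<and> N b \<and> eval num_struct e s \<approx> a \<and> eval num_struct e t \<approx> b \<and> a \<approx> b)"
    by (rule ex_cong1, rule ex_cong1) (use val in \<open>auto simp: cat_def\<close>)
  also have "\<dots> \<longleftrightarrow> eval num_struct e s \<approx> eval num_struct e t"
    using N by (meson eqn_refl eqn_sym eqn_trans)
  finally show ?thesis .
qed

end

text \<open>Adding m to the square of the sum is a variant of Cantor's pairing that avoids halving,
  so its graph needs only addition and multiplication. It is injective but not onto, which suffices
  for coding.\<close>

definition pr :: "nat \<Rightarrow> nat \<Rightarrow> nat" where "pr m n = (m + n) * (m + n) + m"

lemma pr_inject [simp]: "pr a b = pr c d \<longleftrightarrow> a = c \<and> b = d"
proof -
  have *: False if "a + b < c + d" "pr a b = pr c d" for a b c d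
  proof -
    \<comment> \<open>Consecutive squares differ by 2(a + b) + 1, which exceeds the summand a; so
      the pairs with a smaller sum have a smaller code.\<close>
    have "(a + b + 1) * (a + b + 1) \<le> (c + d) * (c + d)" using that by (intro mult_le_mono) auto
    moreover have "(a + b + 1) * (a + b + 1) = (a + b) * (a + b) + 2 * (a + b) + 1" by (simp add: algebra_simps)
    ultimately show False using that by (simp add: pr_def)
  qed
  have "a + b = c + d" if "pr a b = pr c d"
    using *[of a b c d] *[of c d a b] that by (metis nat_neq_iff)
  then show ?thesis by (auto simp: pr_def)
qed

lemma le_pr: "m \<le> pr m n" "n \<le> pr m n"
proof -
  have "x \<le> x * x" for x :: nat by (cases x) auto
  from this[of "m + n"] show "m \<le> pr m n" "n \<le> pr m n" unfolding pr_def by linarith+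
qed

section \<open>Standard numbers inside a model of Q\<close>

context sequential_model
begin

definition zz :: 'a where "zz = opr Zero []"
definition ss :: "'a \<Rightarrow> 'a" where "ss a = opr Succ [a]"
definition ad :: "'a \<Rightarrow> 'a \<Rightarrow> 'a" where "ad a b = opr Plus [a, b]"
definition mu :: "'a \<Rightarrow> 'a \<Rightarrow> 'a" where "mu a b = opr Times [a, b]"

lemma N_zz [simp]: "N zz" unfolding zz_def by (rule opr_graph) (auto simp: arith_lang_def)
lemma N_ss [simp]: "N a \<Longrightarrow> N (ss a)" unfolding ss_def by (rule opr_graph) (auto simp: arith_lang_def)
lemma N_ad [simp]: "N a \<Longrightarrow> N b \<Longrightarrow> N (ad a b)" unfolding ad_def by (rule opr_graph) (auto simp: arith_lang_def)
lemma N_mu [simp]: "N a \<Longrightarrow> N b \<Longrightarrow> N (mu a b)" unfolding mu_def by (rule opr_graph) (auto simp: arith_lang_def)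

lemma ss_cong: "N a \<Longrightarrow> N b \<Longrightarrow> a \<approx> b \<Longrightarrow> ss a \<approx> ss b"
  unfolding ss_def by (rule opr_cong) (auto simp: arith_lang_def)

lemma ad_cong: "N a \<Longrightarrow> N b \<Longrightarrow> N c \<Longrightarrow> N d \<Longrightarrow> a \<approx> b \<Longrightarrow> c \<approx> d \<Longrightarrow> ad a c \<approx> ad b d"
  unfolding ad_def by (rule opr_cong) (auto simp: arith_lang_def less_Suc_eq)

lemma mu_cong: "N a \<Longrightarrow> N b \<Longrightarrow> N c \<Longrightarrow> N d \<Longrightarrow> a \<approx> b \<Longrightarrow> c \<approx> d \<Longrightarrow> mu a c \<approx> mu b d"
  unfolding mu_def by (rule opr_cong) (auto simp: arith_lang_def less_Suc_eq)

lemma eval_num_struct [simp]: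
  "eval num_struct e zero_tm = zz" "eval num_struct e (succ_tm t) = ss (eval num_struct e t)"
  "eval num_struct e (plus_tm s t) = ad (eval num_struct e s) (eval num_struct e t)"
  "eval num_struct e (times_tm s t) = mu (eval num_struct e s) (eval num_struct e t)"
  by (simp_all add: zz_def ss_def ad_def mu_def)

lemma arith_lang_simps [simp]:
  "(Zero, 0) \<in> funs arith_lang" "(Succ, Suc 0) \<in> funs arith_lang"
  "(Plus, Suc (Suc 0)) \<in> funs arith_lang" "(Times, Suc (Suc 0)) \<in> funs arith_lang"
  by (auto simp: arith_lang_def)

lemma Q1: "N a \<Longrightarrow> \<not> ss a \<approx> zz"
  using arith[of "Forall (Neg (Eq (succ_tm (Var 0)) zero_tm))"]
  by (simp add: Q_def sat_tr_Eq del: tr.simps(2) eval.simps(2))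

lemma Q2: "N a \<Longrightarrow> N b \<Longrightarrow> ss a \<approx> ss b \<Longrightarrow> a \<approx> b"
  using arith[of "Forall (Forall (Imp (Eq (succ_tm (Var 1)) (succ_tm (Var 0))) (Eq (Var 1) (Var 0))))"]
  by (simp add: Q_def sat_tr_Eq del: tr.simps(2) eval.simps(2))

lemma Q3: "N a \<Longrightarrow> a \<approx> zz \<or> (\<exists>b. N b \<and> a \<approx> ss b)"
  using arith[of "Forall (Disj (Eq (Var 0) zero_tm) (Exists (Eq (Var 1) (succ_tm (Var 0)))))"]
  by (simp add: Q_def sat_tr_Eq del: tr.simps(2) eval.simps(2) cong: conj_cong)

lemma Q4: "N a \<Longrightarrow> ad a zz \<approx> a"
  using arith[of "Forall (Eq (plus_tm (Var 0) zero_tm) (Var 0))"]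
  by (simp add: Q_def sat_tr_Eq del: tr.simps(2) eval.simps(2))

lemma Q5: "N a \<Longrightarrow> N b \<Longrightarrow> ad a (ss b) \<approx> ss (ad a b)"
  using arith[of "Forall (Forall (Eq (plus_tm (Var 1) (succ_tm (Var 0))) (succ_tm (plus_tm (Var 1) (Var 0)))))"]
  by (simp add: Q_def sat_tr_Eq del: tr.simps(2) eval.simps(2))

lemma Q6: "N a \<Longrightarrow> mu a zz \<approx> zz"
  using arith[of "Forall (Eq (times_tm (Var 0) zero_tm) zero_tm)"]
  by (simp add: Q_def sat_tr_Eq del: tr.simps(2) eval.simps(2))

lemma Q7: "N a \<Longrightarrow> N b \<Longrightarrow> mu a (ss b) \<approx> ad (mu a b) a"
  using arith[of "Forall (Forall (Eq (times_tm (Var 1) (succ_tm (Var 0))) (plus_tm (times_tm (Var 1) (Var 0)) (Var 1))))"]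
  by (simp add: Q_def sat_tr_Eq del: tr.simps(2) eval.simps(2))

text \<open>The witness is the left summand, as in \<open>le_fm\<close>. The order of the summands
  matters because Q does not prove commutativity: addition recurs on its right argument, so a is the
  number that can be taken apart.\<close>

definition Le :: "'a \<Rightarrow> 'a \<Rightarrow> bool" where "Le a b \<longleftrightarrow> (\<exists>x. N x \<and> ad x a \<approx> b)"

lemma sat_elem:
  "sat S e (app \<beta> [Var i, Var j, Var k]) \<longleftrightarrow> elem (e i) (e j) (e k)"
  using beta(2) by (subst sat_app_holds) (auto simp: elem_def)

text \<open>\<open>ext w d a w'\<close>: the sequence \<open>w'\<close> arises from \<open>w\<close> by truncation at \<open>d\<close> and appending \<open>a\<close>.\<close>

definition ext :: "'a \<Rightarrow> 'a \<Rightarrow> 'a \<Rightarrow> 'a \<Rightarrow> bool" where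
  "ext w d a w' \<longleftrightarrow> N d \<and> (\<forall>i y. N i \<and> Le i d \<longrightarrow>
     (elem y i w' \<longleftrightarrow> (\<not> i \<approx> d \<and> elem y i w) \<or> (i \<approx> d \<and> eqr S y a)))"

lemma sat_tr_le: "N (e i) \<Longrightarrow> N (e j) \<Longrightarrow> sat S e (tr I (le_fm (Var i) (Var j))) \<longleftrightarrow> Le (e i) (e j)"
  by (simp add: le_fm_def Le_def sat_tr_Eq del: tr.simps(2) eval.simps(2) cong: conj_cong)

lemma sat_tr_lt:
  "N (e i) \<Longrightarrow> N (e j) \<Longrightarrow> sat S e (tr I (lt_fm (Var i) (Var j))) \<longleftrightarrow> Le (e i) (e j) \<and> \<not> e i \<approx> e j"
  by (simp add: lt_fm_def sat_tr_le sat_tr_Eq del: tr.simps(2))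

lemma sat_tr_eq_Var: "N (e i) \<Longrightarrow> N (e j) \<Longrightarrow> sat S e (tr I (Eq (Var i) (Var j))) \<longleftrightarrow> e i \<approx> e j"
  by (simp add: sat_tr_Eq del: tr.simps(2))

lemma ext_exists:
  assumes "N d"
  shows "\<exists>w'. ext w d a w'"
proof -
  let ?e = "\<lambda>w' i y. case_nat y (case_nat i (case_nat w' (case_nat d (case_nat a (case_nat w undefined)))))"
  obtain w' where w': "\<And>i y. sat S (?e w' i y)
     (Imp (Conj (in_dom I 3) (Conj (in_dom I 1) (tr I (le_fm (Var 1) (Var 3)))))
       (Iff (app \<beta> [Var 0, Var 1, Var 2])
         (Disj (Conj (tr I (lt_fm (Var 1) (Var 3))) (app \<beta> [Var 0, Var 1, Var 5]))
               (Conj (tr I (Eq (Var 1) (Var 3))) (Eq (Var 0) (Var 4))))))"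
    using seq[of undefined] unfolding sequence_ax_def sat.simps(7,8) by blast
  have e: "?e w' i y 0 = y" "?e w' i y 1 = i" "?e w' i y 2 = w'" "?e w' i y 3 = d" "?e w' i y 4 = a" "?e w' i y 5 = w"
    for i y by (simp_all add: numeral_eq_Suc)
  have "elem y i w' \<longleftrightarrow> (\<not> i \<approx> d \<and> elem y i w) \<or> (i \<approx> d \<and> eqr S y a)"
    if i: "N i" "Le i d" for i y
  proof -
    have N: "N (?e w' i y 1)" "N (?e w' i y 3)" unfolding e using i assms by auto
    show ?thesis
      using w'[of y i] i assms
      unfolding sat.simps(2-6) sat_in_dom sat_elem sat_tr_le[OF N] sat_tr_lt[OF N] sat_tr_eq_Var[OF N]
        eval.simps(1) e by blast
  qed
  then show ?thesis using assms unfolding ext_def by blast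
qed

definition std :: "nat \<Rightarrow> 'a" where "std n = (ss ^^ n) zz"

text \<open>A standard number may have many representatives, since the interpreted equality is not
  identity. Facts about standard numbers are stated for all representatives rather than for
  \<open>std n\<close>.\<close>

definition nm :: "'a \<Rightarrow> nat \<Rightarrow> bool" where "nm a n \<longleftrightarrow> N a \<and> a \<approx> std n"

lemma N_std [simp]: "N (std n)"
  by (induction n) (auto simp: std_def)

lemma std_Suc: "std (Suc n) = ss (std n)" by (simp add: std_def)
lemma std_0: "std 0 = zz" by (simp add: std_def)

lemma nm_std [simp]: "nm (std n) n"
  by (simp add: nm_def eqn_refl)

lemma nm_N: "nm a n \<Longrightarrow> N a"
  by (simp add: nm_def)

lemma nm_eqn: "nm a n \<Longrightarrow> N b \<Longrightarrow> a \<approx> b \<longleftrightarrow> nm b n"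
  unfolding nm_def by (meson N_std eqn_sym eqn_trans)

lemma nm_eqn': "nm a n \<Longrightarrow> N b \<Longrightarrow> b \<approx> a \<longleftrightarrow> nm b n"
  unfolding nm_def by (meson N_std eqn_sym eqn_trans)

lemma nm_zz [simp]: "nm zz 0"
  using nm_std[of 0] by (simp add: std_0)

lemma nm_ss_Suc: "N a \<Longrightarrow> nm (ss a) (Suc n) \<longleftrightarrow> nm a n"
  unfolding nm_def std_Suc by (auto intro: ss_cong Q2)

lemma not_nm_ss_0: "N a \<Longrightarrow> \<not> nm (ss a) 0"
  unfolding nm_def std_0 using Q1 by blast

lemma nm_unique: "nm a m \<Longrightarrow> nm a n \<Longrightarrow> m = n"
proof (induction m arbitrary: n a)
  case 0
  then show ?case
  proof (cases n)
    case (Suc n')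
    have "a \<approx> std n" using 0 by (simp add: nm_def)
    then have "nm (ss (std n')) 0" using 0 Suc nm_eqn[of a 0 "std n"] by (simp add: std_Suc)
    then show ?thesis using not_nm_ss_0 by simp
  qed simp
next
  case (Suc m)
  have "a \<approx> std (Suc m)" using Suc.prems by (simp add: nm_def)
  then have s: "nm (ss (std m)) n" using Suc.prems nm_eqn[of a n "std (Suc m)"] by (simp add: std_Suc)
  then obtain n' where n': "n = Suc n'" using not_nm_ss_0[of "std m"] by (cases n) auto
  then have "nm (std m) n'" using s nm_ss_Suc by simp
  then show ?case using Suc.IH[of "std m" n'] n' by simp
qed

lemma nm_ss: "nm a n \<Longrightarrow> nm (ss a) (Suc n)"
  using nm_ss_Suc nm_N by blast

lemma nm_ss_iff: "N a \<Longrightarrow> nm (ss a) n \<longleftrightarrow> (\<exists>m. n = Suc m \<and> nm a m)"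
  by (cases n) (auto simp: not_nm_ss_0 nm_ss_Suc)

lemma nm_ad: "nm a m \<Longrightarrow> nm b n \<Longrightarrow> nm (ad a b) (m + n)"
proof (induction n arbitrary: b)
  case 0
  then have "ad a b \<approx> ad a zz" by (intro ad_cong) (auto simp: nm_def std_0 eqn_refl)
  moreover have "ad a zz \<approx> a" using 0 nm_N Q4 by blast
  ultimately show ?case using 0 nm_N nm_eqn' by (metis N_ad N_zz add.right_neutral)
next
  case (Suc n)
  have N: "N a" "N b" using Suc.prems nm_N by auto
  have "ad a b \<approx> ad a (ss (std n))"
    using Suc.prems N by (intro ad_cong) (auto simp: nm_def std_Suc eqn_refl)
  moreover have "ad a (ss (std n)) \<approx> ss (ad a (std n))" using N by (intro Q5) auto
  moreover have "nm (ss (ad a (std n))) (Suc (m + n))" using Suc by (intro nm_ss) auto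
  ultimately show ?case using N nm_eqn' by (metis N_ad N_ss N_std add_Suc_right)
qed

lemma nm_mu: "nm a m \<Longrightarrow> nm b n \<Longrightarrow> nm (mu a b) (m * n)"
proof (induction n arbitrary: b)
  case 0
  then have "mu a b \<approx> mu a zz" by (intro mu_cong) (auto simp: nm_def std_0 eqn_refl)
  moreover have "mu a zz \<approx> zz" using 0 nm_N Q6 by blast
  ultimately show ?case using 0 nm_N nm_eqn' by (metis N_mu N_zz mult_0_right nm_zz)
next
  case (Suc n)
  have N: "N a" "N b" using Suc.prems nm_N by auto
  have "mu a b \<approx> mu a (ss (std n))"
    using Suc.prems N by (intro mu_cong) (auto simp: nm_def std_Suc eqn_refl)
  moreover have "mu a (ss (std n)) \<approx> ad (mu a (std n)) a" using N by (intro Q7) auto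
  moreover have "nm (ad (mu a (std n)) a) (m * n + m)" using Suc by (intro nm_ad) auto
  ultimately show ?case using N nm_eqn' by (metis N_ad N_mu N_ss N_std add.commute mult_Suc_right)
qed

text \<open>The standard numbers form an initial segment. For the direction from left to right, a
  predecessor is stripped from a and from the bound at the same time until a is zero; this is an
  induction on the standard n, outside the model.\<close>

lemma le_nm: "nm b n \<Longrightarrow> N a \<Longrightarrow> Le a b \<longleftrightarrow> (\<exists>m\<le>n. nm a m)"
proof
  assume b: "nm b n" and a: "N a" and "Le a b"
  then obtain x where "N x" "ad x a \<approx> b" by (auto simp: Le_def)
  then have "nm (ad x a) n" using a b nm_eqn' by auto
  then show "\<exists>m\<le>n. nm a m"
    using a
  proof (induction n arbitrary: a)
    case 0
    show ?case
    proof (rule ccontr)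
      assume *: "\<not> ?case"
      \<comment> \<open>If a were not zero it would have a predecessor c; then x + a would be a
        successor, which is not equal to zero.\<close>
      then obtain c where c: "N c" "a \<approx> ss c" using Q3[OF 0(2)] 0(2) by (auto simp: nm_def std_0)
      then have "ad x a \<approx> ss (ad x c)" using \<open>N x\<close> 0(2)
        by (intro eqn_trans[OF _ _ _ ad_cong Q5]) (auto simp: eqn_refl)
      then have "nm (ss (ad x c)) 0" using 0 c \<open>N x\<close> nm_eqn by auto
      then show False using not_nm_ss_0 c \<open>N x\<close> by simp
    qed
  next
    case (Suc n)
    show ?case
    proof (cases "a \<approx> zz")
      case True
      then have "nm a 0" using Suc by (simp add: nm_def std_0)
      then show ?thesis by blast
    next
      case False
      then obtain c where c: "N c" "a \<approx> ss c" using Q3[OF Suc(3)] by auto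
      then have "ad x a \<approx> ss (ad x c)" using \<open>N x\<close> Suc(3)
        by (intro eqn_trans[OF _ _ _ ad_cong Q5]) (auto simp: eqn_refl)
      then have "nm (ss (ad x c)) (Suc n)" using Suc.prems c \<open>N x\<close> nm_eqn by auto
      then have "nm (ad x c) n" using c \<open>N x\<close> nm_ss_Suc by simp
      then obtain m where "m \<le> n" "nm c m" using Suc.IH c by blast
      then have "nm a (Suc m)" using nm_ss[of c m] nm_eqn'[of "ss c" "Suc m" a] c Suc.prems by auto
      then show ?thesis using \<open>m \<le> n\<close> by blast
    qed
  qed
next
  assume b: "nm b n" and a: "N a" and "\<exists>m\<le>n. nm a m"
  then obtain m where m: "m \<le> n" "nm a m" by blast
  have "nm (ad (std (n - m)) a) n" using nm_ad[OF nm_std m(2), of "n - m"] m(1) by simp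
  then have "ad (std (n - m)) a \<approx> b" using b nm_eqn nm_N by blast
  then show "Le a b" unfolding Le_def by (meson N_std)
qed

text \<open>Q does not prove its order linear, but comparison with a standard number is possible by
  stripping successors from both sides. The final argument needs exactly this to compare an
  arbitrary bound with a standard one.\<close>

lemma le_total: "nm a m \<Longrightarrow> N b \<Longrightarrow> Le a b \<or> (\<exists>k<m. nm b k)"
proof (induction m arbitrary: a b)
  case 0
  \<comment> \<open>For a equal to zero, b itself is the missing left summand.\<close>
  have "ad b a \<approx> b"
    using 0 by (intro eqn_trans[OF _ _ _ ad_cong Q4]) (auto simp: nm_def std_0 eqn_refl)
  then show ?case using 0 by (auto simp: Le_def)
next
  case (Suc m)
  show ?case
  proof (cases "b \<approx> zz")
    case True
    then have "nm b 0" using Suc by (simp add: nm_def std_0)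
    then show ?thesis by blast
  next
    case False
    then obtain c where c: "N c" "b \<approx> ss c" using Q3[OF Suc(3)] by auto
    from Suc.IH[OF nm_std c(1)] show ?thesis
    proof
      assume "Le (std m) c"
      then obtain x where x: "N x" "ad x (std m) \<approx> c" by (auto simp: Le_def)
      have N: "N a" "N b" "N c" "N x" using Suc.prems nm_N x c by auto
      have 1: "ad x a \<approx> ad x (ss (std m))"
        using Suc.prems x by (intro ad_cong) (auto simp: nm_def std_Suc eqn_refl)
      have 2: "ad x (ss (std m)) \<approx> ss (ad x (std m))" using x by (intro Q5) auto
      have 3: "ss (ad x (std m)) \<approx> ss c" using x c by (intro ss_cong) auto
      have 4: "ss c \<approx> b" using c N by (auto intro: eqn_sym[of b])
      have "ad x a \<approx> ss (ad x (std m))" by (rule eqn_trans[OF _ _ _ 1 2]) (simp_all add: N)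
      from eqn_trans[OF _ _ _ this 3] have "ad x a \<approx> ss c" by (simp add: N)
      from eqn_trans[OF _ _ _ this 4] have "ad x a \<approx> b" by (simp add: N)
      then show ?thesis using x by (auto simp: Le_def)
    next
      assume "\<exists>k<m. nm c k"
      then obtain k where "k < m" "nm c k" by blast
      then have "nm b (Suc k)" using nm_ss[of c k] nm_eqn'[of "ss c" "Suc k" b] c Suc.prems by auto
      then show ?thesis using \<open>k < m\<close> by blast
    qed
  qed
qed

text \<open>Both components are explicitly bounded by the code. For nonstandard a and b, Q does not
  supply these bounds, and without them a standard code could also decode into nonstandard
  components.\<close>

definition pairM :: "'a \<Rightarrow> 'a \<Rightarrow> 'a \<Rightarrow> bool" where
  "pairM a b c \<longleftrightarrow> N a \<and> N b \<and> N c \<and> Le a c \<and> Le b c \<and>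
     (\<exists>s q. N s \<and> N q \<and> ad a b \<approx> s \<and> mu s s \<approx> q \<and> ad q a \<approx> c)"

lemma pairM_nm1: "nm a m \<Longrightarrow> nm b n \<Longrightarrow> pairM a b c \<longleftrightarrow> nm c (pr m n)"
proof -
  assume a: "nm a m" and b: "nm b n"
  have s: "ad a b \<approx> s \<longleftrightarrow> nm s (m + n)" if "N s" for s
    using nm_eqn[OF nm_ad[OF a b] that] .
  have q: "mu s s \<approx> q \<longleftrightarrow> nm q ((m + n) * (m + n))" if "nm s (m + n)" "N q" for s q
    using nm_eqn[OF nm_mu[OF that(1) that(1)] that(2)] .
  have c: "ad q a \<approx> c \<longleftrightarrow> nm c (pr m n)" if "nm q ((m + n) * (m + n))" "N c" for q c
    using nm_eqn[OF nm_ad[OF that(1) a] that(2)] by (simp add: pr_def)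
  have le: "Le a c" "Le b c" if "nm c (pr m n)"
    using le_nm[OF that] a b nm_N le_pr by blast+
  show ?thesis
  proof
    assume "pairM a b c"
    then show "nm c (pr m n)" using s q c unfolding pairM_def by blast
  next
    assume *: "nm c (pr m n)"
    moreover have "nm (ad a b) (m + n)" "nm (mu (ad a b) (ad a b)) ((m + n) * (m + n))"
      using nm_ad[OF a b] nm_mu by auto
    ultimately show "pairM a b c"
      using le[OF *] a b s q c nm_N unfolding pairM_def by meson
  qed
qed

lemma pairM_nm2: "nm c z \<Longrightarrow> pairM a b c \<longleftrightarrow> (\<exists>m n. nm a m \<and> nm b n \<and> z = pr m n)"
proof -
  assume c: "nm c z"
  show ?thesis
  proof
    assume p: "pairM a b c"
    then obtain m n where "nm a m" "nm b n" using le_nm[OF c] unfolding pairM_def by blast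
    then show "\<exists>m n. nm a m \<and> nm b n \<and> z = pr m n" using pairM_nm1[of a m b n c] p c nm_unique by blast
  qed (use pairM_nm1 c in blast)
qed

text \<open>Only standard positions below d are constrained. The index ranges over all
  representatives j of i because \<beta> is not assumed to respect the interpreted equality, and the
  entry is determined only up to \<open>eqr\<close>.\<close>

definition envrep :: "'a \<Rightarrow> nat \<Rightarrow> (nat \<Rightarrow> 'a) \<Rightarrow> bool" where
  "envrep w d e \<longleftrightarrow> (\<forall>i<d. \<forall>j. nm j i \<longrightarrow> (\<forall>y. elem y j w \<longleftrightarrow> eqr S y (e i)))"

lemma ext_envrep:
  assumes "nm d' d" "ext w d' a w'" "envrep w d e"
  shows "envrep w' (Suc d) (e(d := a))"
  unfolding envrep_def
proof (intro allI impI)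
  fix i j y assume "i < Suc d" and j: "nm j i"
  then have "N j" "Le j d'" using le_nm[OF assms(1)] nm_N less_Suc_eq_le by blast+
  moreover have "j \<approx> d' \<longleftrightarrow> i = d" using nm_eqn'[OF assms(1) \<open>N j\<close>] j nm_unique by auto
  ultimately show "elem y j w' \<longleftrightarrow> eqr S y ((e(d := a)) i)"
    using assms(2,3) j \<open>i < Suc d\<close> unfolding ext_def envrep_def by (auto simp: less_Suc_eq)
qed

text \<open>The sequence is extended a standard number of times. Any element can serve as the empty
  sequence, because length 0 imposes no condition.\<close>

lemma envrep_exists: "\<exists>w. envrep w d e"
proof (induction d)
  case (Suc d)
  then obtain w where w: "envrep w d e" by blast
  obtain w' where "ext w (std d) (e d) w'" using ext_exists[OF N_std] by blast
  from ext_envrep[OF nm_std this w] show ?case by auto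
qed (simp add: envrep_def)

end

text \<open>Definability is derived from the meaning of a relation by introduction rules, so that no
  formula for truth or refutability has to be written out.\<close>

definition defn :: "('f, 'p) lang \<Rightarrow> ('a, 'f, 'p) struct \<Rightarrow> ((nat \<Rightarrow> 'a) \<Rightarrow> bool) \<Rightarrow> bool" where
  "defn L S R \<longleftrightarrow> (\<exists>\<phi>. in_lang L \<phi> \<and> (\<forall>e. sat S e \<phi> \<longleftrightarrow> R e))"

named_theorems defn_intros

lemma defn_not [defn_intros]: "defn L S P \<Longrightarrow> defn L S (\<lambda>e. \<not> P e)"
  unfolding defn_def by (metis in_lang.simps(3) sat.simps(3))

lemma defn_conj [defn_intros]: "defn L S P \<Longrightarrow> defn L S R \<Longrightarrow> defn L S (\<lambda>e. P e \<and> R e)"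
  unfolding defn_def by (metis in_lang.simps(4) sat.simps(4))

lemma defn_disj [defn_intros]: "defn L S P \<Longrightarrow> defn L S R \<Longrightarrow> defn L S (\<lambda>e. P e \<or> R e)"
  unfolding defn_def by (metis in_lang.simps(5) sat.simps(5))

lemma defn_imp [defn_intros]: "defn L S P \<Longrightarrow> defn L S R \<Longrightarrow> defn L S (\<lambda>e. P e \<longrightarrow> R e)"
  unfolding defn_def by (metis in_lang.simps(6) sat.simps(6))

lemma defn_iff [defn_intros]: "defn L S P \<Longrightarrow> defn L S R \<Longrightarrow> defn L S (\<lambda>e. P e \<longleftrightarrow> R e)"
  unfolding iff_conv_conj_imp by (intro defn_conj defn_imp)

lemma defn_ex [defn_intros]:
  assumes "defn L S (\<lambda>e. R (e 0) (\<lambda>i. e (Suc i)))"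
  shows "defn L S (\<lambda>e. \<exists>a. R a e)"
proof -
  obtain \<phi> where "in_lang L \<phi>" "\<And>e. sat S e \<phi> \<longleftrightarrow> R (e 0) (\<lambda>i. e (Suc i))"
    using assms unfolding defn_def by blast
  then have "in_lang L (Exists \<phi>)" "\<And>e. sat S e (Exists \<phi>) \<longleftrightarrow> (\<exists>a. R a e)" by simp_all
  then show ?thesis unfolding defn_def by blast
qed

lemma defn_all [defn_intros]:
  assumes "defn L S (\<lambda>e. R (e 0) (\<lambda>i. e (Suc i)))"
  shows "defn L S (\<lambda>e. \<forall>a. R a e)"
proof -
  obtain \<phi> where "in_lang L \<phi>" "\<And>e. sat S e \<phi> \<longleftrightarrow> R (e 0) (\<lambda>i. e (Suc i))"
    using assms unfolding defn_def by blast
  then have "in_lang L (Forall \<phi>)" "\<And>e. sat S e (Forall \<phi>) \<longleftrightarrow> (\<forall>a. R a e)" by simp_all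
  then show ?thesis unfolding defn_def by blast
qed

lemma defn_eqr [defn_intros]: "defn L S (\<lambda>e. eqr S (e i) (e j))"
  unfolding defn_def by (intro exI[of _ "Eq (Var i) (Var j)"]) simp

lemma defn_const [defn_intros]: "defn L S (\<lambda>e. c)"
proof -
  let ?\<phi> = "Imp (Eq (Var 0) (Var 0)) (Eq (Var 0) (Var 0))"
  show ?thesis
    unfolding defn_def by (intro exI[of _ "if c then ?\<phi> else Neg ?\<phi>"]) simp
qed

lemma defn_bex: "(\<And>x. x \<in> set xs \<Longrightarrow> defn L S (P x)) \<Longrightarrow> defn L S (\<lambda>e. \<exists>x\<in>set xs. P x e)"
  by (induction xs) (auto intro: defn_intros)

lemma defn_ball: "(\<And>x. x \<in> set xs \<Longrightarrow> defn L S (P x)) \<Longrightarrow> defn L S (\<lambda>e. \<forall>x\<in>set xs. P x e)"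
  by (induction xs) (auto intro: defn_intros)

lemma defn_holds:
  assumes "in_lang L \<phi>" "fv \<phi> \<subseteq> {..<length is}"
  shows "defn L S (\<lambda>e. holds S \<phi> (map e is))"
proof -
  have "in_lang L (app \<phi> (map Var is))" using assms by (intro in_lang_app) (auto simp: list_all_iff)
  moreover have "sat S e (app \<phi> (map Var is)) \<longleftrightarrow> holds S \<phi> (map e is)" for e
    using assms(2) by (subst sat_app_holds) (auto simp: comp_def)
  ultimately show ?thesis unfolding defn_def by blast
qed

section \<open>Definability of the arithmetical relations\<close>

context sequential_model
begin

abbreviation "df \<equiv> defn L S"

lemma df_N [defn_intros]: "df (\<lambda>e. N (e i))"
  using defn_holds[of L "i_dom I" "[i]" S] wf by (auto simp: N_def interp_wf_def)

lemma df_eqn [defn_intros]: "df (\<lambda>e. e i \<approx> e j)"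
  using defn_holds[of L "i_eq I" "[i, j]" S] wf by (auto simp: eqn_def interp_wf_def)

lemma df_elem [defn_intros]: "df (\<lambda>e. elem (e i) (e j) (e k))"
proof -
  have "fv \<beta> \<subseteq> {..<length [i, j, k]}" using beta(2) by auto
  from defn_holds[OF beta(1) this, of S] show ?thesis by (simp add: elem_def)
qed

lemma df_gr:
  assumes "(f, length is) \<in> funs arith_lang"
  shows "df (\<lambda>e. gr f (map e is) (e j))"
proof -
  have "in_lang L (i_fun I f (length is))" "fv (i_fun I f (length is)) \<subseteq> {..<length (is @ [j])}"
    using wf assms by (auto simp: interp_wf_def lessThan_Suc_atMost)
  from defn_holds[OF this, of S] show ?thesis by (simp add: gr_def)
qed

text \<open>The operations \<open>zz\<close>, \<open>ss\<close>, \<open>ad\<close> and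
  \<open>mu\<close> depend on choices and are not definable as such; their graphs on N, taken up to
  the interpreted equality, are.\<close>

definition zeroM :: "'a \<Rightarrow> bool" where "zeroM a \<longleftrightarrow> N a \<and> zz \<approx> a"
definition succM :: "'a \<Rightarrow> 'a \<Rightarrow> bool" where "succM a b \<longleftrightarrow> N a \<and> N b \<and> ss a \<approx> b"
definition plusM :: "'a \<Rightarrow> 'a \<Rightarrow> 'a \<Rightarrow> bool" where "plusM a b c \<longleftrightarrow> N a \<and> N b \<and> N c \<and> ad a b \<approx> c"
definition timesM :: "'a \<Rightarrow> 'a \<Rightarrow> 'a \<Rightarrow> bool" where "timesM a b c \<longleftrightarrow> N a \<and> N b \<and> N c \<and> mu a b \<approx> c"
definition leM :: "'a \<Rightarrow> 'a \<Rightarrow> bool" where "leM a b \<longleftrightarrow> N a \<and> N b \<and> Le a b"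
definition ltM :: "'a \<Rightarrow> 'a \<Rightarrow> bool" where "ltM a b \<longleftrightarrow> leM a b \<and> \<not> a \<approx> b"

lemma df_zeroM [defn_intros]: "df (\<lambda>e. zeroM (e i))"
proof -
  have "df (\<lambda>e. N (e i) \<and> gr Zero (map e []) (e i))"
    by (intro defn_intros df_gr) simp
  moreover have "N a \<and> gr Zero [] a \<longleftrightarrow> zeroM a" for a
    using gr_opr[of Zero "[]" a] by (auto simp: zeroM_def zz_def)
  ultimately show ?thesis by simp
qed

lemma df_succM [defn_intros]: "df (\<lambda>e. succM (e i) (e j))"
proof -
  have "df (\<lambda>e. N (e i) \<and> N (e j) \<and> gr Succ (map e [i]) (e j))"
    by (intro defn_intros df_gr) simp
  moreover have "N a \<and> N b \<and> gr Succ [a] b \<longleftrightarrow> succM a b" for a b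
    using gr_opr[of Succ "[a]" b] by (auto simp: succM_def ss_def)
  ultimately show ?thesis by simp
qed

lemma df_plusM [defn_intros]: "df (\<lambda>e. plusM (e i) (e j) (e k))"
proof -
  have "df (\<lambda>e. N (e i) \<and> N (e j) \<and> N (e k) \<and> gr Plus (map e [i, j]) (e k))"
    by (intro defn_intros df_gr) simp
  moreover have "N a \<and> N b \<and> N c \<and> gr Plus [a, b] c \<longleftrightarrow> plusM a b c" for a b c
    using gr_opr[of Plus "[a, b]" c] by (auto simp: plusM_def ad_def)
  ultimately show ?thesis by simp
qed

lemma df_timesM [defn_intros]: "df (\<lambda>e. timesM (e i) (e j) (e k))"
proof -
  have "df (\<lambda>e. N (e i) \<and> N (e j) \<and> N (e k) \<and> gr Times (map e [i, j]) (e k))"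
    by (intro defn_intros df_gr) simp
  moreover have "N a \<and> N b \<and> N c \<and> gr Times [a, b] c \<longleftrightarrow> timesM a b c" for a b c
    using gr_opr[of Times "[a, b]" c] by (auto simp: timesM_def mu_def)
  ultimately show ?thesis by simp
qed

lemma df_leM [defn_intros]: "df (\<lambda>e. leM (e i) (e j))"
proof -
  have "df (\<lambda>e. N (e i) \<and> N (e j) \<and> (\<exists>x. plusM x (e i) (e j)))" by (intro defn_intros)
  moreover have "N a \<and> N b \<and> (\<exists>x. plusM x a b) \<longleftrightarrow> leM a b" for a b
    by (auto simp: leM_def plusM_def Le_def)
  ultimately show ?thesis by simp
qed

lemma df_ltM [defn_intros]: "df (\<lambda>e. ltM (e i) (e j))"
  unfolding ltM_def by (intro defn_intros)

lemma df_pairM [defn_intros]: "df (\<lambda>e. pairM (e i) (e j) (e k))"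
proof -
  have "df (\<lambda>e. leM (e i) (e k) \<and> leM (e j) (e k) \<and>
      (\<exists>s q. plusM (e i) (e j) s \<and> timesM s s q \<and> plusM q (e i) (e k)))" by (intro defn_intros)
  moreover have "leM a c \<and> leM b c \<and> (\<exists>s q. plusM a b s \<and> timesM s s q \<and> plusM q a c) \<longleftrightarrow> pairM a b c" for a b c
    by (auto simp: leM_def plusM_def timesM_def pairM_def)
  ultimately show ?thesis by simp
qed

lemma df_ext [defn_intros]: "df (\<lambda>e. ext (e i) (e j) (e k) (e l))"
proof -
  have "df (\<lambda>e. N (e j) \<and> (\<forall>x y. leM x (e j) \<longrightarrow>
     (elem y x (e l) \<longleftrightarrow> (\<not> x \<approx> e j \<and> elem y x (e i)) \<or> (x \<approx> e j \<and> eqr S y (e k)))))"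
    by (intro defn_intros)
  moreover have "N d \<and> (\<forall>x y. leM x d \<longrightarrow>
     (elem y x w' \<longleftrightarrow> (\<not> x \<approx> d \<and> elem y x w) \<or> (x \<approx> d \<and> eqr S y a))) \<longleftrightarrow> ext w d a w'" for d w w' a
    unfolding ext_def leM_def by blast
  ultimately show ?thesis by simp
qed

lemma zeroM_nm: "zeroM a \<longleftrightarrow> nm a 0"
  using nm_eqn[OF nm_zz] by (auto simp: zeroM_def dest: nm_N)

lemma succM_nm1: "nm a n \<Longrightarrow> succM a b \<longleftrightarrow> nm b (Suc n)"
  using nm_eqn[OF nm_ss] by (auto simp: succM_def dest: nm_N)

lemma succM_nm2: "nm b n \<Longrightarrow> succM a b \<longleftrightarrow> (\<exists>m. n = Suc m \<and> nm a m)"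
  using nm_eqn'[of b n "ss a"] nm_ss_iff[of a n] by (auto simp: succM_def dest: nm_N)

lemma leM_nm: "nm b n \<Longrightarrow> leM a b \<longleftrightarrow> (\<exists>m\<le>n. nm a m)"
  using le_nm[of b n a] by (auto simp: leM_def dest: nm_N)

lemma ltM_nm: "nm b n \<Longrightarrow> ltM a b \<longleftrightarrow> (\<exists>m<n. nm a m)"
  using leM_nm[of b n a] nm_eqn'[of b n a] nm_unique nm_N
  unfolding ltM_def by (metis less_imp_le order_less_le)

lemma leM_total: "nm a m \<Longrightarrow> N b \<Longrightarrow> leM a b \<or> (\<exists>k<m. nm b k)"
  using le_total[of a m b] nm_N by (auto simp: leM_def)

lemma df_nm [defn_intros]: "df (\<lambda>e. nm (e i) n)"
proof (induction n arbitrary: i)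
  case 0
  show ?case unfolding zeroM_nm[symmetric] by (intro defn_intros)
next
  case (Suc n)
  have "nm b (Suc n) \<longleftrightarrow> (\<exists>a. nm a n \<and> succM a b)" for b
    using succM_nm1 nm_std by blast
  then show ?case by (simp only:) (intro defn_intros Suc)
qed

end

section \<open>Formulae stratified by quantifier alternation\<close>

text \<open>Formulae with named variables, in negation normal form. \<open>Lit q b is\<close> is the atom number \<open>q\<close>,
  negated unless \<open>b\<close>; \<open>True\<close> selects conjunction and existential quantification; \<open>Up\<close> has no meaning
  of its own and only separates levels of quantifier alternation.\<close>

datatype cf = Lit nat bool "nat list" | Bin bool cf cf | Qu bool nat cf | Up bool cf

primrec sem :: "(nat \<Rightarrow> 'a list \<Rightarrow> bool) \<Rightarrow> cf \<Rightarrow> (nat \<Rightarrow> 'a) \<Rightarrow> bool" where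
  "sem R (Lit q b is) = (\<lambda>e. R q (map e is) = b)"
| "sem R (Bin t a b) = (\<lambda>e. if t then sem R a e \<and> sem R b e else sem R a e \<or> sem R b e)"
| "sem R (Qu t i a) = (\<lambda>e. if t then \<exists>x. sem R a (e(i := x)) else \<forall>x. sem R a (e(i := x)))"
| "sem R (Up t a) = sem R a"

datatype ('f, 'p) at = EqA | RelA 'p nat | FunA 'f nat

primrec ar :: "('f, 'p) at \<Rightarrow> nat" where
  "ar EqA = 2" | "ar (RelA p k) = k" | "ar (FunA f k) = Suc k"

text \<open>The atom of a function symbol is its graph, with the value as first argument.\<close>

fun at_sem :: "('a, 'f, 'p) struct \<Rightarrow> ('f, 'p) at \<Rightarrow> 'a list \<Rightarrow> bool" where
  "at_sem S EqA as = eqr S (as ! 0) (as ! 1)"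
| "at_sem S (RelA p k) as = rint S p as"
| "at_sem S (FunA f k) as = eqr S (fint S f (tl as)) (hd as)"

lemma at_sem_cong:
  assumes S: "cong_struct S" and "list_all2 (eqr S) as bs" "length as = ar a"
  shows "at_sem S a as = at_sem S a bs"
proof (cases a)
  case EqA
  then have "eqr S (as ! 0) (bs ! 0)" "eqr S (as ! 1) (bs ! 1)"
    using assms by (auto simp: list_all2_conv_all_nth)
  then show ?thesis using EqA eqr_sym[OF S] eqr_trans[OF S] by (metis at_sem.simps(1))
next
  case (RelA p k)
  then show ?thesis using assms by (auto simp: cong_struct_def)
next
  case (FunA f k)
  then obtain x xs y ys where "as = x # xs" "bs = y # ys"
    using assms by (metis Suc_length_conv ar.simps(3) list_all2_lengthD)
  then have *: "eqr S x y" "list_all2 (eqr S) xs ys" using assms by auto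
  then have "eqr S (fint S f xs) (fint S f ys)" using S by (auto simp: cong_struct_def)
  then show ?thesis using * FunA \<open>as = x # xs\<close> \<open>bs = y # ys\<close> eqr_sym[OF S] eqr_trans[OF S]
    by (metis at_sem.simps(3) list.sel(1,3))
qed

text \<open>Finiteness of the language enters here: an atom is coded by its position in a list, and
  truth of an atomic formula becomes a finite case distinction in \<open>litM\<close>.\<close>

locale lang_atoms =
  fixes L :: "('f, 'p) lang" and ats :: "('f, 'p) at list"
  assumes set_ats: "set ats = {EqA} \<union> (\<lambda>(p, k). RelA p k) ` rels L \<union> (\<lambda>(f, k). FunA f k) ` funs L"
    and distinct_ats: "distinct ats"
begin

abbreviation na :: nat where "na \<equiv> length ats"

abbreviation arq :: "nat \<Rightarrow> nat" where "arq q \<equiv> ar (ats ! q)"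

definition RS :: "('a, 'f, 'p) struct \<Rightarrow> nat \<Rightarrow> 'a list \<Rightarrow> bool" where
  "RS S q as = at_sem S (ats ! q) as"

primrec ok :: "cf \<Rightarrow> bool" where
  "ok (Lit q b is) \<longleftrightarrow> q < na \<and> length is = arq q"
| "ok (Bin t a b) \<longleftrightarrow> ok a \<and> ok b"
| "ok (Qu t i a) \<longleftrightarrow> ok a"
| "ok (Up t a) \<longleftrightarrow> ok a"

text \<open>\<open>cwf True m d\<close> and \<open>cwf False m d\<close> are the \<open>\<Sigma>\<close>- and \<open>\<Pi>\<close>-formulae of level \<open>m\<close> whose free
  variables are below \<open>d\<close>; a quantifier at depth \<open>d\<close> binds variable \<open>d\<close>.\<close>

inductive cwf :: "bool \<Rightarrow> nat \<Rightarrow> nat \<Rightarrow> cf \<Rightarrow> bool" where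
  "q < na \<Longrightarrow> length is = arq q \<Longrightarrow> \<forall>i\<in>set is. i < d \<Longrightarrow> cwf s 0 d (Lit q b is)"
| "cwf b m d c \<Longrightarrow> cwf s (Suc m) d (Up b c)"
| "cwf s (Suc m) d a \<Longrightarrow> cwf s (Suc m) d b \<Longrightarrow> cwf s (Suc m) d (Bin t a b)"
| "cwf s (Suc m) (Suc d) a \<Longrightarrow> cwf s (Suc m) d (Qu s d a)"

lemma cwf_ok: "cwf s m d c \<Longrightarrow> ok c"
  by (induction rule: cwf.induct) auto

lemma sem_ok:
  "ok c \<Longrightarrow> (\<And>q as. q < na \<Longrightarrow> length as = arq q \<Longrightarrow> R q as = R' q as) \<Longrightarrow> sem R c e = sem R' c e"
  by (induction c arbitrary: e) auto

text \<open>One formula has to express P in all structures on the given carrier, because the same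
  formula is later evaluated both in S and in a countermodel.\<close>

definition rep :: "bool \<Rightarrow> nat \<Rightarrow> nat \<Rightarrow> (('a, 'f, 'p) struct \<Rightarrow> (nat \<Rightarrow> 'a) \<Rightarrow> bool) \<Rightarrow> bool" where
  "rep s m d P \<longleftrightarrow> (\<exists>c. cwf s m d c \<and> (\<forall>S e. cong_struct S \<longrightarrow> sem (RS S) c e = P S e))"

lemma rep_cong: "rep s m d P \<Longrightarrow> (\<And>S e. cong_struct S \<Longrightarrow> P S e = P' S e) \<Longrightarrow> rep s m d P'"
  unfolding rep_def by metis

lemma rep_lit:
  assumes "q < na" "length is = arq q" "\<forall>i\<in>set is. i < d"
  shows "rep s 0 d (\<lambda>S e. at_sem S (ats ! q) (map e is) = b)"
  unfolding rep_def by (intro exI[of _ "Lit q b is"]) (auto intro!: cwf.intros assms simp: RS_def)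

lemma rep_up: "rep b m d P \<Longrightarrow> rep s (Suc m) d P"
  unfolding rep_def by (metis cwf.intros(2) sem.simps(4))

lemma rep_conj:
  assumes "rep s (Suc m) d P" "rep s (Suc m) d P'"
  shows "rep s (Suc m) d (\<lambda>S e. P S e \<and> P' S e)"
proof -
  obtain a b where "cwf s (Suc m) d a" "\<And>S e. cong_struct S \<longrightarrow> sem (RS S) a e = P S e"
    "cwf s (Suc m) d b" "\<And>S e. cong_struct S \<longrightarrow> sem (RS S) b e = P' S e"
    using assms unfolding rep_def by blast
  then show ?thesis unfolding rep_def by (intro exI[of _ "Bin True a b"]) (auto intro: cwf.intros)
qed

lemma rep_disj:
  assumes "rep s (Suc m) d P" "rep s (Suc m) d P'"
  shows "rep s (Suc m) d (\<lambda>S e. P S e \<or> P' S e)"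
proof -
  obtain a b where "cwf s (Suc m) d a" "\<And>S e. cong_struct S \<longrightarrow> sem (RS S) a e = P S e"
    "cwf s (Suc m) d b" "\<And>S e. cong_struct S \<longrightarrow> sem (RS S) b e = P' S e"
    using assms unfolding rep_def by blast
  then show ?thesis unfolding rep_def by (intro exI[of _ "Bin False a b"]) (auto intro: cwf.intros)
qed

lemma rep_ex:
  assumes "rep True (Suc m) (Suc d) P"
  shows "rep True (Suc m) d (\<lambda>S e. \<exists>x. P S (e(d := x)))"
proof -
  obtain a where "cwf True (Suc m) (Suc d) a" "\<And>S e. cong_struct S \<longrightarrow> sem (RS S) a e = P S e"
    using assms unfolding rep_def by blast
  then show ?thesis unfolding rep_def by (intro exI[of _ "Qu True d a"]) (auto intro: cwf.intros)
qed

lemma rep_all: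
  assumes "rep False (Suc m) (Suc d) P"
  shows "rep False (Suc m) d (\<lambda>S e. \<forall>x. P S (e(d := x)))"
proof -
  obtain a where "cwf False (Suc m) (Suc d) a" "\<And>S e. cong_struct S \<longrightarrow> sem (RS S) a e = P S e"
    using assms unfolding rep_def by blast
  then show ?thesis unfolding rep_def by (intro exI[of _ "Qu False d a"]) (auto intro: cwf.intros)
qed

lemma atom_index: "a \<in> set ats \<Longrightarrow> \<exists>q<na. ats ! q = a"
  by (metis in_set_conv_nth)

lemma eval_upd:
  fixes d :: nat
  shows "(\<forall>i\<in>fv_tm t. \<rho> i < d) \<Longrightarrow> eval S (\<lambda>i. (e(d := x)) (\<rho> i)) t = eval S (\<lambda>i. e (\<rho> i)) t"
  by (rule eval_fv) auto

text \<open>Terms are replaced by variables one after the other: \<open>zs\<close> are the arguments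
  already named, \<open>ts\<close> those still to come. A value exists and is unique up to
  \<open>eqr\<close>, so a negated atom also needs only existential quantifiers in front. The
  premise about terms is kept abstract so that the induction in \<open>rep_tm\<close> can supply
  it.\<close>

lemma rep_atom:
  assumes "\<And>t d z. t \<in> set ts \<Longrightarrow> \<forall>i\<in>fv_tm t. \<rho> i < d \<Longrightarrow> z < d \<Longrightarrow>
      rep True 1 d (\<lambda>(S :: ('a, 'f, 'p) struct) e. eqr S (eval S (\<lambda>i. e (\<rho> i)) t) (e z))"
    and "q < na" "length zs + length ts = arq q" "\<forall>z\<in>set zs. z < d" "\<forall>t\<in>set ts. \<forall>i\<in>fv_tm t. \<rho> i < d"
  shows "rep True 1 d (\<lambda>(S :: ('a, 'f, 'p) struct) e. at_sem S (ats ! q) (map e zs @ map (eval S (\<lambda>i. e (\<rho> i))) ts) = b)"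
  using assms
proof (induction ts arbitrary: d zs)
  case Nil
  then have "rep True (Suc 0) d (\<lambda>(S :: ('a, 'f, 'p) struct) e. at_sem S (ats ! q) (map e zs) = b)"
    by (intro rep_up[of True] rep_lit) auto
  then show ?case by simp
next
  case (Cons t ts)
  have 1: "rep True 1 (Suc d) (\<lambda>(S :: ('a, 'f, 'p) struct) e. eqr S (eval S (\<lambda>i. e (\<rho> i)) t) (e d))"
    using Cons.prems(5) by (intro Cons.prems(1)) auto
  have 2: "rep True 1 (Suc d) (\<lambda>(S :: ('a, 'f, 'p) struct) e. at_sem S (ats ! q) (map e (zs @ [d]) @ map (eval S (\<lambda>i. e (\<rho> i))) ts) = b)"
  proof (rule Cons.IH)
    fix u d' z assume "u \<in> set ts" "\<forall>i\<in>fv_tm u. \<rho> i < d'" "z < d'"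
    then show "rep True 1 d' (\<lambda>(S :: ('a, 'f, 'p) struct) e. eqr S (eval S (\<lambda>i. e (\<rho> i)) u) (e z))"
      by (intro Cons.prems(1)) auto
  qed (use Cons.prems(2-5) in \<open>auto intro: less_SucI\<close>)
  have "rep True 1 d (\<lambda>(S :: ('a, 'f, 'p) struct) e. \<exists>x. eqr S (eval S (\<lambda>i. (e(d := x)) (\<rho> i)) t) ((e(d := x)) d) \<and>
     (at_sem S (ats ! q) (map (e(d := x)) (zs @ [d]) @ map (eval S (\<lambda>i. (e(d := x)) (\<rho> i))) ts) = b))"
    using rep_ex[OF rep_conj, OF 1[unfolded One_nat_def] 2[unfolded One_nat_def]] by simp
  then show ?case
  proof (rule rep_cong)
    fix S :: "('a, 'f, 'p) struct" and e assume S: "cong_struct S"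
    let ?v = "eval S (\<lambda>i. e (\<rho> i))"
    have m: "map (e(d := x)) (zs @ [d]) @ map (eval S (\<lambda>i. (e(d := x)) (\<rho> i))) ts = map e zs @ x # map ?v ts" for x
      using Cons.prems(4,5) eval_upd[of _ \<rho> d S e x] by (auto intro!: map_cong)
    have h1: "at_sem S (ats ! q) (map e zs @ x # map ?v ts) = at_sem S (ats ! q) (map e zs @ ?v t # map ?v ts)"
      if "eqr S (?v t) x" for x
    proof (rule at_sem_cong[OF S, symmetric])
      show "list_all2 (eqr S) (map e zs @ ?v t # map ?v ts) (map e zs @ x # map ?v ts)"
        using that by (intro list_all2_appendI) (auto simp: eqr_refl[OF S] list_all2_same)
      show "length (map e zs @ ?v t # map ?v ts) = ar (ats ! q)" using Cons.prems(3) by simp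
    qed
    have h2: "eqr S (?v t) (?v t)" by (simp add: eqr_refl[OF S])
    have h3: "eval S (\<lambda>i. (e(d := x)) (\<rho> i)) t = ?v t" for x
      using Cons.prems(5) by (intro eval_upd) auto
    show "(\<exists>x. eqr S (eval S (\<lambda>i. (e(d := x)) (\<rho> i)) t) ((e(d := x)) d) \<and>
       (at_sem S (ats ! q) (map (e(d := x)) (zs @ [d]) @ map (eval S (\<lambda>i. (e(d := x)) (\<rho> i))) ts) = b)) =
      (at_sem S (ats ! q) (map e zs @ map ?v (t # ts)) = b)"
      unfolding m h3 fun_upd_same list.map 
    proof
      assume "\<exists>x. eqr S (?v t) x \<and> (at_sem S (ats ! q) (map e zs @ x # map ?v ts) = b)"
      then show "at_sem S (ats ! q) (map e zs @ ?v t # map ?v ts) = b" using h1 by auto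
    qed (use h2 in auto)
  qed
qed

lemma rep_tm:
  "in_lang_tm L t \<Longrightarrow> \<forall>i\<in>fv_tm t. \<rho> i < d \<Longrightarrow> z < d \<Longrightarrow>
    rep True 1 d (\<lambda>(S :: ('a, 'f, 'p) struct) e. eqr S (eval S (\<lambda>i. e (\<rho> i)) t) (e z))"
proof (induction t arbitrary: d z)
  case (Var i)
  obtain q where q: "q < na" "ats ! q = EqA" using atom_index set_ats by blast
  have "rep True (Suc 0) d (\<lambda>(S :: ('a, 'f, 'p) struct) e. at_sem S (ats ! q) (map e [\<rho> i, z]) = True)"
    using Var q by (intro rep_up[of True] rep_lit) auto
  then show ?case using q by simp
next
  case (Fun f ts)
  then have "FunA f (length ts) \<in> set ats" unfolding set_ats by force
  then obtain q where q: "q < na" "ats ! q = FunA f (length ts)" using atom_index by blast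
  have "rep True 1 d (\<lambda>(S :: ('a, 'f, 'p) struct) e. at_sem S (ats ! q) (map e [z] @ map (eval S (\<lambda>i. e (\<rho> i))) ts) = True)"
  proof (rule rep_atom)
    fix t d z assume "t \<in> set ts" "\<forall>i\<in>fv_tm t. \<rho> i < d" "z < d"
    then show "rep True 1 d (\<lambda>(S :: ('a, 'f, 'p) struct) e. eqr S (eval S (\<lambda>i. e (\<rho> i)) t) (e z))"
      using Fun.prems(1) by (intro Fun.IH) (auto simp: list_all_iff)
  qed (use Fun q in auto)
  then show ?case using q by simp
qed

lemma rep_Rel:
  assumes "in_lang L (Rel p ts)" "\<forall>i\<in>fv (Rel p ts). \<rho> i < d"
  shows "rep True 1 d (\<lambda>S e. sat S (\<lambda>i. e (\<rho> i)) (Rel p ts) = b)"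
proof -
  have "RelA p (length ts) \<in> set ats" using assms(1) unfolding set_ats by force
  then obtain q where q: "q < na" "ats ! q = RelA p (length ts)" using atom_index by blast
  have "rep True 1 d (\<lambda>S e. at_sem S (ats ! q) (map e [] @ map (eval S (\<lambda>i. e (\<rho> i))) ts) = b)"
    using assms q by (intro rep_atom rep_tm) (auto simp: list_all_iff)
  then show ?thesis using q by simp
qed

lemma rep_Eq:
  assumes "in_lang L (Eq s t)" "\<forall>i\<in>fv (Eq s t). \<rho> i < d"
  shows "rep True 1 d (\<lambda>S e. sat S (\<lambda>i. e (\<rho> i)) (Eq s t) = b)"
proof -
  obtain q where q: "q < na" "ats ! q = EqA" using atom_index set_ats by blast
  have "rep True 1 d (\<lambda>S e. at_sem S (ats ! q) (map e [] @ map (eval S (\<lambda>i. e (\<rho> i))) [s, t]) = b)"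
    using assms q by (intro rep_atom rep_tm) auto
  then show ?thesis using q by simp
qed

lemmas connective_simps = sat.simps de_Morgan_conj de_Morgan_disj imp_conv_disj not_not eq_True eq_False

text \<open>Flattened atoms are existential formulae of level 1. Under \<open>Up\<close> they count
  for both sides at level 2, where Boolean combinations are free. Both truth values are treated
  together because negation has been pushed into the literals.\<close>

lemma rep_qfree:
  assumes "quantifier_free \<phi>" "in_lang L \<phi>" "\<forall>i\<in>fv \<phi>. \<rho> i < d"
  shows "rep s 2 d (\<lambda>(S :: ('a, 'f, 'p) struct) e. sat S (\<lambda>i. e (\<rho> i)) \<phi> = b)"
proof -
  have two: "2 = Suc (Suc 0)" by simp
  have "rep s 2 d (\<lambda>(S :: ('a, 'f, 'p) struct) e. sat S (\<lambda>i. e (\<rho> i)) \<phi>) \<and> rep s 2 d (\<lambda>(S :: ('a, 'f, 'p) struct) e. \<not> sat S (\<lambda>i. e (\<rho> i)) \<phi>)"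
    using assms
  proof (induction \<phi>)
    case (Rel p ts)
    then show ?case
      using rep_up[OF rep_Rel[of p ts \<rho> d True], of s] rep_up[OF rep_Rel[of p ts \<rho> d False], of s]
      by (simp add: two)
  next
    case (Eq t u)
    then show ?case
      using rep_up[OF rep_Eq[of t u \<rho> d True], of s] rep_up[OF rep_Eq[of t u \<rho> d False], of s]
      by (simp add: two)
  next
    case (Conj \<phi> \<psi>)
    then have "rep s 2 d (\<lambda>(S :: ('a, 'f, 'p) struct) e. sat S (\<lambda>i. e (\<rho> i)) \<phi>)" "rep s 2 d (\<lambda>(S :: ('a, 'f, 'p) struct) e. \<not> sat S (\<lambda>i. e (\<rho> i)) \<phi>)"
      "rep s 2 d (\<lambda>(S :: ('a, 'f, 'p) struct) e. sat S (\<lambda>i. e (\<rho> i)) \<psi>)" "rep s 2 d (\<lambda>(S :: ('a, 'f, 'p) struct) e. \<not> sat S (\<lambda>i. e (\<rho> i)) \<psi>)" by auto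
    then show ?case unfolding connective_simps two by (intro conjI rep_conj rep_disj)
  next
    case (Disj \<phi> \<psi>)
    then have "rep s 2 d (\<lambda>(S :: ('a, 'f, 'p) struct) e. sat S (\<lambda>i. e (\<rho> i)) \<phi>)" "rep s 2 d (\<lambda>(S :: ('a, 'f, 'p) struct) e. \<not> sat S (\<lambda>i. e (\<rho> i)) \<phi>)"
      "rep s 2 d (\<lambda>(S :: ('a, 'f, 'p) struct) e. sat S (\<lambda>i. e (\<rho> i)) \<psi>)" "rep s 2 d (\<lambda>(S :: ('a, 'f, 'p) struct) e. \<not> sat S (\<lambda>i. e (\<rho> i)) \<psi>)" by auto
    then show ?case unfolding connective_simps two by (intro conjI rep_conj rep_disj)
  next
    case (Imp \<phi> \<psi>)
    then have "rep s 2 d (\<lambda>(S :: ('a, 'f, 'p) struct) e. sat S (\<lambda>i. e (\<rho> i)) \<phi>)" "rep s 2 d (\<lambda>(S :: ('a, 'f, 'p) struct) e. \<not> sat S (\<lambda>i. e (\<rho> i)) \<phi>)"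
      "rep s 2 d (\<lambda>(S :: ('a, 'f, 'p) struct) e. sat S (\<lambda>i. e (\<rho> i)) \<psi>)" "rep s 2 d (\<lambda>(S :: ('a, 'f, 'p) struct) e. \<not> sat S (\<lambda>i. e (\<rho> i)) \<psi>)" by auto
    then show ?case unfolding connective_simps two by (intro conjI rep_conj rep_disj)
  qed auto
  then show ?thesis by (cases b) auto
qed

text \<open>The de Bruijn index \<open>i\<close> at depth \<open>d\<close> corresponds to the named variable \<open>d - 1 - i\<close>.\<close>

definition lv :: "nat \<Rightarrow> (nat \<Rightarrow> 'a) \<Rightarrow> nat \<Rightarrow> 'a" where
  "lv d e = (\<lambda>i. e (d - Suc i))"

lemma sat_lv_Suc:
  assumes "fv \<phi> \<subseteq> {..<Suc d}"
  shows "sat S (lv (Suc d) (e(d := x))) \<phi> = sat S (case_nat x (lv d e)) \<phi>"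
  by (rule sat_fv) (use assms in \<open>auto simp: lv_def split: nat.split\<close>)

lemma fv_quant: "fv (Exists \<phi>) \<subseteq> {..<d} \<longleftrightarrow> fv \<phi> \<subseteq> {..<Suc d}"
proof -
  have "(\<forall>i. i \<in> A \<longrightarrow> i < Suc d) \<longleftrightarrow> (\<forall>i. Suc i \<in> A \<longrightarrow> i < d)" for A
    by (metis Suc_less_eq not0_implies_Suc zero_less_Suc)
  then show ?thesis by (simp add: subset_iff)
qed

text \<open>The \<open>itself\<close> argument fixes the carrier type, which occurs in none of the
  other arguments.\<close>

definition rep_sat :: "bool \<Rightarrow> nat \<Rightarrow> ('f, 'p) fm \<Rightarrow> bool \<Rightarrow> ('a, 'f, 'p) struct itself \<Rightarrow> bool" where
  "rep_sat s m \<phi> b (_ :: ('a, 'f, 'p) struct itself) \<longleftrightarrow>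
     (\<forall>d. fv \<phi> \<subseteq> {..<d} \<longrightarrow> rep s m d (\<lambda>(S :: ('a, 'f, 'p) struct) e. sat S (lv d e) \<phi> = b))"

lemma rep_sat_conj:
  fixes A :: "('a, 'f, 'p) struct itself"
  assumes "rep_sat s (Suc m) \<phi> b A" "rep_sat s (Suc m) \<psi> b' A" "fv \<chi> = fv \<phi> \<union> fv \<psi>"
    and "\<And>(S :: ('a, 'f, 'p) struct) e. (sat S e \<chi> = c) = ((sat S e \<phi> = b) \<and> (sat S e \<psi> = b'))"
  shows "rep_sat s (Suc m) \<chi> c A"
  using assms(1,2) unfolding rep_sat_def assms(3,4) Un_subset_iff by (intro allI impI rep_conj) simp_all

lemma rep_sat_disj:
  fixes A :: "('a, 'f, 'p) struct itself"
  assumes "rep_sat s (Suc m) \<phi> b A" "rep_sat s (Suc m) \<psi> b' A" "fv \<chi> = fv \<phi> \<union> fv \<psi>"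
    and "\<And>(S :: ('a, 'f, 'p) struct) e. (sat S e \<chi> = c) = ((sat S e \<phi> = b) \<or> (sat S e \<psi> = b'))"
  shows "rep_sat s (Suc m) \<chi> c A"
  using assms(1,2) unfolding rep_sat_def assms(3,4) Un_subset_iff by (intro allI impI rep_disj) simp_all

text \<open>\<open>Neg\<close> and \<open>Imp\<close> exchange the two classes, whereas stratified
  formulae negate only literals. So truth and falsity of \<phi> are represented simultaneously, on
  opposite sides of the same level.\<close>

lemma rep_Star:
  fixes A :: "('a, 'f, 'p) struct itself"
  shows "SigmaStar m \<phi> \<Longrightarrow> in_lang L \<phi> \<longrightarrow> rep_sat True (m + 2) \<phi> True A \<and> rep_sat False (m + 2) \<phi> False A"
    and "PiStar m \<phi> \<Longrightarrow> in_lang L \<phi> \<longrightarrow> rep_sat False (m + 2) \<phi> True A \<and> rep_sat True (m + 2) \<phi> False A"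
proof (induction rule: SigmaStar_PiStar.inducts)
  case (Sigma_0 \<phi>)
  have "rep_sat s 2 \<phi> b A" if "in_lang L \<phi>" for s b
    unfolding rep_sat_def lv_def using rep_qfree Sigma_0 that
    by (auto simp: subset_iff intro!: rep_qfree)
  then show ?case by (simp add: numeral_2_eq_2)
next
  case (Pi_0 \<phi>)
  have "rep_sat s 2 \<phi> b A" if "in_lang L \<phi>" for s b
    unfolding rep_sat_def lv_def using rep_qfree Pi_0 that
    by (auto simp: subset_iff intro!: rep_qfree)
  then show ?case by (simp add: numeral_2_eq_2)
next
  case (Sigma_Pi n \<phi>)
  then show ?case by (auto simp: rep_sat_def intro: rep_up)
next
  case (Pi_Sigma n \<phi>)
  then show ?case by (auto simp: rep_sat_def intro: rep_up)
next
  case (Sigma_Ex n \<phi>)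
  have "rep_sat True (Suc n + 2) (Exists \<phi>) True A" "rep_sat False (Suc n + 2) (Exists \<phi>) False A"
    if "in_lang L \<phi>"
  proof -
    have "rep True (Suc n + 2) d (\<lambda>(S :: ('a, 'f, 'p) struct) e. sat S (lv d e) (Exists \<phi>) = True)"
      and "rep False (Suc n + 2) d (\<lambda>(S :: ('a, 'f, 'p) struct) e. sat S (lv d e) (Exists \<phi>) = False)"
      if "fv (Exists \<phi>) \<subseteq> {..<d}" for d
      using rep_ex[of "Suc n + 1" d "\<lambda>(S :: ('a, 'f, 'p) struct) e. sat S (lv (Suc d) e) \<phi> = True"]
        rep_all[of "Suc n + 1" d "\<lambda>(S :: ('a, 'f, 'p) struct) e. sat S (lv (Suc d) e) \<phi> = False"]
        Sigma_Ex \<open>in_lang L \<phi>\<close> that fv_quant[of \<phi> d]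
      by (auto simp: rep_sat_def sat_lv_Suc)
    then show "rep_sat True (Suc n + 2) (Exists \<phi>) True A" "rep_sat False (Suc n + 2) (Exists \<phi>) False A"
      unfolding rep_sat_def by blast+
  qed
  then show ?case by simp
next
  case (Pi_All n \<phi>)
  have "rep_sat False (Suc n + 2) (Forall \<phi>) True A" "rep_sat True (Suc n + 2) (Forall \<phi>) False A"
    if "in_lang L \<phi>"
  proof -
    have "rep False (Suc n + 2) d (\<lambda>(S :: ('a, 'f, 'p) struct) e. sat S (lv d e) (Forall \<phi>) = True)"
      and "rep True (Suc n + 2) d (\<lambda>(S :: ('a, 'f, 'p) struct) e. sat S (lv d e) (Forall \<phi>) = False)"
      if "fv (Exists \<phi>) \<subseteq> {..<d}" for d
      using rep_ex[of "Suc n + 1" d "\<lambda>(S :: ('a, 'f, 'p) struct) e. sat S (lv (Suc d) e) \<phi> = False"]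
        rep_all[of "Suc n + 1" d "\<lambda>(S :: ('a, 'f, 'p) struct) e. sat S (lv (Suc d) e) \<phi> = True"]
        Pi_All \<open>in_lang L \<phi>\<close> that fv_quant[of \<phi> d]
      by (auto simp: rep_sat_def sat_lv_Suc)
    then show "rep_sat False (Suc n + 2) (Forall \<phi>) True A" "rep_sat True (Suc n + 2) (Forall \<phi>) False A"
      unfolding rep_sat_def by simp_all
  qed
  then show ?case by simp
next
  case (Sigma_Conj n \<phi> \<psi>)
  then show ?case
    using rep_sat_conj[of True "Suc n + 1" \<phi> True A \<psi> True "Conj \<phi> \<psi>" True]
      rep_sat_disj[of False "Suc n + 1" \<phi> False A \<psi> False "Conj \<phi> \<psi>" False]
    by auto
next
  case (Pi_Conj n \<phi> \<psi>)
  then show ?case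
    using rep_sat_conj[of False "Suc n + 1" \<phi> True A \<psi> True "Conj \<phi> \<psi>" True]
      rep_sat_disj[of True "Suc n + 1" \<phi> False A \<psi> False "Conj \<phi> \<psi>" False]
    by auto
next
  case (Sigma_Disj n \<phi> \<psi>)
  then show ?case
    using rep_sat_disj[of True "Suc n + 1" \<phi> True A \<psi> True "Disj \<phi> \<psi>" True]
      rep_sat_conj[of False "Suc n + 1" \<phi> False A \<psi> False "Disj \<phi> \<psi>" False]
    by auto
next
  case (Pi_Disj n \<phi> \<psi>)
  then show ?case
    using rep_sat_disj[of False "Suc n + 1" \<phi> True A \<psi> True "Disj \<phi> \<psi>" True]
      rep_sat_conj[of True "Suc n + 1" \<phi> False A \<psi> False "Disj \<phi> \<psi>" False]
    by auto
next
  case (Sigma_Imp n \<phi> \<psi>)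
  then show ?case
    using rep_sat_disj[of True "Suc n + 1" \<phi> False A \<psi> True "Imp \<phi> \<psi>" True]
      rep_sat_conj[of False "Suc n + 1" \<phi> True A \<psi> False "Imp \<phi> \<psi>" False]
    by auto
next
  case (Pi_Imp n \<phi> \<psi>)
  then show ?case
    using rep_sat_disj[of False "Suc n + 1" \<phi> False A \<psi> True "Imp \<phi> \<psi>" True]
      rep_sat_conj[of True "Suc n + 1" \<phi> True A \<psi> False "Imp \<phi> \<psi>" False]
    by auto
qed (auto simp: rep_sat_def)

corollary rep_SigmaStar_sentence:
  assumes "SigmaStar m \<phi>" "in_lang L \<phi>" "fv \<phi> = {}"
  shows "\<exists>c. cwf True (m + 2) 0 c \<and>
    (\<forall>(S :: ('a, 'f, 'p) struct) e e'. cong_struct S \<longrightarrow> sem (RS S) c e = sat S e' \<phi>)"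
proof -
  have "rep True (m + 2) 0 (\<lambda>(S :: ('a, 'f, 'p) struct) e. sat S (lv 0 e) \<phi> = True)"
    using rep_Star(1)[OF assms(1), of "TYPE(('a, 'f, 'p) struct)"] assms(2,3) by (simp add: rep_sat_def)
  then obtain c where c: "cwf True (m + 2) 0 c"
    "\<And>(S :: ('a, 'f, 'p) struct) e. cong_struct S \<Longrightarrow> sem (RS S) c e = (sat S (lv 0 e) \<phi> = True)"
    unfolding rep_def by blast
  have "sat S (lv 0 e) \<phi> = sat S e' \<phi>" for S :: "('a, 'f, 'p) struct" and e e'
    by (rule sat_fv) (simp add: assms)
  with c show ?thesis by blast
qed

text \<open>The formulae to be refuted, among them the diagonal one, have no prescribed level; only
  membership in the relational language matters for them.\<close>

definition repr :: "(('a, 'f, 'p) struct \<Rightarrow> (nat \<Rightarrow> 'a) \<Rightarrow> bool) \<Rightarrow> bool" where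
  "repr P \<longleftrightarrow> (\<exists>c. ok c \<and> (\<forall>S e. cong_struct S \<longrightarrow> sem (RS S) c e = P S e))"

lemma rep_repr: "rep s m d P \<Longrightarrow> repr P"
  unfolding rep_def repr_def using cwf_ok by blast

lemma repr_conj:
  assumes "repr P" "repr P'"
  shows "repr (\<lambda>S e. P S e \<and> P' S e)"
proof -
  obtain a b where "ok a" "\<And>S e. cong_struct S \<longrightarrow> sem (RS S) a e = P S e"
    "ok b" "\<And>S e. cong_struct S \<longrightarrow> sem (RS S) b e = P' S e"
    using assms unfolding repr_def by blast
  then show ?thesis unfolding repr_def by (intro exI[of _ "Bin True a b"]) simp
qed

lemma repr_disj:
  assumes "repr P" "repr P'"
  shows "repr (\<lambda>S e. P S e \<or> P' S e)"
proof -
  obtain a b where "ok a" "\<And>S e. cong_struct S \<longrightarrow> sem (RS S) a e = P S e"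
    "ok b" "\<And>S e. cong_struct S \<longrightarrow> sem (RS S) b e = P' S e"
    using assms unfolding repr_def by blast
  then show ?thesis unfolding repr_def by (intro exI[of _ "Bin False a b"]) simp
qed

lemma repr_ex:
  assumes "repr P"
  shows "repr (\<lambda>S e. \<exists>x. P S (e(d := x)))"
proof -
  obtain a where "ok a" "\<And>S e. cong_struct S \<longrightarrow> sem (RS S) a e = P S e"
    using assms unfolding repr_def by blast
  then show ?thesis unfolding repr_def by (intro exI[of _ "Qu True d a"]) simp
qed

lemma repr_all:
  assumes "repr P"
  shows "repr (\<lambda>S e. \<forall>x. P S (e(d := x)))"
proof -
  obtain a where "ok a" "\<And>S e. cong_struct S \<longrightarrow> sem (RS S) a e = P S e"
    using assms unfolding repr_def by blast
  then show ?thesis unfolding repr_def by (intro exI[of _ "Qu False d a"]) simp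
qed

lemma repr_sat:
  "in_lang L \<phi> \<Longrightarrow> fv \<phi> \<subseteq> {..<d} \<Longrightarrow>
    repr (\<lambda>(S :: ('a, 'f, 'p) struct) e. sat S (lv d e) \<phi>) \<and> repr (\<lambda>(S :: ('a, 'f, 'p) struct) e. \<not> sat S (lv d e) \<phi>)"
proof (induction \<phi> arbitrary: d)
  case (Rel p ts)
  have *: "\<forall>i\<in>fv (Rel p ts). d - Suc i < d" using Rel.prems(2) by fastforce
  show ?case
    using rep_repr[OF rep_Rel[OF Rel.prems(1) *, of True]] rep_repr[OF rep_Rel[OF Rel.prems(1) *, of False]]
    by (simp add: lv_def)
next
  case (Eq s t)
  have *: "\<forall>i\<in>fv (Eq s t). d - Suc i < d" using Eq.prems(2) by fastforce
  show ?case
    using rep_repr[OF rep_Eq[OF Eq.prems(1) *, of True]] rep_repr[OF rep_Eq[OF Eq.prems(1) *, of False]]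
    by (simp add: lv_def)
next
  case (Forall \<phi>)
  have fv: "fv \<phi> \<subseteq> {..<Suc d}" using Forall.prems fv_quant[of \<phi> d] by simp
  then show ?case using Forall.IH[of "Suc d"] Forall.prems
      repr_all[of "\<lambda>(S :: ('a, 'f, 'p) struct) e. sat S (lv (Suc d) e) \<phi>" d] repr_ex[of "\<lambda>(S :: ('a, 'f, 'p) struct) e. \<not> sat S (lv (Suc d) e) \<phi>" d]
    by (simp add: sat_lv_Suc)
next
  case (Exists \<phi>)
  have fv: "fv \<phi> \<subseteq> {..<Suc d}" using Exists.prems fv_quant[of \<phi> d] by simp
  then show ?case using Exists.IH[of "Suc d"] Exists.prems
      repr_ex[of "\<lambda>(S :: ('a, 'f, 'p) struct) e. sat S (lv (Suc d) e) \<phi>" d] repr_all[of "\<lambda>(S :: ('a, 'f, 'p) struct) e. \<not> sat S (lv (Suc d) e) \<phi>" d]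
    by (simp add: sat_lv_Suc)
next
  case (Conj \<phi> \<psi>)
  have "in_lang L \<phi>" "in_lang L \<psi>" "fv \<phi> \<subseteq> {..<d}" "fv \<psi> \<subseteq> {..<d}" using Conj.prems by auto
  then show ?case
    using Conj.IH(1)[of d] Conj.IH(2)[of d] unfolding connective_simps by (intro conjI repr_conj repr_disj) auto
next
  case (Disj \<phi> \<psi>)
  have "in_lang L \<phi>" "in_lang L \<psi>" "fv \<phi> \<subseteq> {..<d}" "fv \<psi> \<subseteq> {..<d}" using Disj.prems by auto
  then show ?case
    using Disj.IH(1)[of d] Disj.IH(2)[of d] unfolding connective_simps by (intro conjI repr_conj repr_disj) auto
next
  case (Imp \<phi> \<psi>)
  have "in_lang L \<phi>" "in_lang L \<psi>" "fv \<phi> \<subseteq> {..<d}" "fv \<psi> \<subseteq> {..<d}" using Imp.prems by auto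
  then show ?case
    using Imp.IH(1)[of d] Imp.IH(2)[of d] unfolding connective_simps by (intro conjI repr_conj repr_disj) auto
next
  case (Neg \<phi>)
  show ?case using Neg.IH[of d] Neg.prems by simp
qed

definition idx :: "('f, 'p) at \<Rightarrow> nat" where
  "idx a = (SOME q. q < na \<and> ats ! q = a)"

lemma idx: "a \<in> set ats \<Longrightarrow> idx a < na \<and> ats ! idx a = a"
  unfolding idx_def by (rule someI_ex) (rule atom_index)

lemma idx_nth: "q < na \<Longrightarrow> idx (ats ! q) = q"
  using idx[of "ats ! q"] distinct_ats by (metis nth_eq_iff_index_eq nth_mem)

lemma EqA_ats: "EqA \<in> set ats"
  unfolding set_ats by simp

section \<open>Equality and function axioms for relational interpretations\<close>

definition alls :: "nat \<Rightarrow> cf \<Rightarrow> cf" where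
  "alls k c = foldr (Qu False) [0..<k] c"

lemma sem_alls: "sem R (alls k c) e \<longleftrightarrow> (\<forall>as. length as = k \<longrightarrow> sem R c (\<lambda>i. if i < k then as ! i else e i))"
proof (induction k arbitrary: c)
  case 0
  then show ?case by (simp add: alls_def)
next
  case (Suc k)
  have "(\<lambda>i. if i < k then as ! i else e i)(k := x) = (\<lambda>i. if i < Suc k then (as @ [x]) ! i else e i)"
    if "length as = k" for as x
    using that by (auto simp: fun_eq_iff nth_append less_Suc_eq)
  moreover have "alls (Suc k) c = alls k (Qu False k c)" by (simp add: alls_def)
  ultimately have "sem R (alls (Suc k) c) e \<longleftrightarrow>
    (\<forall>as. length as = k \<longrightarrow> (\<forall>x. sem R c (\<lambda>i. if i < Suc k then (as @ [x]) ! i else e i)))"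
    by (simp add: Suc)
  also have "\<dots> \<longleftrightarrow> (\<forall>as. length as = Suc k \<longrightarrow> sem R c (\<lambda>i. if i < Suc k then as ! i else e i))"
    using ex_snoc[of k "\<lambda>as. \<not> sem R c (\<lambda>i. if i < Suc k then as ! i else e i)"] by blast
  finally show ?case .
qed

lemma ok_alls [simp]: "ok (alls k c) = ok c"
  unfolding alls_def by (induction k arbitrary: c) auto

lemma sem_foldr_disj:
  "sem R (foldr (Bin False) cs c) e \<longleftrightarrow> (\<exists>c\<in>set cs. sem R c e) \<or> sem R c e"
  by (induction cs) auto

lemma sem_foldr_conj:
  "sem R (foldr (Bin True) cs c) e \<longleftrightarrow> (\<forall>c\<in>set cs. sem R c e) \<and> sem R c e"
  by (induction cs) auto

lemma ok_foldr [simp]: "ok (foldr (Bin b) cs c) \<longleftrightarrow> (\<forall>c\<in>set cs. ok c) \<and> ok c"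
  by (induction cs) auto

definition qe :: nat where "qe = idx EqA"

lemma qe: "qe < na" "ats ! qe = EqA"
  using idx[OF EqA_ats] by (simp_all add: qe_def)

definition refl_cf :: cf where "refl_cf = alls 1 (Lit qe True [0, 0])"

text \<open>This is also imposed on the equality atom itself, so that symmetry and transitivity
  follow from reflexivity.\<close>

definition cong_cf :: "nat \<Rightarrow> cf" where
  "cong_cf q = (let k = arq q in alls (2 * k) (foldr (Bin False) (map (\<lambda>j. Lit qe False [j, k + j]) [0..<k])
     (Bin False (Lit q False [0..<k]) (Lit q True [k..<2 * k]))))"

definition total_cf :: "nat \<Rightarrow> cf" where
  "total_cf q = (let k = arq q - 1 in alls k (Qu True k (Lit q True (k # [0..<k]))))"

definition unique_cf :: "nat \<Rightarrow> cf" where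
  "unique_cf q = (let k = arq q - 1 in alls (k + 2) (Bin False (Lit q False (k # [0..<k]))
     (Bin False (Lit q False (Suc k # [0..<k])) (Lit qe True [k, Suc k]))))"

text \<open>The refutation calculus is purely relational and knows neither equality nor functions.
  This one sentence is conjoined to each formula to be refuted, and forces a relational
  interpretation to come from a genuine structure.\<close>

definition eq_ax :: cf where
  "eq_ax = foldr (Bin True) (map cong_cf [0..<na] @
     concat (map (\<lambda>q. if \<exists>f k. ats ! q = FunA f k then [total_cf q, unique_cf q] else []) [0..<na])) refl_cf"

lemma sem_refl_cf: "sem R refl_cf e \<longleftrightarrow> (\<forall>a. R qe [a, a])"
proof -
  have "(\<forall>as. length as = Suc 0 \<longrightarrow> P (as ! 0)) \<longleftrightarrow> (\<forall>a. P a)" for P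
    by (auto simp: length_Suc_conv)
  then show ?thesis by (simp add: refl_cf_def sem_alls)
qed

lemma sem_cong_cf:
  "sem R (cong_cf q) e \<longleftrightarrow> (\<forall>as bs. length as = arq q \<longrightarrow> length bs = arq q \<longrightarrow>
     (\<forall>j<arq q. R qe [as ! j, bs ! j]) \<longrightarrow> R q as \<longrightarrow> R q bs)"
proof -
  let ?k = "arq q"
  have split: "(\<forall>cs. length cs = 2 * ?k \<longrightarrow> P cs) \<longleftrightarrow> (\<forall>as bs. length as = ?k \<longrightarrow> length bs = ?k \<longrightarrow> P (as @ bs))"
    for P :: "'z list \<Rightarrow> bool"
  proof (intro iffI allI impI)
    fix cs :: "'z list" assume *: "\<forall>as bs. length as = ?k \<longrightarrow> length bs = ?k \<longrightarrow> P (as @ bs)" "length cs = 2 * ?k"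
    then have "P (take ?k cs @ drop ?k cs)" by (intro *(1)[rule_format]) auto
    then show "P cs" by simp
  qed auto
  have *: "map (\<lambda>i. if i < 2 * ?k then (as @ bs) ! i else e i) [0..<?k] = as"
    "map (\<lambda>i. if i < 2 * ?k then (as @ bs) ! i else e i) [?k..<2 * ?k] = bs"
    if "length as = ?k" "length bs = ?k" for as bs :: "'a list"
    using that by (auto intro!: nth_equalityI simp: nth_append)
  show ?thesis
    unfolding cong_cf_def Let_def sem_alls split
    by (intro all_cong1 imp_cong refl)
      (auto simp: sem_foldr_disj * nth_append)
qed


lemma sem_total_cf:
  assumes "arq q = Suc k"
  shows "sem R (total_cf q) e \<longleftrightarrow> (\<forall>as. length as = k \<longrightarrow> (\<exists>b. R q (b # as)))"
proof -
  have "map ((\<lambda>i. if i < k then as ! i else e i)(k := b)) [0..<k] = as" if "length as = k" for as :: "'a list" and b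
    using that by (auto intro!: nth_equalityI)
  then show ?thesis unfolding total_cf_def Let_def assms diff_Suc_1 sem_alls by simp
qed

lemma sem_unique_cf:
  assumes "arq q = Suc k"
  shows "sem R (unique_cf q) e \<longleftrightarrow>
    (\<forall>as a b. length as = k \<longrightarrow> R q (a # as) \<longrightarrow> R q (b # as) \<longrightarrow> R qe [a, b])"
proof -
  have split: "(\<forall>cs. length cs = k + 2 \<longrightarrow> P cs) \<longleftrightarrow> (\<forall>as a b. length as = k \<longrightarrow> P (as @ [a, b]))"
    for P :: "'z list \<Rightarrow> bool"
  proof (intro iffI allI impI)
    fix cs :: "'z list" assume *: "\<forall>as a b. length as = k \<longrightarrow> P (as @ [a, b])" "length cs = k + 2"
    then obtain bs b where "cs = bs @ [b]" "length bs = k + 1"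
      by (metis add_2_eq_Suc' Suc_eq_plus1 length_Suc_conv_rev)
    moreover then obtain as a where "bs = as @ [a]" "length as = k"
      by (metis Suc_eq_plus1 length_Suc_conv_rev)
    ultimately show "P cs" using * by simp
  qed auto
  have "map (\<lambda>i. if i < k + 2 then (as @ [a, b]) ! i else e i) [0..<k] = as" if "length as = k"
    for as :: "'a list" and a b
    using that by (auto intro!: nth_equalityI simp: nth_append)
  then show ?thesis
    unfolding unique_cf_def Let_def assms diff_Suc_1 sem_alls split
    by (simp add: nth_append) blast
qed

lemma FunA_ar: "ats ! q = FunA f k \<Longrightarrow> arq q = Suc k"
  by simp

lemma ok_eq_ax: "ok eq_ax"
proof -
  have "ok refl_cf" using qe by (simp add: refl_cf_def)
  moreover have "ok (cong_cf q)" if "q < na" for q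
    using qe that by (auto simp: cong_cf_def Let_def)
  moreover have "ok (total_cf q)" "ok (unique_cf q)" if "q < na" "ats ! q = FunA f k" for q f k
    using qe that by (auto simp: total_cf_def unique_cf_def Let_def)
  ultimately show ?thesis by (auto simp: eq_ax_def)
qed

lemma sem_eq_ax:
  "sem R eq_ax e \<longleftrightarrow> (\<forall>a. R qe [a, a]) \<and>
    (\<forall>q<na. \<forall>as bs. length as = arq q \<longrightarrow> length bs = arq q \<longrightarrow>
       (\<forall>j<arq q. R qe [as ! j, bs ! j]) \<longrightarrow> R q as \<longrightarrow> R q bs) \<and>
    (\<forall>q<na. \<forall>f k. ats ! q = FunA f k \<longrightarrow> (\<forall>as. length as = k \<longrightarrow> (\<exists>b. R q (b # as))) \<and>
       (\<forall>as a b. length as = k \<longrightarrow> R q (a # as) \<longrightarrow> R q (b # as) \<longrightarrow> R qe [a, b]))"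
proof -
  have "sem R eq_ax e \<longleftrightarrow> sem R refl_cf e \<and> (\<forall>q<na. sem R (cong_cf q) e) \<and>
    (\<forall>q<na. \<forall>f k. ats ! q = FunA f k \<longrightarrow> sem R (total_cf q) e \<and> sem R (unique_cf q) e)"
    unfolding eq_ax_def sem_foldr_conj by (auto simp: ball_Un)
  then show ?thesis
    unfolding sem_refl_cf sem_cong_cf by (simp only: sem_total_cf[OF FunA_ar] sem_unique_cf[OF FunA_ar] cong: conj_cong imp_cong)
qed

lemma RS_eq_ax:
  assumes S: "cong_struct S"
  shows "sem (RS S) eq_ax e"
  unfolding sem_eq_ax
proof (intro conjI allI impI)
  show "RS S qe [a, a]" for a by (simp add: RS_def qe eqr_refl[OF S])
next
  fix q as bs assume "length as = arq q" "length bs = arq q" "\<forall>j<arq q. RS S qe [as ! j, bs ! j]" "RS S q as"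
  moreover from this have "list_all2 (eqr S) as bs" by (simp add: RS_def qe list_all2_conv_all_nth)
  ultimately show "RS S q bs" using at_sem_cong[OF S] by (simp add: RS_def)
next
  fix q f k and as :: "'a list" assume *: "ats ! q = FunA f k"
  have "RS S q (fint S f as # as)" by (simp add: RS_def * eqr_refl[OF S])
  then show "\<exists>b. RS S q (b # as)" ..
next
  fix q f k and as :: "'a list" and a b assume "ats ! q = FunA f k" "RS S q (a # as)" "RS S q (b # as)"
  then have "eqr S (fint S f as) a" "eqr S (fint S f as) b" by (simp_all add: RS_def)
  from eqr_trans[OF S eqr_sym[OF S this(1)] this(2)] show "RS S qe [a, b]" by (simp add: RS_def qe)
qed

text \<open>The way back from relations to a structure: function values are chosen from the graphs.
  Symbols used with an arity outside the language get fixed defaults, which makes congruence trivial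
  for them.\<close>

definition struct_of :: "(nat \<Rightarrow> 'a list \<Rightarrow> bool) \<Rightarrow> ('a, 'f, 'p) struct" where
  "struct_of R = \<lparr>eqr = \<lambda>a b. R qe [a, b],
     fint = \<lambda>f as. if FunA f (length as) \<in> set ats then SOME b. R (idx (FunA f (length as))) (b # as) else undefined,
     rint = \<lambda>p as. RelA p (length as) \<in> set ats \<and> R (idx (RelA p (length as))) as\<rparr>"

context
  fixes R :: "nat \<Rightarrow> 'a list \<Rightarrow> bool" and e :: "nat \<Rightarrow> 'a"
  assumes R: "sem R eq_ax e"
begin

lemma R_refl: "R qe [a, a]"
  using R unfolding sem_eq_ax by blast

lemma R_cong:
  "q < na \<Longrightarrow> length as = arq q \<Longrightarrow> length bs = arq q \<Longrightarrow> (\<And>j. j < arq q \<Longrightarrow> R qe [as ! j, bs ! j]) \<Longrightarrow> R q as \<Longrightarrow> R q bs"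
  using R unfolding sem_eq_ax by blast

lemma R_fun:
  assumes "FunA f (length as) \<in> set ats"
  shows "R (idx (FunA f (length as))) (fint (struct_of R) f as # as)"
    and "R (idx (FunA f (length as))) (a # as) \<Longrightarrow> R (idx (FunA f (length as))) (b # as) \<Longrightarrow> R qe [a, b]"
proof -
  let ?q = "idx (FunA f (length as))"
  have q: "?q < na" "ats ! ?q = FunA f (length as)" using idx[OF assms] by auto
  then have "\<exists>b. R ?q (b # as)" using R unfolding sem_eq_ax by blast
  from someI_ex[OF this] show "R ?q (fint (struct_of R) f as # as)" using assms by (simp add: struct_of_def)
  show "R ?q (a # as) \<Longrightarrow> R ?q (b # as) \<Longrightarrow> R qe [a, b]" using q R unfolding sem_eq_ax by blast
qed

text \<open>Congruence of the equality atom, from which symmetry and transitivity are read off by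
  reflexive choices of the arguments.\<close>

lemma R_cong2: "R qe [a, a'] \<Longrightarrow> R qe [b, b'] \<Longrightarrow> R qe [a, b] \<Longrightarrow> R qe [a', b']"
proof (rule R_cong[of qe "[a, b]"])
  fix j assume "R qe [a, a']" "R qe [b, b']" "j < arq qe"
  then show "R qe [[a, b] ! j, [a', b'] ! j]" by (cases j) (auto simp: qe)
qed (auto simp: qe)

lemma R_sym: "R qe [a, b] \<Longrightarrow> R qe [b, a]"
  using R_cong2[of a b a a] R_refl by blast

lemma R_trans: "R qe [a, b] \<Longrightarrow> R qe [b, c] \<Longrightarrow> R qe [a, c]"
  using R_cong2[of b a c c] R_refl R_sym by blast

lemma cong_struct_of: "cong_struct (struct_of R)"
  unfolding cong_struct_def
proof (intro conjI allI impI)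
  show "equivp (eqr (struct_of R))"
    by (rule equivpI) (auto simp: struct_of_def reflp_def symp_def transp_def R_refl intro: R_sym R_trans)
next
  fix f as bs assume *: "list_all2 (eqr (struct_of R)) as bs"
  then have l: "length bs = length as" by (simp add: list_all2_lengthD)
  show "eqr (struct_of R) (fint (struct_of R) f as) (fint (struct_of R) f bs)"
  proof (cases "FunA f (length as) \<in> set ats")
    case True
    let ?q = "idx (FunA f (length as))" and ?v = "fint (struct_of R) f as"
    have "R ?q (?v # bs)"
    proof (rule R_cong)
      show "R ?q (?v # as)" by (rule R_fun(1)[OF True])
      show "R qe [(?v # as) ! j, (?v # bs) ! j]" if "j < arq ?q" for j
        using that idx[OF True] * by (cases j) (auto simp: R_refl struct_of_def list_all2_conv_all_nth)
    qed (use idx[OF True] l in auto)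
    moreover have "R ?q (fint (struct_of R) f bs # bs)"
      using R_fun(1)[of f bs] True l by simp
    ultimately have "R qe [?v, fint (struct_of R) f bs]"
      using R_fun(2)[of f bs] True l by simp
    then show ?thesis by (simp add: struct_of_def)
  next
    case False
    then show ?thesis using l by (simp add: struct_of_def R_refl)
  qed
next
  fix p as bs assume *: "list_all2 (eqr (struct_of R)) as bs"
  then have l: "length bs = length as" by (simp add: list_all2_lengthD)
  have "R (idx (RelA p (length as))) as \<longleftrightarrow> R (idx (RelA p (length as))) bs" if "RelA p (length as) \<in> set ats"
    using R_cong[of "idx (RelA p (length as))" as bs] R_cong[of "idx (RelA p (length as))" bs as] idx[OF that] * l
    by (auto simp: struct_of_def list_all2_conv_all_nth R_sym)
  then show "rint (struct_of R) p as = rint (struct_of R) p bs"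
    using l by (auto simp: struct_of_def)
qed

lemma RS_struct_of:
  assumes "q < na" "length as = arq q"
  shows "RS (struct_of R) q as = R q as"
proof (cases "ats ! q")
  case EqA
  then have "as = [as ! 0, as ! 1]" "q = qe"
    using assms idx_nth[of q] by (auto simp: qe_def numeral_2_eq_2 length_Suc_conv)
  then show ?thesis using qe by (simp add: RS_def struct_of_def)
next
  case (RelA p k)
  then have "RelA p (length as) \<in> set ats" "idx (RelA p (length as)) = q"
    using assms idx_nth[of q] nth_mem[of q ats] by auto
  then show ?thesis using RelA assms by (simp add: RS_def struct_of_def)
next
  case (FunA f k)
  then obtain a bs where as: "as = a # bs" "length bs = k" using assms by (auto simp: length_Suc_conv)
  then have F: "FunA f (length bs) \<in> set ats" "idx (FunA f (length bs)) = q"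
    using assms idx_nth[of q] nth_mem[of q ats] FunA by auto
  have "R qe [fint (struct_of R) f bs, a] \<longleftrightarrow> R q as"
  proof
    assume *: "R qe [fint (struct_of R) f bs, a]"
    show "R q as"
    proof (rule R_cong[OF assms(1) _ assms(2)])
      show "R q (fint (struct_of R) f bs # bs)" using R_fun(1)[OF F(1)] F(2) by simp
      show "R qe [(fint (struct_of R) f bs # bs) ! j, as ! j]" if "j < arq q" for j
        using that * as by (cases j) (auto simp: R_refl)
    qed (use as FunA in auto)
  next
    assume "R q as"
    then show "R qe [fint (struct_of R) f bs, a]" using R_fun[OF F(1)] F(2) as by auto
  qed
  then show ?thesis using FunA as by (simp add: RS_def struct_of_def)
qed

end

end

section \<open>Partial truth predicates\<close>

text \<open>As \<open>pr 0 0\<close> is 0, the successor is what separates nonempty lists from the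
  empty one.\<close>

primrec lc :: "nat list \<Rightarrow> nat" where
  "lc [] = 0" | "lc (i # is) = Suc (pr i (lc is))"

primrec code :: "cf \<Rightarrow> nat" where
  "code (Lit q b is) = pr 0 (pr q (pr (of_bool b) (lc is)))"
| "code (Bin t a b) = pr (if t then 1 else 2) (pr (code a) (code b))"
| "code (Qu t i a) = pr (if t then 3 else 4) (pr i (code a))"
| "code (Up t a) = pr (if t then 5 else 6) (code a)"

text \<open>A definable relation cannot distinguish elements related by \<open>eqr\<close>. This
  replaces a separate congruence proof for every predicate built inside the model.\<close>

lemma df_cong: "defn L S R \<Longrightarrow> cong_struct S \<Longrightarrow> (\<And>i. eqr S (e i) (e' i)) \<Longrightarrow> R e = R e'"
  unfolding defn_def using sat_cong[of S e e'] by auto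

section \<open>Reading codes, assignments and certificates in the model\<close>

context sequential_model
begin

definition tagM :: "nat \<Rightarrow> 'a \<Rightarrow> 'a \<Rightarrow> bool" where
  "tagM k x c \<longleftrightarrow> (\<exists>t. nm t k \<and> pairM t x c)"

definition tag2M :: "nat \<Rightarrow> 'a \<Rightarrow> 'a \<Rightarrow> 'a \<Rightarrow> bool" where
  "tag2M k x y c \<longleftrightarrow> (\<exists>p. pairM x y p \<and> tagM k p c)"

definition consM :: "'a \<Rightarrow> 'a \<Rightarrow> 'a \<Rightarrow> bool" where
  "consM x l c \<longleftrightarrow> (\<exists>p. pairM x l p \<and> succM p c)"

lemma df_tagM [defn_intros]: "df (\<lambda>e. tagM k (e i) (e j))"
  unfolding tagM_def by (intro defn_intros)

lemma df_tag2M [defn_intros]: "df (\<lambda>e. tag2M k (e i) (e j) (e l))"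
  unfolding tag2M_def by (intro defn_intros)

lemma df_consM [defn_intros]: "df (\<lambda>e. consM (e i) (e j) (e l))"
  unfolding consM_def by (intro defn_intros)

lemma tagM_nm:
  assumes "nm c z"
  shows "tagM k x c \<longleftrightarrow> (\<exists>n. nm x n \<and> z = pr k n)"
proof -
  have "tagM k x c \<longleftrightarrow> (\<exists>t m n. nm t k \<and> nm t m \<and> nm x n \<and> z = pr m n)"
    unfolding tagM_def pairM_nm2[OF assms] by blast
  also have "\<dots> \<longleftrightarrow> (\<exists>n. nm x n \<and> z = pr k n)"
    using nm_std[of k] nm_unique[of _ k] by blast
  finally show ?thesis .
qed

lemma ex_pairM_nm: "(\<exists>p. pairM x y p \<and> nm p z) \<longleftrightarrow> (\<exists>m n. nm x m \<and> nm y n \<and> z = pr m n)"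
proof
  assume "\<exists>p. pairM x y p \<and> nm p z"
  then show "\<exists>m n. nm x m \<and> nm y n \<and> z = pr m n" using pairM_nm2 by blast
next
  assume "\<exists>m n. nm x m \<and> nm y n \<and> z = pr m n"
  then show "\<exists>p. pairM x y p \<and> nm p z" using pairM_nm1 nm_std by blast
qed

lemma tag2M_nm:
  assumes "nm c z"
  shows "tag2M k x y c \<longleftrightarrow> (\<exists>m n. nm x m \<and> nm y n \<and> z = pr k (pr m n))"
proof -
  have "tag2M k x y c \<longleftrightarrow> (\<exists>n. (\<exists>p. pairM x y p \<and> nm p n) \<and> z = pr k n)"
    unfolding tag2M_def tagM_nm[OF assms] by blast
  then show ?thesis unfolding ex_pairM_nm by blast
qed

lemma consM_nm:
  assumes "nm c z"
  shows "consM x l c \<longleftrightarrow> (\<exists>m n. nm x m \<and> nm l n \<and> z = Suc (pr m n))"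
proof -
  have "consM x l c \<longleftrightarrow> (\<exists>n. (\<exists>p. pairM x l p \<and> nm p n) \<and> z = Suc n)"
    unfolding consM_def succM_nm2[OF assms] by blast
  then show ?thesis unfolding ex_pairM_nm by blast
qed

text \<open>The number k of arguments is external, so reading them is a fixed nesting of existential
  quantifiers. The values, which are arbitrary elements of the model and have no codes, are handed
  to the continuation P.\<close>

primrec lookM :: "nat \<Rightarrow> 'a \<Rightarrow> 'a \<Rightarrow> ('a list \<Rightarrow> bool) \<Rightarrow> bool" where
  "lookM 0 l w P \<longleftrightarrow> nm l 0 \<and> P []"
| "lookM (Suc k) l w P \<longleftrightarrow> (\<exists>i t y. consM i t l \<and> elem y i w \<and> lookM k t w (\<lambda>ys. P (y # ys)))"

lemma df_lookM:
  assumes "\<And>is. length is = length js + k \<Longrightarrow> df (\<lambda>e. P (map e is))"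
  shows "df (\<lambda>e. lookM k (e i) (e j) (\<lambda>ys. P (map e js @ ys)))"
  using assms
proof (induction k arbitrary: i j js)
  case 0
  have "df (\<lambda>e. P (map e js))" by (rule 0) simp
  then show ?case by (simp, intro defn_intros)
next
  case (Suc k)
  let ?js = "map (\<lambda>i. Suc (Suc (Suc i))) js @ [0]"
  have "df (\<lambda>e. lookM k (e (Suc 0)) (e (Suc (Suc (Suc j)))) (\<lambda>ys. P (map e ?js @ ys)))"
    by (rule Suc.IH) (use Suc.prems in simp)
  then have *: "df (\<lambda>e. lookM k (e (Suc 0)) (e (Suc (Suc (Suc j))))
      (\<lambda>ys. P (map (\<lambda>i. e (Suc (Suc (Suc i)))) js @ e 0 # ys)))"
    by (simp add: comp_def)
  show ?case by (simp, intro defn_intros *)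
qed

text \<open>A sequence determines its entries only up to \<open>eqr\<close>, hence the requirement
  that P respects it.\<close>

lemma lookM_nm:
  assumes "nm l (lc is)" "envrep w d e" "\<forall>i\<in>set is. i < d"
    and "\<And>ys zs. list_all2 (eqr S) ys zs \<Longrightarrow> length ys = length is \<Longrightarrow> P ys = P zs"
  shows "lookM (length is) l w P \<longleftrightarrow> P (map e is)"
  using assms
proof (induction "is" arbitrary: l P)
  case (Cons i "is")
  have tl: "lookM (length is) t w (\<lambda>ys. P (y # ys)) \<longleftrightarrow> P (y # map e is)" if "nm t (lc is)" for t y
    using Cons.prems that eqr_refl[OF cong] by (intro Cons.IH) auto
  have "consM j t l \<longleftrightarrow> nm j i \<and> nm t (lc is)" for j t
    using consM_nm[OF Cons.prems(1)] by auto
  then have "lookM (length (i # is)) l w P \<longleftrightarrow>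
    (\<exists>j t y. nm j i \<and> nm t (lc is) \<and> elem y j w \<and> P (y # map e is))"
    unfolding length_Cons lookM.simps by (intro ex_cong1) (auto simp: tl)
  also have "\<dots> \<longleftrightarrow> (\<exists>y. eqr S y (e i) \<and> P (y # map e is))"
  proof -
    have "elem y j w \<longleftrightarrow> eqr S y (e i)" if "nm j i" for j y
      using Cons.prems(2,3) that by (simp add: envrep_def)
    then show ?thesis using nm_std by metis
  qed
  also have "\<dots> \<longleftrightarrow> P (e i # map e is)"
  proof -
    have "P (y # map e is) = P (e i # map e is)" if "eqr S y (e i)" for y
      using that eqr_refl[OF cong] by (intro Cons.prems(4)) (auto simp: list_all2_same)
    then show ?thesis using eqr_refl[OF cong] by blast
  qed
  finally show ?case by simp
qed simp

text \<open>A certificate is a pair of sequences, u with the codes and v with the assignments, up to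
  position k. Two sequences are used because assignments need not be numbers and cannot be put into
  \<open>pairM\<close>.\<close>

definition itemM :: "'a \<Rightarrow> 'a \<Rightarrow> 'a \<Rightarrow> 'a \<Rightarrow> 'a \<Rightarrow> bool" where
  "itemM u v k x w \<longleftrightarrow> (\<exists>j c. ltM j k \<and> elem c j u \<and> N c \<and> c \<approx> x \<and> N x \<and> elem w j v)"

lemma df_itemM [defn_intros]: "df (\<lambda>e. itemM (e i) (e j) (e k) (e l) (e m))"
  unfolding itemM_def by (intro defn_intros)

text \<open>A and B evaluate subformulae below \<open>Up\<close>, that is, at the previous level,
  and J stands for membership in the certificate. For s = False the tags of conjunction and
  disjunction, and those of the quantifiers, change places, which covers falsity by the same
  definition. Literals have no clause: above level 0 they occur only below
  \<open>Up\<close>.\<close>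

definition stepM :: "bool \<Rightarrow> ('a \<Rightarrow> 'a \<Rightarrow> bool) \<Rightarrow> ('a \<Rightarrow> 'a \<Rightarrow> bool) \<Rightarrow> ('a \<Rightarrow> 'a \<Rightarrow> bool) \<Rightarrow> 'a \<Rightarrow> 'a \<Rightarrow> bool" where
  "stepM s A B J c w \<longleftrightarrow> (\<exists>x. tagM 5 x c \<and> A x w) \<or> (\<exists>x. tagM 6 x c \<and> B x w) \<or>
     (\<exists>x y. tag2M (if s then 1 else 2) x y c \<and> J x w \<and> J y w) \<or>
     (\<exists>x y. tag2M (if s then 2 else 1) x y c \<and> (J x w \<or> J y w)) \<or>
     (\<exists>d x a w'. tag2M (if s then 3 else 4) d x c \<and> ext w d a w' \<and> J x w')"

lemma stepM_mono: "stepM s A B J c w \<Longrightarrow> (\<And>x w. J x w \<Longrightarrow> J' x w) \<Longrightarrow> stepM s A B J' c w"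
  unfolding stepM_def by blast

definition certM :: "bool \<Rightarrow> ('a \<Rightarrow> 'a \<Rightarrow> bool) \<Rightarrow> ('a \<Rightarrow> 'a \<Rightarrow> bool) \<Rightarrow> 'a \<Rightarrow> 'a \<Rightarrow> bool" where
  "certM s A B c w \<longleftrightarrow> (\<exists>u v k. itemM u v k c w \<and>
     (\<forall>j c w. ltM j k \<longrightarrow> elem c j u \<longrightarrow> elem w j v \<longrightarrow> stepM s A B (itemM u v k) c w))"

lemma df_stepM:
  assumes "\<And>i j. df (\<lambda>e. A (e i) (e j))" "\<And>i j. df (\<lambda>e. B (e i) (e j))"
  shows "df (\<lambda>e. stepM s A B (itemM (e i) (e j) (e k)) (e l) (e m))"
  unfolding stepM_def by (intro defn_intros assms)

lemma df_certM:
  assumes "\<And>i j. df (\<lambda>e. A (e i) (e j))" "\<And>i j. df (\<lambda>e. B (e i) (e j))"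
  shows "df (\<lambda>e. certM s A B (e i) (e j))"
  unfolding certM_def by (intro defn_intros df_stepM assms)

end

locale coded_model = sequential_model L S I \<beta> + lang_atoms L ats
  for L :: "('f, 'p) lang" and S :: "('a, 'f, 'p) struct" and I \<beta> ats
begin

lemma df_at_sem:
  assumes "q < na" "length is = arq q"
  shows "df (\<lambda>e. at_sem S (ats ! q) (map e is))"
proof (cases "ats ! q")
  case EqA
  then have "map e is ! 0 = e (is ! 0)" "map e is ! 1 = e (is ! 1)" for e :: "nat \<Rightarrow> 'a" using assms by auto
  then show ?thesis using EqA by (simp, intro defn_intros)
next
  case (RelA p k)
  have "RelA p k \<in> set ats" using RelA assms nth_mem by metis
  then have "in_lang L (Rel p (map Var is))" using RelA assms by (auto simp: set_ats list_all_iff)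
  moreover have "sat S e (Rel p (map Var is)) = at_sem S (ats ! q) (map e is)" for e
    by (simp add: RelA comp_def)
  ultimately show ?thesis unfolding defn_def by blast
next
  case (FunA f k)
  have "FunA f k \<in> set ats" using FunA assms nth_mem by metis
  moreover have "is \<noteq> []" using FunA assms by auto
  ultimately have "in_lang L (Eq (Fun f (map Var (tl is))) (Var (hd is)))"
    using FunA assms by (auto simp: set_ats list_all_iff)
  moreover have "sat S e (Eq (Fun f (map Var (tl is))) (Var (hd is))) = at_sem S (ats ! q) (map e is)" for e
    using \<open>is \<noteq> []\<close> by (simp add: FunA comp_def map_tl hd_map)
  ultimately show ?thesis unfolding defn_def by blast
qed

definition litM :: "'a \<Rightarrow> 'a \<Rightarrow> bool" where
  "litM c w \<longleftrightarrow> (\<exists>q\<in>set [0..<na]. \<exists>b\<in>set [True, False]. \<exists>l x y. tagM (of_bool b) l x \<and> tagM q x y \<and> tagM 0 y c \<and>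
     lookM (arq q) l w (\<lambda>ys. at_sem S (ats ! q) ys = b))"

lemma df_litM [defn_intros]: "df (\<lambda>e. litM (e i) (e j))"
proof -
  have *: "df (\<lambda>e. lookM (arq q) (e k) (e l) (\<lambda>ys. at_sem S (ats ! q) ys = b))" if "q < na" for q b k l
  proof -
    have "df (\<lambda>e. at_sem S (ats ! q) (map e is) = b)" if "length is = length [] + arq q" for "is"
      using df_at_sem[OF \<open>q < na\<close>, of "is"] that by (intro defn_intros) simp
    from df_lookM[of "[]" "arq q" "\<lambda>ys. at_sem S (ats ! q) ys = b", OF this] show ?thesis by simp
  qed
  show ?thesis unfolding litM_def by (intro defn_bex defn_intros *) simp
qed

lemma litM_nm:
  assumes "nm c (code (Lit q b is))" "q < na" "length is = arq q" "\<forall>i\<in>set is. i < d" "envrep w d e"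
  shows "litM c w \<longleftrightarrow> sem (RS S) (Lit q b is) e"
proof -
  have look: "lookM (arq q) l w (\<lambda>ys. at_sem S (ats ! q) ys = b) \<longleftrightarrow> at_sem S (ats ! q) (map e is) = b"
    if "nm l (lc is)" for l
    using lookM_nm[OF that assms(5,4), of "\<lambda>ys. at_sem S (ats ! q) ys = b"] at_sem_cong[OF cong] assms(3)
    by simp
  have dec: "tagM (of_bool b') l x \<and> tagM q' x y \<and> tagM 0 y c \<longleftrightarrow>
    b' = b \<and> q' = q \<and> nm l (lc is) \<and> nm x (pr (of_bool b) (lc is)) \<and> nm y (pr q (pr (of_bool b) (lc is)))"
    for b' q' l x y
  proof -
    have "tagM 0 y c \<longleftrightarrow> nm y (pr q (pr (of_bool b) (lc is)))"
      using tagM_nm[OF assms(1), of 0 y] by simp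
    moreover have "tagM q' x y \<longleftrightarrow> q' = q \<and> nm x (pr (of_bool b) (lc is))" if "nm y (pr q (pr (of_bool b) (lc is)))"
      using tagM_nm[OF that, of q' x] by auto
    moreover have "tagM (of_bool b') l x \<longleftrightarrow> b' = b \<and> nm l (lc is)" if "nm x (pr (of_bool b) (lc is))"
      using tagM_nm[OF that, of "of_bool b'" l] by (auto simp: of_bool_eq_iff)
    ultimately show ?thesis by blast
  qed
  have "litM c w \<longleftrightarrow> (\<exists>l x y. nm l (lc is) \<and> nm x (pr (of_bool b) (lc is)) \<and>
      nm y (pr q (pr (of_bool b) (lc is))) \<and> at_sem S (ats ! q) (map e is) = b)"
  proof -
    have "litM c w \<longleftrightarrow> (\<exists>q'\<in>set [0..<na]. \<exists>b'\<in>set [True, False]. \<exists>l x y.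
      (tagM (of_bool b') l x \<and> tagM q' x y \<and> tagM 0 y c) \<and> lookM (arq q') l w (\<lambda>ys. at_sem S (ats ! q') ys = b'))"
      unfolding litM_def by simp
    also have "\<dots> \<longleftrightarrow> (\<exists>l x y. nm l (lc is) \<and> nm x (pr (of_bool b) (lc is)) \<and>
      nm y (pr q (pr (of_bool b) (lc is))) \<and> lookM (arq q) l w (\<lambda>ys. at_sem S (ats ! q) ys = b))"
      unfolding dec using assms(2) by auto
    finally show ?thesis using look by blast
  qed
  also have "\<dots> \<longleftrightarrow> at_sem S (ats ! q) (map e is) = b" using nm_std by blast
  finally show ?thesis by (simp add: RS_def)
qed

text \<open>Truth for a \<open>\<Sigma>\<close>-formula (\<open>s = True\<close>) and falsity of a \<open>\<Pi>\<close>-formula (\<open>s = False\<close>) are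
  witnessed by a finite set of pairs of a formula and an assignment which contains, with each pair,
  enough pairs to justify it. No well-foundedness is required of such a certificate, as truth is only
  claimed for standard formulae.\<close>

primrec Tr :: "bool \<Rightarrow> nat \<Rightarrow> 'a \<Rightarrow> 'a \<Rightarrow> bool" where
  "Tr s 0 c w \<longleftrightarrow> litM c w"
| "Tr s (Suc m) c w \<longleftrightarrow> certM s (\<lambda>x w. Tr True m x w = s) (\<lambda>x w. Tr False m x w = s) c w = s"

lemma df_Tr: "df (\<lambda>e. Tr s m (e i) (e j))"
proof (induction m arbitrary: s i j)
  case 0
  show ?case by (simp, intro defn_intros)
next
  case (Suc m)
  show ?case by (simp, intro defn_intros df_certM Suc)
qed

section \<open>Correctness of certificates, from level m to the next\<close>

context
  fixes m :: nat
  assumes IH: "\<And>s d c a w e. cwf s m d c \<Longrightarrow> nm a (code c) \<Longrightarrow> envrep w d e \<Longrightarrow> Tr s m a w \<longleftrightarrow> sem (RS S) c e"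
begin

abbreviation "At s \<equiv> \<lambda>x w. Tr True m x w = s"
abbreviation "Af s \<equiv> \<lambda>x w. Tr False m x w = s"

text \<open>The induction follows the standard formula c and inspects only the entries that it
  demands. The length k may be nonstandard, and the remaining entries may be meaningless.\<close>

lemma cert_sound:
  assumes steps: "\<And>j c w. ltM j k \<Longrightarrow> elem c j u \<Longrightarrow> elem w j v \<Longrightarrow> stepM s (At s) (Af s) (itemM u v k) c w"
  shows "cwf s' m' d c \<Longrightarrow> s' = s \<Longrightarrow> m' = Suc m \<Longrightarrow> nm a (code c) \<Longrightarrow> itemM u v k a w \<Longrightarrow> envrep w d e \<Longrightarrow>
    sem (RS S) c e = s"
proof (induction arbitrary: a w e rule: cwf.induct)
  case (2 b m' d c s')
  obtain a' where a': "nm a' (code (Up b c))" "stepM s (At s) (Af s) (itemM u v k) a' w"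
    using steps 2(5,6) nm_eqn' unfolding itemM_def by blast
  then have "\<exists>x. nm x (code c) \<and> (Tr b m x w = s)"
    unfolding stepM_def tagM_nm[OF a'(1)] tag2M_nm[OF a'(1)] by (auto split: if_splits)
  moreover have "cwf b m d c" using 2(1,4) by simp
  ultimately show ?case using IH[OF _ _ 2(7)] by auto
next
  case (3 s' m' d c c' t)
  obtain a' where a': "nm a' (code (Bin t c c'))" "stepM s (At s) (Af s) (itemM u v k) a' w"
    using steps 3(7,8) nm_eqn' unfolding itemM_def by blast
  then have "\<exists>x y. nm x (code c) \<and> nm y (code c') \<and>
      (if t = s then itemM u v k x w \<and> itemM u v k y w else itemM u v k x w \<or> itemM u v k y w)"
    unfolding stepM_def tagM_nm[OF a'(1)] tag2M_nm[OF a'(1)] by (auto split: if_splits)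
  then show ?case using 3(3)[OF 3(5,6) _ _ 3(9)] 3(4)[OF 3(5,6) _ _ 3(9)] 
    by (auto split: if_splits)
next
  case (4 s' m' d c)
  obtain a' where a': "nm a' (code (Qu s' d c))" "stepM s (At s) (Af s) (itemM u v k) a' w"
    using steps 4(5,6) nm_eqn' unfolding itemM_def by blast
  then have "\<exists>d' x b w'. nm d' d \<and> nm x (code c) \<and> ext w d' b w' \<and> itemM u v k x w'"
    unfolding stepM_def tagM_nm[OF a'(1)] tag2M_nm[OF a'(1)] using 4(3) by (auto split: if_splits)
  then obtain d' x b w' where *: "nm d' d" "nm x (code c)" "ext w d' b w'" "itemM u v k x w'" by blast
  have "sem (RS S) c (e(d := b)) = s"
    using 4(2)[OF 4(3,4) *(2,4) ext_envrep[OF *(1,3) 4(7)]] .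
  then show ?case using 4(3) by (cases s) auto
qed simp

text \<open>The counterpart of \<open>itemM\<close> for an external finite list: certificates are
  first assembled as lists and only then turned into sequences of the model.\<close>

definition IL :: "('a \<times> 'a) list \<Rightarrow> 'a \<Rightarrow> 'a \<Rightarrow> bool" where
  "IL its x w \<longleftrightarrow> N x \<and> (\<exists>c. (c, w) \<in> set its \<and> N c \<and> c \<approx> x)"

definition justified :: "bool \<Rightarrow> ('a \<times> 'a) list \<Rightarrow> bool" where
  "justified s its \<longleftrightarrow> (\<forall>(c, w) \<in> set its. stepM s (At s) (Af s) (IL its) c w)"

lemma justified_append: "justified s xs \<Longrightarrow> justified s ys \<Longrightarrow> justified s (xs @ ys)"
proof -
  have "stepM s (At s) (Af s) (IL (xs @ ys)) c w" if "stepM s (At s) (Af s) (IL zs) c w" "zs = xs \<or> zs = ys" for zs c w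
    using that(1) by (rule stepM_mono) (use that(2) in \<open>auto simp: IL_def\<close>)
  then show "justified s xs \<Longrightarrow> justified s ys \<Longrightarrow> justified s (xs @ ys)"
    unfolding justified_def by fastforce
qed

lemma justified_Cons:
  "justified s its \<Longrightarrow> stepM s (At s) (Af s) (IL its) c w \<Longrightarrow> justified s ((c, w) # its)"
proof -
  have "stepM s (At s) (Af s) (IL ((c, w) # its)) c' w'" if "stepM s (At s) (Af s) (IL its) c' w'" for c' w'
    using that by (rule stepM_mono) (auto simp: IL_def)
  then show "justified s its \<Longrightarrow> stepM s (At s) (Af s) (IL its) c w \<Longrightarrow> justified s ((c, w) # its)"
    unfolding justified_def by auto
qed

lemma IL_memb: "(x, w) \<in> set its \<Longrightarrow> nm x n \<Longrightarrow> IL its x w"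
  unfolding IL_def using nm_N eqn_refl by blast

text \<open>Certificates of subformulae are appended. Items stay justified in a longer list because
  \<open>stepM\<close> is monotone in the membership relation.\<close>

lemma cert_complete:
  "cwf s m' d c \<Longrightarrow> m' = Suc m \<Longrightarrow> nm a (code c) \<Longrightarrow> envrep w d e \<Longrightarrow> sem (RS S) c e = s \<Longrightarrow>
    \<exists>its. justified s its \<and> (a, w) \<in> set its"
proof (induction arbitrary: a w e rule: cwf.induct)
  case (2 b m' d c s)
  have "Tr b m (std (code c)) w = s" using IH[of b d c "std (code c)" w e] 2 by simp
  then have "stepM s (At s) (Af s) (IL []) a w"
    unfolding stepM_def tagM_nm[OF 2(4)] by (cases b) (auto intro!: exI[of _ "std (code c)"])
  then show ?case by (intro exI[of _ "[(a, w)]"] conjI justified_Cons) (auto simp: justified_def)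
next
  case (3 s m' d c c' t)
  have one: "\<exists>its. justified s its \<and> (std (code c), w) \<in> set its" if "sem (RS S) c e = s"
    using 3(3)[OF 3(5) nm_std 3(7) that] .
  have two: "\<exists>its. justified s its \<and> (std (code c'), w) \<in> set its" if "sem (RS S) c' e = s"
    using 3(4)[OF 3(5) nm_std 3(7) that] .
  have fin: ?case if "justified s its" and "if t = s then IL its (std (code c)) w \<and> IL its (std (code c')) w
      else IL its (std (code c)) w \<or> IL its (std (code c')) w" for its
  proof -
    have "tag2M (if t then 1 else 2) (std (code c)) (std (code c')) a"
      unfolding tag2M_nm[OF 3(6)] by auto
    then have "stepM s (At s) (Af s) (IL its) a w"
      using that(2) unfolding stepM_def by (cases t; cases s) (simp_all, blast+)
    then show ?thesis using justified_Cons that(1) by (intro exI[of _ "(a, w) # its"]) simp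
  qed
  show ?case
  proof (cases "t = s")
    case True
    then have "sem (RS S) c e = s" "sem (RS S) c' e = s" using 3(8) by (auto split: if_splits)
    with one two obtain xs ys where "justified s xs" "(std (code c), w) \<in> set xs"
      "justified s ys" "(std (code c'), w) \<in> set ys" by blast
    then show ?thesis using True IL_memb[OF _ nm_std]
      by (intro fin[of "xs @ ys"] justified_append) auto
  next
    case False
    then have "sem (RS S) c e = s \<or> sem (RS S) c' e = s" using 3(8) by (auto split: if_splits)
    with one two obtain xs where "justified s xs" "(std (code c), w) \<in> set xs \<or> (std (code c'), w) \<in> set xs"
      by blast
    then show ?thesis using False IL_memb[OF _ nm_std] by (intro fin[of xs]) auto
  qed
next
  case (4 s m' d c)
  obtain x where x: "sem (RS S) c (e(d := x)) = s" using 4(6) by (auto split: if_splits)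
  obtain w' where w': "ext w (std d) x w'" using ext_exists[OF N_std] by blast
  from 4(2)[OF 4(3) nm_std ext_envrep[OF nm_std w' 4(5)] x]
  obtain its where its: "justified s its" "(std (code c), w') \<in> set its" by blast
  have "tag2M (if s then 3 else 4) (std d) (std (code c)) a"
    unfolding tag2M_nm[OF 4(4)] by auto
  then have "stepM s (At s) (Af s) (IL its) a w"
    using w' IL_memb[OF its(2) nm_std] unfolding stepM_def by blast
  then show ?case using justified_Cons its(1) by (intro exI[of _ "(a, w) # its"]) simp
qed simp

lemma df_stepM_At: "df (\<lambda>e. stepM s (At s) (Af s) (itemM (e i) (e j) (e k)) (e l) (e n))"
  by (intro df_stepM defn_intros df_Tr)

lemma cert_of_list:
  assumes "justified s its" "(a, w) \<in> set its" "N a"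
  shows "certM s (At s) (Af s) a w"
proof -
  obtain u where u: "envrep u (length its) (\<lambda>i. fst (its ! i))" using envrep_exists by blast
  obtain v where v: "envrep v (length its) (\<lambda>i. snd (its ! i))" using envrep_exists by blast
  let ?k = "std (length its)"
  have memb: "itemM u v ?k x w" if il: "IL its x w" for x w
  proof -
    obtain c i where *: "i < length its" "its ! i = (c, w)" "N c" "c \<approx> x" "N x"
      using il unfolding IL_def by (auto simp: in_set_conv_nth)
    then have "ltM (std i) ?k" by (meson ltM_nm nm_std)
    moreover have "elem c (std i) u" "elem w (std i) v"
      using u v * nm_std[of i] eqr_refl[OF cong] unfolding envrep_def by auto
    ultimately show ?thesis using * unfolding itemM_def by blast
  qed
  have "stepM s (At s) (Af s) (itemM u v ?k) c w"
    if j: "ltM j ?k" "elem c j u" "elem w j v" for j c w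
  proof -
    obtain i where i: "i < length its" "nm j i" using ltM_nm[OF nm_std] j(1) by blast
    then have e: "eqr S c (fst (its ! i))" "eqr S w (snd (its ! i))"
      using u v j unfolding envrep_def by auto
    have "stepM s (At s) (Af s) (IL its) (fst (its ! i)) (snd (its ! i))"
      using assms(1) i nth_mem[of i its] unfolding justified_def by fastforce
    then have "stepM s (At s) (Af s) (itemM u v ?k) (fst (its ! i)) (snd (its ! i))"
      by (rule stepM_mono) (rule memb)
    \<comment> \<open>The entries read from u and v agree with the list only up to
      \<open>eqr\<close>; since the step condition is definable, it carries over.\<close>
    moreover have "(\<lambda>e. stepM s (At s) (Af s) (itemM (e 0) (e 1) (e 2)) (e 3) (e 4)) ((!) [u, v, ?k, c, w]) =
       (\<lambda>e. stepM s (At s) (Af s) (itemM (e 0) (e 1) (e 2)) (e 3) (e 4)) ((!) [u, v, ?k, fst (its ! i), snd (its ! i)])"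
      by (rule df_cong[OF df_stepM_At cong]) (use e in \<open>auto simp: eqr_refl[OF cong] nth_Cons split: nat.split\<close>)
    ultimately show ?thesis by (simp add: numeral_eq_Suc)
  qed
  moreover have "itemM u v ?k a w" by (rule memb) (use assms in \<open>auto simp: IL_def eqn_refl\<close>)
  ultimately show ?thesis unfolding certM_def by blast
qed

lemma Tr_Suc:
  assumes "cwf s (Suc m) d c" "nm a (code c)" "envrep w d e"
  shows "Tr s (Suc m) a w \<longleftrightarrow> sem (RS S) c e"
proof -
  have "certM s (At s) (Af s) a w \<longleftrightarrow> sem (RS S) c e = s"
  proof
    assume "certM s (At s) (Af s) a w"
    then show "sem (RS S) c e = s"
      unfolding certM_def using cert_sound[OF _ assms(1) refl refl assms(2) _ assms(3)] by blast
  next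
    assume "sem (RS S) c e = s"
    from cert_complete[OF assms(1) refl assms(2,3) this] show "certM s (At s) (Af s) a w"
      using cert_of_list nm_N[OF assms(2)] by blast
  qed
  then show ?thesis by (cases s) auto
qed

end

theorem Tr_correct:
  "cwf s m d c \<Longrightarrow> nm a (code c) \<Longrightarrow> envrep w d e \<Longrightarrow> Tr s m a w \<longleftrightarrow> sem (RS S) c e"
proof (induction m arbitrary: s d c a w e)
  case 0
  from 0(1) show ?case
  proof cases
    case (1 q "is" b)
    then show ?thesis using litM_nm[of a q b "is" d w e] 0(2,3) by simp
  qed
next
  case (Suc m)
  show ?case by (rule Tr_Suc[OF Suc.IH Suc.prems])
qed

text \<open>The detour through y makes truth invariant under the interpreted equality of numbers,
  which is not known for \<open>Tr\<close>. For sentences any w serves as the assignment, since no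
  position is constrained.\<close>

definition TruM :: "nat \<Rightarrow> 'a \<Rightarrow> bool" where
  "TruM m x \<longleftrightarrow> (\<exists>y w. N x \<and> N y \<and> y \<approx> x \<and> Tr True m y w)"

lemma df_TruM: "df (\<lambda>e. TruM m (e i))"
  unfolding TruM_def by (intro defn_intros df_Tr)

lemma TruM_nm: "nm x n \<Longrightarrow> TruM m x \<longleftrightarrow> TruM m (std n)"
proof -
  assume x: "nm x n"
  have "y \<approx> x \<longleftrightarrow> y \<approx> std n" if "N y" for y
    using that nm_eqn'[OF x that] nm_eqn'[OF nm_std that, of n] by simp
  then show ?thesis unfolding TruM_def using nm_N[OF x] by auto
qed

lemma TruM_correct:
  assumes "cwf True m 0 c"
  shows "TruM m (std (code c)) \<longleftrightarrow> sem (RS S) c e"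
proof -
  have "Tr True m y w \<longleftrightarrow> sem (RS S) c e" if "N y" "y \<approx> std (code c)" for y w
    by (rule Tr_correct[OF assms]) (use that in \<open>auto simp: nm_def envrep_def\<close>)
  moreover have "std (code c) \<approx> std (code c)" by (simp add: eqn_refl)
  ultimately show ?thesis unfolding TruM_def using N_std by blast
qed

end

section \<open>Definability of Horn programs\<close>

datatype pt = PV nat | PC nat | PP pt pt | PS pt

primrec pev :: "(nat \<Rightarrow> nat) \<Rightarrow> pt \<Rightarrow> nat" where
  "pev v (PV i) = v i" | "pev v (PC n) = n" | "pev v (PP p q) = pr (pev v p) (pev v q)" | "pev v (PS p) = Suc (pev v p)"

primrec pvars :: "pt \<Rightarrow> nat set" where
  "pvars (PV i) = {i}" | "pvars (PC n) = {}" | "pvars (PP p q) = pvars p \<union> pvars q" | "pvars (PS p) = pvars p"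

lemma finite_pvars: "finite (pvars p)"
  by (induction p) auto

text \<open>Provability will be presented as a Horn program over codes, so that definability has to be
  shown only once, for arbitrary programs. The side conditions are inequations and queries to a set of
  numbers, which will be the set of true sentences of bounded complexity.\<close>

datatype rule = Rule (concl: pt) (prems: "pt list") (neqs: "(pt \<times> pt) list") (orac: "pt list")

definition rvars :: "rule \<Rightarrow> nat set" where
  "rvars r = \<Union> (pvars ` (set (concl r # prems r @ orac r) \<union> fst ` set (neqs r) \<union> snd ` set (neqs r)))"

definition side :: "(nat \<Rightarrow> bool) \<Rightarrow> rule \<Rightarrow> (nat \<Rightarrow> nat) \<Rightarrow> bool" where
  "side X r v \<longleftrightarrow> (\<forall>(a, b)\<in>set (neqs r). pev v a \<noteq> pev v b) \<and> (\<forall>p\<in>set (orac r). X (pev v p))"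

inductive horn :: "rule list \<Rightarrow> (nat \<Rightarrow> bool) \<Rightarrow> nat \<Rightarrow> bool" for P X where
  horn: "r \<in> set P \<Longrightarrow> \<forall>p\<in>set (prems r). horn P X (pev v p) \<Longrightarrow> side X r v \<Longrightarrow> horn P X (pev v (concl r))"

text \<open>The number y bounds the conclusion and the values of all rule variables. Inside the
  model, a standard y will thereby force all these values to be standard.\<close>

definition inference :: "rule list \<Rightarrow> (nat \<Rightarrow> bool) \<Rightarrow> nat \<Rightarrow> nat \<Rightarrow> nat set \<Rightarrow> nat \<Rightarrow> bool" where
  "inference P X l y A n \<longleftrightarrow> n \<le> y \<and> (\<exists>r\<in>set P. \<exists>v. (\<forall>i<l. v i \<le> y) \<and> n = pev v (concl r) \<and>
     (\<forall>p\<in>set (prems r). pev v p \<in> A) \<and> side X r v)"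

lemma inference_mono: "inference P X l y A n \<Longrightarrow> y \<le> y' \<Longrightarrow> A \<subseteq> A' \<Longrightarrow> inference P X l y' A' n"
  unfolding inference_def by (meson order_trans subsetD)

primrec derivation :: "rule list \<Rightarrow> (nat \<Rightarrow> bool) \<Rightarrow> nat \<Rightarrow> nat \<Rightarrow> nat list \<Rightarrow> bool" where
  "derivation P X l y [] \<longleftrightarrow> True"
| "derivation P X l y (n # us) \<longleftrightarrow> inference P X l y (set us) n \<and> derivation P X l y us"

lemma derivation_mono: "derivation P X l y us \<Longrightarrow> y \<le> y' \<Longrightarrow> derivation P X l y' us"
  by (induction us) (auto elim: inference_mono)

lemma derivation_append:
  "derivation P X l y us \<Longrightarrow> derivation P X l y us' \<Longrightarrow> derivation P X l y (us @ us')"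
  by (induction us) (auto elim: inference_mono)

lemma derivation_nth:
  "derivation P X l y us \<Longrightarrow> j < length us \<Longrightarrow> inference P X l y (set (take j (rev us))) (rev us ! j)"
  by (induction us) (auto simp: nth_append less_Suc_eq)

lemma horn_derivation: "horn P X n \<Longrightarrow> \<exists>y us. derivation P X l y us \<and> n \<in> set us"
proof (induction rule: horn.induct)
  case (horn r v)
  have "\<exists>y us. derivation P X l y us \<and> (\<forall>p\<in>set ps. pev v p \<in> set us)" if "set ps \<subseteq> set (prems r)" for ps
    using that
  proof (induction ps)
    case Nil
    have "derivation P X l 0 []" by simp
    then show ?case by (intro exI[of _ 0] exI[of _ "[]"]) simp
  next
    case (Cons p ps)
    then obtain y us where 1: "derivation P X l y us" "\<forall>p\<in>set ps. pev v p \<in> set us" by auto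
    obtain y' us' where 2: "derivation P X l y' us'" "pev v p \<in> set us'" using horn.IH Cons.prems by force
    have "derivation P X l (max y y') (us @ us')"
      by (intro derivation_append derivation_mono[OF 1(1)] derivation_mono[OF 2(1)]) auto
    then show ?case using 1(2) 2(2)
      by (intro exI[of _ "max y y'"] exI[of _ "us @ us'"]) auto
  qed
  then obtain y us where d: "derivation P X l y us" "\<forall>p\<in>set (prems r). pev v p \<in> set us" by blast
  \<comment> \<open>Any common bound for the earlier derivation, the conclusion and the first l
    variables would do; a sum is the simplest one.\<close>
  define y' where "y' = y + pev v (concl r) + sum v {..<l}"
  have "v i \<le> y'" if "i < l" for i
    using that member_le_sum[of i "{..<l}" v] by (simp add: y'_def)
  then have "inference P X l y' (set us) (pev v (concl r))"
    unfolding inference_def using horn.hyps d(2) by (intro conjI bexI[of _ r] exI[of _ v]) (auto simp: y'_def)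
  moreover have "derivation P X l y' us" using d(1) by (rule derivation_mono) (simp add: y'_def)
  ultimately have "derivation P X l y' (pev v (concl r) # us)" by simp
  then show ?case by (meson list.set_intros(1))
qed

lemma defn_exs:
  fixes S :: "('a, 'f, 'p) struct"
  assumes "defn L S (\<lambda>e. R (map e [0..<l]) (\<lambda>i. e (i + l)))"
  shows "defn L S (\<lambda>e. \<exists>as. length as = l \<and> R as e)"
proof -
  obtain \<phi> where \<phi>: "in_lang L \<phi>" "\<And>e. sat S e \<phi> \<longleftrightarrow> R (map e [0..<l]) (\<lambda>i. e (i + l))"
    using assms unfolding defn_def by blast
  have "map (cat as e) [0..<l] = as" "(\<lambda>i. cat as e (i + l)) = e" if "length as = l" for as and e :: "nat \<Rightarrow> 'a"
    using that map_cat_vars0[of as e] by (auto simp: cat_def)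
  then have "sat S e (exs l \<phi>) \<longleftrightarrow> (\<exists>as. length as = l \<and> R as e)" for e
    unfolding sat_exs \<phi> by (intro ex_cong1 conj_cong) simp_all
  then show ?thesis using \<phi>(1) unfolding defn_def by (intro exI[of _ "exs l \<phi>"]) simp
qed

section \<open>Horn derivations coded by sequences of the model\<close>

context sequential_model
begin

primrec patM :: "pt \<Rightarrow> 'a list \<Rightarrow> 'a \<Rightarrow> bool" where
  "patM (PV i) vs x \<longleftrightarrow> N x \<and> N (vs ! i) \<and> x \<approx> vs ! i"
| "patM (PC n) vs x \<longleftrightarrow> nm x n"
| "patM (PP p q) vs x \<longleftrightarrow> (\<exists>a b. patM p vs a \<and> patM q vs b \<and> pairM a b x)"
| "patM (PS p) vs x \<longleftrightarrow> (\<exists>a. patM p vs a \<and> succM a x)"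

lemma df_patM:
  assumes "pvars p \<subseteq> {..<l}"
  shows "df (\<lambda>e. patM p (map (\<lambda>i. e (f i)) [0..<l]) (e j))"
  using assms
proof (induction p arbitrary: f j)
  case (PV i)
  then have "i < l" by simp
  then show ?case by (simp, intro defn_intros)
next
  case (PC n)
  show ?case by (simp, intro defn_intros)
next
  case (PP p q)
  show ?case using PP.prems by (simp, intro defn_intros PP.IH) auto
next
  case (PS p)
  show ?case using PS.prems by (simp, intro defn_intros PS.IH) auto
qed

lemma patM_nm:
  assumes "\<And>i. i < l \<Longrightarrow> nm (vs ! i) (v i)"
  shows "pvars p \<subseteq> {..<l} \<Longrightarrow> patM p vs x \<longleftrightarrow> nm x (pev v p)"
proof (induction p arbitrary: x)
  case (PV i)
  then have i: "nm (vs ! i) (v i)" using assms by simp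
  show ?case using nm_eqn'[OF i, of x] nm_N[OF i] nm_N[of x] by auto
next
  case (PP p q)
  then have "patM (PP p q) vs x \<longleftrightarrow> (\<exists>a b. nm a (pev v p) \<and> nm b (pev v q) \<and> pairM a b x)" by simp
  also have "\<dots> \<longleftrightarrow> nm x (pr (pev v p) (pev v q))" using pairM_nm1 nm_std by blast
  finally show ?case by simp
next
  case (PS p)
  then have "patM (PS p) vs x \<longleftrightarrow> (\<exists>a. nm a (pev v p) \<and> succM a x)" by simp
  also have "\<dots> \<longleftrightarrow> nm x (Suc (pev v p))" using succM_nm1 nm_std by blast
  finally show ?case by simp
qed simp

definition memM :: "'a \<Rightarrow> 'a \<Rightarrow> 'a \<Rightarrow> bool" where
  "memM u k c \<longleftrightarrow> (\<exists>j c'. ltM j k \<and> elem c' j u \<and> N c' \<and> N c \<and> c' \<approx> c)"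

lemma df_memM [defn_intros]: "df (\<lambda>e. memM (e i) (e j) (e k))"
  unfolding memM_def by (intro defn_intros)

context
  fixes P :: "rule list" and l :: nat and XM :: "'a \<Rightarrow> bool"
  assumes P: "\<And>r. r \<in> set P \<Longrightarrow> rvars r \<subseteq> {..<l}"
    and df_XM: "\<And>i. df (\<lambda>e. XM (e i))"
    and XM_nm: "\<And>x n. nm x n \<Longrightarrow> XM x \<longleftrightarrow> XM (std n)"
begin

definition ruleM :: "rule \<Rightarrow> 'a list \<Rightarrow> 'a \<Rightarrow> 'a \<Rightarrow> 'a \<Rightarrow> bool" where
  "ruleM r vs u j c \<longleftrightarrow> patM (concl r) vs c \<and> (\<forall>p\<in>set (prems r). \<exists>x. patM p vs x \<and> memM u j x) \<and>
     (\<forall>ab\<in>set (neqs r). \<exists>x y. patM (fst ab) vs x \<and> patM (snd ab) vs y \<and> \<not> x \<approx> y) \<and>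
     (\<forall>p\<in>set (orac r). \<exists>x. patM p vs x \<and> XM x)"

text \<open>The sequence u lists the derived facts; premises have to occur at earlier positions,
  which \<open>memM u j\<close> expresses. The single number y bounds the length, the facts and the
  rule instances, and is the size that is compared in Rosser's argument.\<close>

definition hornM :: "'a \<Rightarrow> 'a \<Rightarrow> bool" where
  "hornM y n \<longleftrightarrow> (\<exists>u k. leM k y \<and> memM u k n \<and> (\<forall>j c. ltM j k \<longrightarrow> elem c j u \<longrightarrow> leM c y \<and>
     (\<exists>vs. length vs = l \<and> (\<forall>i\<in>set [0..<l]. leM (vs ! i) y) \<and> (\<exists>r\<in>set P. ruleM r vs u j c))))"

lemma df_ruleM:
  assumes "r \<in> set P"
  shows "df (\<lambda>e. ruleM r (map (\<lambda>i. e (f i)) [0..<l]) (e i) (e j) (e k))"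
proof -
  have *: "pvars p \<subseteq> {..<l}" if "p \<in> set (concl r # prems r @ orac r) \<union> fst ` set (neqs r) \<union> snd ` set (neqs r)" for p
    using P[OF assms] that unfolding rvars_def by blast
  show ?thesis
    unfolding ruleM_def by (intro defn_intros defn_ball df_patM df_XM *) auto
qed

lemma df_hornM: "df (\<lambda>e. hornM (e i) (e j))"
proof -
  have *: "df (\<lambda>e. leM (map (\<lambda>i. e (f i)) [0..<l] ! m) (e j))" if "m \<in> set [0..<l]" for m f j
    using that by (simp, intro defn_intros)
  show ?thesis
    unfolding hornM_def by (intro defn_intros defn_exs defn_ball defn_bex df_ruleM *)
qed

abbreviation "XN \<equiv> \<lambda>n. XM (std n)"

lemma ruleM_nm:
  assumes "r \<in> set P" "\<And>i. i < l \<Longrightarrow> nm (vs ! i) (v i)" "nm c n"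
  shows "ruleM r vs u j c \<longleftrightarrow> n = pev v (concl r) \<and> (\<forall>p\<in>set (prems r). memM u j (std (pev v p))) \<and> side XN r v"
proof -
  have pat: "patM p vs x \<longleftrightarrow> nm x (pev v p)"
    if "p \<in> set (concl r # prems r @ orac r) \<union> fst ` set (neqs r) \<union> snd ` set (neqs r)" for p x
    by (rule patM_nm[OF assms(2)]) (use P[OF assms(1)] that in \<open>auto simp: rvars_def\<close>)
  have "patM (concl r) vs c \<longleftrightarrow> n = pev v (concl r)"
    using pat[of "concl r" c] nm_unique[OF assms(3), of "pev v (concl r)"] assms(3) by auto
  moreover have "(\<exists>x. patM p vs x \<and> memM u j x) \<longleftrightarrow> memM u j (std (pev v p))" if "p \<in> set (prems r)" for p
  proof -
    have "memM u j x \<longleftrightarrow> memM u j (std (pev v p))" if "nm x (pev v p)" for x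
    proof -
      have "c \<approx> x \<longleftrightarrow> c \<approx> std (pev v p)" if "N c" for c
        using nm_eqn'[OF \<open>nm x (pev v p)\<close> that] nm_eqn'[OF nm_std that, of "pev v p"] by simp
      then show ?thesis unfolding memM_def using nm_N[OF that] N_std by blast
    qed
    moreover have "patM p vs x \<longleftrightarrow> nm x (pev v p)" for x using that by (intro pat) auto
    ultimately show ?thesis using nm_std[of "pev v p"] by blast
  qed
  moreover have "(\<exists>x y. patM a vs x \<and> patM b vs y \<and> \<not> x \<approx> y) \<longleftrightarrow> pev v a \<noteq> pev v b"
    if "(a, b) \<in> set (neqs r)" for a b
  proof -
    have "patM a vs x \<longleftrightarrow> nm x (pev v a)" "patM b vs x \<longleftrightarrow> nm x (pev v b)" for x
      using that by (intro pat; force)+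
    moreover have "x \<approx> y \<longleftrightarrow> pev v a = pev v b" if "nm x (pev v a)" "nm y (pev v b)" for x y
      using nm_eqn[OF that(1) nm_N[OF that(2)]] nm_unique[OF that(2), of "pev v a"] that(2) by auto
    ultimately show ?thesis using nm_std[of "pev v a"] nm_std[of "pev v b"] by blast
  qed
  moreover have "(\<exists>x. patM p vs x \<and> XM x) \<longleftrightarrow> XM (std (pev v p))" if "p \<in> set (orac r)" for p
  proof -
    have "patM p vs x \<longleftrightarrow> nm x (pev v p)" for x using that by (intro pat) auto
    then show ?thesis using XM_nm[of _ "pev v p"] nm_std[of "pev v p"] by blast
  qed
  ultimately show ?thesis unfolding ruleM_def side_def by (auto simp: case_prod_beta)
qed

text \<open>With y standard, the length, the facts and the rule instances are standard as well, so
  strong induction on positions is available outside the model and turns the sequence into an actual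
  derivation.\<close>

lemma hornM_sound:
  assumes "hornM y n" "nm y b" "nm n z"
  shows "horn P XN z"
proof -
  obtain u k where k: "leM k y" "memM u k n" and step: "\<And>j c. ltM j k \<Longrightarrow> elem c j u \<Longrightarrow> leM c y \<and>
     (\<exists>vs. length vs = l \<and> (\<forall>i\<in>set [0..<l]. leM (vs ! i) y) \<and> (\<exists>r\<in>set P. ruleM r vs u j c))"
    using assms(1) unfolding hornM_def by blast
  obtain kk where kk: "nm k kk" using k(1) leM_nm[OF assms(2)] by blast
  have all: "\<exists>n. nm c n \<and> horn P XN n" if "i < kk" "nm j i" "elem c j u" for i j c
    using that
  proof (induction i arbitrary: j c rule: less_induct)
    case (less i)
    have "ltM j k" using ltM_nm[OF kk] less.prems by blast
    then obtain vs r where "leM c y" and vs: "length vs = l" "\<forall>i\<in>set [0..<l]. leM (vs ! i) y"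
      and r: "r \<in> set P" "ruleM r vs u j c" using step less.prems(3) by blast
    then obtain n where n: "nm c n" using leM_nm[OF assms(2)] by blast
    have "\<forall>i<l. \<exists>n. nm (vs ! i) n" using vs leM_nm[OF assms(2)] by auto
    then obtain v where v: "\<And>i. i < l \<Longrightarrow> nm (vs ! i) (v i)" by metis
    have *: "n = pev v (concl r)" "\<forall>p\<in>set (prems r). memM u j (std (pev v p))" "side XN r v"
      using ruleM_nm[OF r(1) v n] r(2) by auto
    have "horn P XN (pev v p)" if p: "p \<in> set (prems r)" for p
    proof -
      obtain j' c' where j': "ltM j' j" "elem c' j' u" "N c'" "c' \<approx> std (pev v p)"
        using bspec[OF *(2) p] unfolding memM_def by blast
      then obtain i' where i': "i' < i" "nm j' i'" using ltM_nm[OF less.prems(2)] by blast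
      have "i' < kk" using i'(1) less.prems(1) by simp
      from less.IH[OF i'(1) this i'(2) j'(2)] obtain n' where "nm c' n'" "horn P XN n'" by blast
      moreover have "nm c' (pev v p)" using nm_eqn'[OF nm_std j'(3)] j'(4) by blast
      ultimately show ?thesis using nm_unique by blast
    qed
    then have "horn P XN n" unfolding *(1) by (intro horn.horn r(1) *(3)) auto
    then show ?case using n by blast
  qed
  obtain j c where j: "ltM j k" "elem c j u" "N c" "c \<approx> n" using k(2) unfolding memM_def by blast
  then obtain i where "i < kk" "nm j i" using ltM_nm[OF kk] by blast
  then obtain n' where "nm c n'" "horn P XN n'" using all j(2) by blast
  moreover have "nm c z" using nm_eqn'[OF assms(3) j(3)] j(4) by blast
  ultimately show ?thesis using nm_unique by blast
qed

lemma hornM_complete: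
  assumes "horn P XN z"
  shows "\<exists>b. \<forall>y n. nm y b \<longrightarrow> nm n z \<longrightarrow> hornM y n"
proof -
  obtain b' vs where d': "derivation P XN l b' vs" "z \<in> set vs" using horn_derivation[OF assms] by blast
  define us where "us = rev vs"
  \<comment> \<open>The length is added because \<open>hornM\<close> also requires the number of
    facts to be at most y.\<close>
  define b where "b = b' + length us"
  have "derivation P XN l b vs" using d'(1) by (rule derivation_mono) (simp add: b_def)
  then have d: "\<And>i. i < length us \<Longrightarrow> inference P XN l b (set (take i us)) (us ! i)" "z \<in> set us"
    using derivation_nth[of P XN l b vs] d'(2) by (auto simp: us_def)
  obtain u where u: "envrep u (length us) (\<lambda>i. std (us ! i))" using envrep_exists by blast
  let ?k = "std (length us)"
  \<comment> \<open>Entries are known only up to \<open>eqr\<close>, but representing a fixed number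
    n is definable and therefore insensitive to that.\<close>
  have eqr_nm: "nm c n" if "eqr S c (std n)" for c n
  proof -
    have "(\<lambda>e. nm (e 0) n) (\<lambda>_. c) = (\<lambda>e. nm (e 0) n) (\<lambda>_. std n)"
      by (rule df_cong[OF df_nm cong that])
    then show ?thesis by simp
  qed
  have elem: "elem c j u \<longleftrightarrow> eqr S c (std (us ! i))" if "nm j i" "i < length us" for c j i
    using u that unfolding envrep_def by blast
  have mem: "memM u j c" if "nm j i" "i \<le> length us" "i' < i" "nm c (us ! i')" for j i i' c
  proof -
    have "ltM (std i') j" using ltM_nm[OF that(1)] that(3) nm_std by blast
    moreover have "elem (std (us ! i')) (std i') u" using elem[OF nm_std, of i'] that eqr_refl[OF cong] by auto
    moreover have "std (us ! i') \<approx> c" using nm_eqn[OF nm_std nm_N[OF that(4)]] that(4) by blast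
    ultimately show ?thesis unfolding memM_def using nm_N[OF that(4)] N_std by blast
  qed
  have "hornM y n" if y: "nm y b" and n: "nm n z" for y n
    unfolding hornM_def
  proof (rule exI[of _ u], rule exI[of _ ?k], intro conjI allI impI)
    show "leM ?k y" using leM_nm[OF y] nm_std[of "length us"] le_add2[of "length us" b'] unfolding b_def by blast
    obtain i where "i < length us" "us ! i = z" using d(2) by (auto simp: in_set_conv_nth)
    then show "memM u ?k n" using mem[OF nm_std, of "length us" i n] n by simp
    fix j c assume j: "ltM j ?k" "elem c j u"
    then obtain i where i: "i < length us" "nm j i" using ltM_nm[OF nm_std] by blast
    have c: "nm c (us ! i)" using eqr_nm elem[OF i(2,1)] j(2) by blast
    obtain r v where r: "us ! i \<le> b" "r \<in> set P" "\<forall>m<l. v m \<le> b" "us ! i = pev v (concl r)"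
      "\<forall>p\<in>set (prems r). pev v p \<in> set (take i us)" "side XN r v"
      using d(1)[OF i(1)] unfolding inference_def by blast
    show "leM c y" using leM_nm[OF y] c r(1) by blast
    let ?vs = "map (\<lambda>i. std (v i)) [0..<l]"
    have "memM u j (std (pev v p))" if "p \<in> set (prems r)" for p
    proof -
      have "pev v p \<in> set (take i us)" using r(5) that by blast
      then obtain i' where "i' < i" "us ! i' = pev v p" using i(1) by (auto simp: in_set_conv_nth)
      then show ?thesis using mem[OF i(2), of i' "std (pev v p)"] i(1) by simp
    qed
    then have "ruleM r ?vs u j c" using ruleM_nm[OF r(2) _ c, of ?vs v] r(4,6) by auto
    moreover have "\<forall>m\<in>set [0..<l]. leM (?vs ! m) y" using leM_nm[OF y] r(3) nm_std by fastforce
    ultimately show "\<exists>vs. length vs = l \<and> (\<forall>i\<in>set [0..<l]. leM (vs ! i) y) \<and> (\<exists>r\<in>set P. ruleM r vs u j c)"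
      using r(2) by (intro exI[of _ ?vs]) auto
  qed
  then show ?thesis by blast
qed

end

end

section \<open>Refutability as a Horn program\<close>

abbreviation "T2 k a b \<equiv> PP (PC k) (PP a b)"
abbreviation "T3 k a b c \<equiv> PP (PC k) (PP a (PP b c))"
abbreviation "pcons x l \<equiv> PS (PP x l)"
abbreviation "pnil \<equiv> PC 0"

primrec ce :: "(nat \<times> nat) list \<Rightarrow> nat" where
  "ce [] = 0" | "ce (x # e) = Suc (pr (pr (fst x) (snd x)) (ce e))"

primrec cg :: "(cf \<times> (nat \<times> nat) list) list \<Rightarrow> nat" where
  "cg [] = 0" | "cg (x # g) = Suc (pr (pr (code (fst x)) (ce (snd x))) (cg g))"

text \<open>An unbound variable denotes the constant 0, as in \<open>r_lk3\<close>. Sequents are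
  therefore read only with a positive bound, so that this default also counts among the old
  constants.\<close>

primrec lk :: "(nat \<times> nat) list \<Rightarrow> nat \<Rightarrow> nat" where
  "lk [] i = 0" | "lk (x # e) i = (if i = fst x then snd x else lk e i)"

lemma ce_0 [simp]: "ce e = 0 \<longleftrightarrow> e = []" "0 = ce e \<longleftrightarrow> e = []" by (cases e; simp)+
lemma lc_0 [simp]: "lc e = 0 \<longleftrightarrow> e = []" "0 = lc e \<longleftrightarrow> e = []" by (cases e; simp)+
lemma cg_0 [simp]: "cg e = 0 \<longleftrightarrow> e = []" "0 = cg e \<longleftrightarrow> e = []" by (cases e; simp)+

lemma ce_Suc: "Suc (pr x y) = ce e \<longleftrightarrow> (\<exists>i a e'. e = (i, a) # e' \<and> x = pr i a \<and> y = ce e')" by (cases e) auto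
lemma lc_Suc: "Suc (pr x y) = lc e \<longleftrightarrow> (\<exists>e'. e = x # e' \<and> y = lc e')" by (cases e) auto
lemma cg_Suc: "Suc (pr x y) = cg g \<longleftrightarrow> (\<exists>c e g'. g = (c, e) # g' \<and> x = pr (code c) (ce e) \<and> y = cg g')" by (cases g) auto

lemma lc_inj: "lc xs = lc ys \<longleftrightarrow> xs = ys"
proof (induction xs arbitrary: ys)
  case (Cons x xs)
  then show ?case by (cases ys) auto
qed auto

lemma code_Lit: "pr 0 (pr q (pr (of_bool b) l)) = code c \<longleftrightarrow> (\<exists>is. c = Lit q b is \<and> l = lc is)"
  by (cases c) (auto simp: of_bool_eq_iff)

lemma code_Bin:
  "pr (Suc 0) (pr a b) = code c \<longleftrightarrow> (\<exists>x y. c = Bin True x y \<and> a = code x \<and> b = code y)"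
  "pr 2 (pr a b) = code c \<longleftrightarrow> (\<exists>x y. c = Bin False x y \<and> a = code x \<and> b = code y)"
  by (cases c; auto split: if_splits)+

lemma code_Qu:
  "pr 3 (pr i a) = code c \<longleftrightarrow> (\<exists>x. c = Qu True i x \<and> a = code x)"
  "pr 4 (pr i a) = code c \<longleftrightarrow> (\<exists>x. c = Qu False i x \<and> a = code x)"
  by (cases c; auto split: if_splits)+

lemma code_Up:
  "pr 5 a = code c \<longleftrightarrow> (\<exists>x. c = Up True x \<and> a = code x)"
  "pr 6 a = code c \<longleftrightarrow> (\<exists>x. c = Up False x \<and> a = code x)"
  by (cases c; auto split: if_splits)+

text \<open>Predicates of the Horn program: 0 lookup of a variable in an environment, 1 lookup of a list of
  variables, 2 list membership, 3 refutability of a sequent, 4 less-than, 5 well-formedness, 6 the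
  formula defining a numeral, 7 refutability of a formula applied to a numeral. A sequent is a list of
  formulae with environments mapping variables to constants, all constants being below a bound.\<close>

definition "r_lk1 = Rule (T3 0 (pcons (PP (PV 1) (PV 2)) (PV 0)) (PV 1) (PV 2)) [] [] []"
definition "r_lk2 = Rule (T3 0 (pcons (PP (PV 3) (PV 4)) (PV 0)) (PV 1) (PV 2)) [T3 0 (PV 0) (PV 1) (PV 2)] [(PV 1, PV 3)] []"
definition "r_lk3 = Rule (T3 0 pnil (PV 0) (PC 0)) [] [] []"
definition "r_ml1 = Rule (T3 1 (PV 0) pnil pnil) [] [] []"
definition "r_ml2 = Rule (T3 1 (PV 0) (pcons (PV 1) (PV 2)) (pcons (PV 3) (PV 4)))
  [T3 0 (PV 0) (PV 1) (PV 3), T3 1 (PV 0) (PV 2) (PV 4)] [] []"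
definition "r_mb1 = Rule (T2 2 (PV 0) (pcons (PV 0) (PV 1))) [] [] []"
definition "r_mb2 = Rule (T2 2 (PV 0) (pcons (PV 2) (PV 1))) [T2 2 (PV 0) (PV 1)] [] []"
definition "r_lt1 = Rule (T2 4 (PV 0) (PS (PV 0))) [] [] []"
definition "r_lt2 = Rule (T2 4 (PV 0) (PS (PV 1))) [T2 4 (PV 0) (PV 1)] [] []"

abbreviation "pwf s m d c \<equiv> PP (PC 5) (PP s (PP m (PP d c)))"

definition "r_wf_lit q k b = Rule (pwf (PV 0) (PC 0) (PV 1) (PP (PC 0) (PP (PC q) (PP (PC (of_bool b)) (foldr pcons (map PV [2..<2 + k]) pnil)))))
  (map (\<lambda>i. T2 4 (PV i) (PV 1)) [2..<2 + k]) [] []"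
definition "r_wf_up b = Rule (pwf (PV 0) (PS (PV 1)) (PV 2) (PP (PC (if b then 5 else 6)) (PV 3)))
  [pwf (PC (of_bool b)) (PV 1) (PV 2) (PV 3)] [] []"
definition "r_wf_bin b = Rule (pwf (PV 0) (PS (PV 1)) (PV 2) (PP (PC (if b then 1 else 2)) (PP (PV 3) (PV 4))))
  [pwf (PV 0) (PS (PV 1)) (PV 2) (PV 3), pwf (PV 0) (PS (PV 1)) (PV 2) (PV 4)] [] []"
definition "r_wf_qu b = Rule (pwf (PC (of_bool b)) (PS (PV 1)) (PV 2) (PP (PC (if b then 3 else 4)) (PP (PV 2) (PV 3))))
  [pwf (PC (of_bool b)) (PS (PV 1)) (PS (PV 2)) (PV 3)] [] []"

definition "r_nm1 cz = Rule (T2 6 (PC 0) (PC (code cz))) [] [] []"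
definition "r_nm2 cs ceq = Rule (T2 6 (PS (PV 0)) (T2 3 (PC 1) (T2 1 (PC (code cs)) (T2 3 (PC 0) (T2 1 (PC (code ceq)) (PV 1))))))
  [T2 6 (PV 0) (PV 1)] [] []"
definition "r_go = Rule (T2 7 (PV 0) (PV 1))
  [T2 6 (PV 1) (PV 2), T2 3 (PC 1) (pcons (PP (T2 3 (PC 0) (T2 1 (PV 2) (PV 0))) pnil) pnil)] [] []"

text \<open>Complementary literals may use different variables and environments; they clash if both
  argument lists denote the same list of constants, held in \<open>PV 7\<close>.\<close>

definition "r_clash = Rule (T2 3 (PV 0) (PV 1))
  [T2 2 (PP (PP (PC 0) (PP (PV 2) (PP (PC 1) (PV 3)))) (PV 4)) (PV 1),
   T2 2 (PP (PP (PC 0) (PP (PV 2) (PP (PC 0) (PV 5)))) (PV 6)) (PV 1),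
   T3 1 (PV 4) (PV 3) (PV 7), T3 1 (PV 6) (PV 5) (PV 7)] [] []"
definition "r_conj = Rule (T2 3 (PV 0) (PV 1))
  [T2 2 (PP (T2 1 (PV 2) (PV 3)) (PV 4)) (PV 1),
   T2 3 (PV 0) (pcons (PP (PV 2) (PV 4)) (pcons (PP (PV 3) (PV 4)) (PV 1)))] [] []"
definition "r_disj = Rule (T2 3 (PV 0) (PV 1))
  [T2 2 (PP (T2 2 (PV 2) (PV 3)) (PV 4)) (PV 1),
   T2 3 (PV 0) (pcons (PP (PV 2) (PV 4)) (PV 1)), T2 3 (PV 0) (pcons (PP (PV 3) (PV 4)) (PV 1))] [] []"
text \<open>The bound itself is the new constant, and increasing it records that the constant is now
  in use: this is the eigenvariable condition.\<close>

definition "r_ex = Rule (T2 3 (PV 0) (PV 1))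
  [T2 2 (PP (T2 3 (PV 2) (PV 3)) (PV 4)) (PV 1),
   T2 3 (PS (PV 0)) (pcons (PP (PV 3) (pcons (PP (PV 2) (PV 0)) (PV 4))) (PV 1))] [] []"
definition "r_all = Rule (T2 3 (PV 0) (PV 1))
  [T2 2 (PP (T2 4 (PV 2) (PV 3)) (PV 4)) (PV 1), T2 4 (PV 5) (PV 0),
   T2 3 (PV 0) (pcons (PP (PV 3) (pcons (PP (PV 2) (PV 5)) (PV 4))) (PV 1))] [] []"
definition "r_up b = Rule (T2 3 (PV 0) (PV 1))
  [T2 2 (PP (PP (PC (if b then 5 else 6)) (PV 2)) (PV 3)) (PV 1),
   T2 3 (PV 0) (pcons (PP (PV 2) (PV 3)) (PV 1))] [] []"
text \<open>Universal formulae can be instantiated only below the bound; raising it makes further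
  constants available to them.\<close>

definition "r_bump = Rule (T2 3 (PV 0) (PV 1)) [T2 3 (PS (PV 0)) (PV 1)] [] []"
text \<open>The set of numbers queried is arbitrary outside the codes of sentences of level M. The
  well-formedness premise keeps such numbers out.\<close>

definition "r_ax M = Rule (T2 3 (PV 0) (PV 1))
  [pwf (PC 1) (PC M) (PC 0) (PV 2), T2 3 (PV 0) (pcons (PP (PV 2) pnil) (PV 1))] [] [PV 2]"

lemmas r_defs = r_lk1_def r_lk2_def r_lk3_def r_ml1_def r_ml2_def r_mb1_def r_mb2_def r_lt1_def r_lt2_def
  r_wf_lit_def r_wf_up_def r_wf_bin_def r_wf_qu_def r_nm1_def r_nm2_def r_go_def r_clash_def r_conj_def
  r_disj_def r_ex_def r_all_def r_up_def r_bump_def r_ax_def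

lemma lk_less: "0 < n \<Longrightarrow> \<forall>x\<in>set e. snd x < n \<Longrightarrow> lk e i < n"
  by (induction e) auto

lemma lk_Cons_upd: "(\<lambda>j. v (lk ((i, a) # e) j)) = (\<lambda>j. v (lk e j))(i := v a)"
  by auto

locale refutation = lang_atoms L ats
  for L :: "('f, 'p) lang" and ats +
  fixes M :: nat and cz cs ceq :: cf and X :: "nat \<Rightarrow> bool"
begin

definition prog :: "rule list" where
  "prog = [r_lk1, r_lk2, r_lk3, r_ml1, r_ml2, r_mb1, r_mb2, r_lt1, r_lt2, r_wf_up True, r_wf_up False,
     r_wf_bin True, r_wf_bin False, r_wf_qu True, r_wf_qu False, r_nm1 cz, r_nm2 cs ceq, r_go, r_clash, r_conj,
     r_disj, r_ex, r_all, r_up True, r_up False, r_bump, r_ax M] @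
     map (\<lambda>q. r_wf_lit q (arq q) True) [0..<na] @ map (\<lambda>q. r_wf_lit q (arq q) False) [0..<na]"

text \<open>Intended reading: \<open>cs\<close> says that variable 0 is the successor of variable 1,
  and \<open>ceq\<close> equates the two. Copying the predecessor back to variable 0 lets the
  formula for p be reused unchanged, so the recursion involves no renaming.\<close>

primrec num_cf :: "nat \<Rightarrow> cf" where
  "num_cf 0 = cz"
| "num_cf (Suc p) = Qu True 1 (Bin True cs (Qu True 0 (Bin True ceq (num_cf p))))"

definition at_num :: "cf \<Rightarrow> nat \<Rightarrow> cf" where
  "at_num c p = Qu True 0 (Bin True (num_cf p) c)"

abbreviation "hp \<equiv> horn prog X"

definition unsat :: "(nat \<Rightarrow> 'a list \<Rightarrow> bool) \<Rightarrow> (cf \<times> (nat \<times> nat) list) list \<Rightarrow> bool" where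
  "unsat R g \<longleftrightarrow> \<not> (\<exists>v. \<forall>x\<in>set g. sem R (fst x) (\<lambda>i. v (lk (snd x) i)))"

definition mLK :: "nat \<Rightarrow> bool" where "mLK y \<longleftrightarrow> (\<forall>e i a. y = pr (ce e) (pr i a) \<longrightarrow> a = lk e i)"
definition mML :: "nat \<Rightarrow> bool" where "mML y \<longleftrightarrow> (\<forall>e is as. y = pr (ce e) (pr (lc is) as) \<longrightarrow> as = lc (map (lk e) is))"
definition mMB :: "nat \<Rightarrow> bool" where
  "mMB y \<longleftrightarrow> (\<forall>z g. y = pr z (cg g) \<longrightarrow> (\<exists>c e. (c, e) \<in> set g \<and> z = pr (code c) (ce e)))"
definition mRF :: "(nat \<Rightarrow> 'a list \<Rightarrow> bool) \<Rightarrow> nat \<Rightarrow> bool" where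
  "mRF R y \<longleftrightarrow> (\<forall>n g. y = pr n (cg g) \<longrightarrow> 0 < n \<longrightarrow> (\<forall>x\<in>set g. \<forall>y\<in>set (snd x). snd y < n) \<longrightarrow> unsat R g)"
definition mLT :: "nat \<Rightarrow> bool" where "mLT y \<longleftrightarrow> (\<forall>a b. y = pr a b \<longrightarrow> a < b)"
definition mWF :: "nat \<Rightarrow> bool" where
  "mWF y \<longleftrightarrow> (\<forall>s m d c. y = pr (of_bool s) (pr m (pr d c)) \<longrightarrow> (\<exists>c'. c = code c' \<and> cwf s m d c'))"
definition mNM :: "nat \<Rightarrow> bool" where "mNM y \<longleftrightarrow> (\<forall>p x. y = pr p x \<longrightarrow> x = code (num_cf p))"
definition mGO :: "(nat \<Rightarrow> 'a list \<Rightarrow> bool) \<Rightarrow> nat \<Rightarrow> bool" where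
  "mGO R y \<longleftrightarrow> (\<forall>c p. y = pr (code c) p \<longrightarrow> (\<forall>a. \<not> sem R (at_num c p) (\<lambda>_. a)))"

text \<open>The invariant of the soundness proof: every derivable fact is correct in its intended
  reading. Each reading constrains only arguments of the expected form.\<close>

definition meaning :: "(nat \<Rightarrow> 'a list \<Rightarrow> bool) \<Rightarrow> nat \<Rightarrow> bool" where
  "meaning R x \<longleftrightarrow> (\<forall>k y. x = pr k y \<longrightarrow> (k = 0 \<longrightarrow> mLK y) \<and> (k = 1 \<longrightarrow> mML y) \<and> (k = 2 \<longrightarrow> mMB y) \<and>
     (k = 3 \<longrightarrow> mRF R y) \<and> (k = 4 \<longrightarrow> mLT y) \<and> (k = 5 \<longrightarrow> mWF y) \<and> (k = 6 \<longrightarrow> mNM y) \<and> (k = 7 \<longrightarrow> mGO R y))"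

lemma meaning_simps [simp]:
  "meaning R (pr 0 y) = mLK y" "meaning R (pr 1 y) = mML y" "meaning R (pr (Suc 0) y) = mML y" "meaning R (pr 2 y) = mMB y"
  "meaning R (pr 3 y) = mRF R y" "meaning R (pr 4 y) = mLT y" "meaning R (pr 5 y) = mWF y"
  "meaning R (pr 6 y) = mNM y" "meaning R (pr 7 y) = mGO R y"
  by (auto simp: meaning_def)

section \<open>Soundness of the tableau calculus\<close>

definition sound :: "(nat \<Rightarrow> 'a list \<Rightarrow> bool) \<Rightarrow> rule \<Rightarrow> bool" where
  "sound R r \<longleftrightarrow> (\<forall>v. (\<forall>p\<in>set (prems r). meaning R (pev v p)) \<longrightarrow> side X r v \<longrightarrow> meaning R (pev v (concl r)))"

lemma sound_lk: "sound R r_lk1" "sound R r_lk2" "sound R r_lk3"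
  unfolding sound_def r_defs by (auto simp: mLK_def side_def ce_Suc)

lemma sound_ml: "sound R r_ml1" "sound R r_ml2"
  unfolding sound_def r_defs by (auto simp: mLK_def mML_def side_def lc_Suc)

lemma sound_mb: "sound R r_mb1" "sound R r_mb2"
proof -
  show "sound R r_mb1"
    unfolding sound_def r_defs by (simp add: mMB_def side_def cg_Suc) (metis list.set_intros(1))
  show "sound R r_mb2"
    unfolding sound_def
  proof (intro allI impI)
    fix v assume "\<forall>p\<in>set (prems r_mb2). meaning R (pev v p)"
    then have prem: "\<And>g. v 1 = cg g \<Longrightarrow> \<exists>c e. (c, e) \<in> set g \<and> v 0 = pr (code c) (ce e)"
      by (simp add: r_defs mMB_def)
    have "mMB (pr (v 0) (Suc (pr (v 2) (v 1))))"
      unfolding mMB_def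
    proof (intro allI impI)
      fix z g assume "pr (v 0) (Suc (pr (v 2) (v 1))) = pr z (cg g)"
      then obtain x g' where "z = v 0" "g = x # g'" "v 1 = cg g'" by (auto simp: cg_Suc)
      with prem[of g'] show "\<exists>c e. (c, e) \<in> set g \<and> z = pr (code c) (ce e)" by auto
    qed
    then show "meaning R (pev v (concl r_mb2))" by (simp add: r_defs)
  qed
qed

lemma sound_lt: "sound R r_lt1" "sound R r_lt2"
  unfolding sound_def r_defs by (auto simp: mLT_def side_def less_SucI)

lemma pev_list: "pev v (foldr pcons (map PV xs) pnil) = lc (map v xs)"
  by (induction xs) auto

lemma sound_wf_lit:
  assumes "q < na"
  shows "sound R (r_wf_lit q (arq q) b)"
proof -
  have "cwf s 0 (v 1) (Lit q b (map v [2..<2 + arq q]))" if "\<forall>i\<in>{2..<2 + arq q}. v i < v 1" for s v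
    using assms that by (intro cwf.intros) auto
  note wf = this
  show ?thesis
    unfolding sound_def
  proof (intro allI impI)
    fix v assume "\<forall>p\<in>set (prems (r_wf_lit q (arq q) b)). meaning R (pev v p)"
    then have "\<forall>i\<in>{2..<2 + arq q}. v i < v 1" by (auto simp: r_defs mLT_def simp del: upt_Suc)
    from wf[OF this] have "mWF (pr (v 0) (pr 0 (pr (v 1) (code (Lit q b (map v [2..<2 + arq q]))))))"
      unfolding mWF_def by (auto simp del: code.simps)
    then show "meaning R (pev v (concl (r_wf_lit q (arq q) b)))" by (simp add: r_defs pev_list del: upt_Suc)
  qed
qed

lemma code_exI: "c = code c' \<Longrightarrow> cwf s m d c' \<Longrightarrow> \<exists>c'. c = code c' \<and> cwf s m d c'"
  by blast

lemma mWF_I: "(\<And>s. a = of_bool s \<Longrightarrow> \<exists>c'. c = code c' \<and> cwf s m d c') \<Longrightarrow> mWF (pr a (pr m (pr d c)))"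
  unfolding mWF_def by auto

lemma mWF_D: "mWF (pr (of_bool s) (pr m (pr d c))) \<Longrightarrow> \<exists>c'. c = code c' \<and> cwf s m d c'"
  unfolding mWF_def by auto

lemma sound_wf: "sound R (r_wf_up b)" "sound R (r_wf_bin b)" "sound R (r_wf_qu b)"
proof -
  show "sound R (r_wf_up b)"
    unfolding sound_def
  proof (intro allI impI)
    fix v assume "\<forall>p\<in>set (prems (r_wf_up b)). meaning R (pev v p)"
    then have "mWF (pr (of_bool b) (pr (v 1) (pr (v 2) (v 3))))" by (simp add: r_defs)
    from mWF_D[OF this] obtain c where "v 3 = code c" "cwf b (v 1) (v 2) c" by blast
    then have "mWF (pr (v 0) (pr (Suc (v 1)) (pr (v 2) (code (Up b c)))))"
      by (intro mWF_I code_exI[OF refl] cwf.intros)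
    then show "meaning R (pev v (concl (r_wf_up b)))" using \<open>v 3 = code c\<close> by (simp add: r_defs)
  qed
  show "sound R (r_wf_bin b)"
    unfolding sound_def
  proof (intro allI impI)
    fix v assume "\<forall>p\<in>set (prems (r_wf_bin b)). meaning R (pev v p)"
    then have *: "mWF (pr (v 0) (pr (Suc (v 1)) (pr (v 2) (v 3))))" "mWF (pr (v 0) (pr (Suc (v 1)) (pr (v 2) (v 4))))"
      by (simp_all add: r_defs)
    have "mWF (pr (v 0) (pr (Suc (v 1)) (pr (v 2) (pr (if b then 1 else 2) (pr (v 3) (v 4))))))"
    proof (rule mWF_I)
      fix s assume s: "v 0 = of_bool s"
      obtain c c' where c: "v 3 = code c" "cwf s (Suc (v 1)) (v 2) c" "v 4 = code c'" "cwf s (Suc (v 1)) (v 2) c'"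
        using *[unfolded s, THEN mWF_D] by blast
      show "\<exists>c'. pr (if b then 1 else 2) (pr (v 3) (v 4)) = code c' \<and> cwf s (Suc (v 1)) (v 2) c'"
        by (rule code_exI[of _ "Bin b c c'"]) (use c in \<open>auto intro: cwf.intros\<close>)
    qed
    then show "meaning R (pev v (concl (r_wf_bin b)))" by (simp add: r_defs)
  qed
  show "sound R (r_wf_qu b)"
    unfolding sound_def
  proof (intro allI impI)
    fix v assume "\<forall>p\<in>set (prems (r_wf_qu b)). meaning R (pev v p)"
    then have "mWF (pr (of_bool b) (pr (Suc (v 1)) (pr (Suc (v 2)) (v 3))))" by (simp add: r_defs)
    from mWF_D[OF this] obtain c where "v 3 = code c" "cwf b (Suc (v 1)) (Suc (v 2)) c" by blast
    then have "mWF (pr (of_bool b) (pr (Suc (v 1)) (pr (v 2) (code (Qu b (v 2) c)))))"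
      by (intro mWF_I code_exI[OF refl]) (auto intro!: cwf.intros simp: of_bool_eq_iff)
    then show "meaning R (pev v (concl (r_wf_qu b)))" using \<open>v 3 = code c\<close> by (simp add: r_defs)
  qed
qed

lemma sound_nm: "sound R (r_nm1 cz)" "sound R (r_nm2 cs ceq)"
  unfolding sound_def r_defs by (auto simp: mNM_def side_def)

lemma mRF_I:
  "(\<And>g. y = cg g \<Longrightarrow> 0 < n \<Longrightarrow> \<forall>x\<in>set g. \<forall>y\<in>set (snd x). snd y < n \<Longrightarrow> unsat R g) \<Longrightarrow> mRF R (pr n y)"
  unfolding mRF_def by auto

lemma mRF_D:
  "mRF R (pr n (cg g)) \<Longrightarrow> 0 < n \<Longrightarrow> \<forall>x\<in>set g. \<forall>y\<in>set (snd x). snd y < n \<Longrightarrow> unsat R g"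
  unfolding mRF_def by auto

lemma sound_go: "sound R r_go"
  unfolding sound_def
proof (intro allI impI)
  fix v assume *: "\<forall>p\<in>set (prems r_go). meaning R (pev v p)"
  have "mGO R (pr (v 0) (v 1))"
    unfolding mGO_def
  proof (intro allI impI)
    fix c p a assume "pr (v 0) (v 1) = pr (code c) p"
    then have c: "v 0 = code c" "v 1 = p" by auto
    have "v 2 = code (num_cf p)" "mRF R (pr 1 (cg [(at_num c p, [])]))"
      using * c by (auto simp: r_defs mNM_def at_num_def)
    from mRF_D[OF this(2)] have "unsat R [(at_num c p, [])]" by simp
    then have "\<forall>v. \<not> sem R (at_num c p) (\<lambda>i. v (0 :: nat))" by (simp add: unsat_def)
    from this[rule_format, of "\<lambda>_. a"] show "\<not> sem R (at_num c p) (\<lambda>_. a)" .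
  qed
  then show "meaning R (pev v (concl r_go))" by (simp add: r_defs)
qed

lemma mMB_D: "mMB (pr z (cg g)) \<Longrightarrow> \<exists>c e. (c, e) \<in> set g \<and> z = pr (code c) (ce e)"
  unfolding mMB_def by auto

lemma sound_rf_step:
  assumes "\<And>g v. (\<forall>p\<in>set (prems r). meaning R (pev v p)) \<Longrightarrow> side X r v \<Longrightarrow> v 1 = cg g \<Longrightarrow> 0 < v 0 \<Longrightarrow>
     \<forall>x\<in>set g. \<forall>y\<in>set (snd x). snd y < v 0 \<Longrightarrow> unsat R g"
    and "concl r = T2 3 (PV 0) (PV 1)"
  shows "sound R r"
  unfolding sound_def
proof (intro allI impI)
  fix v assume "\<forall>p\<in>set (prems r). meaning R (pev v p)" "side X r v"
  then have "mRF R (pr (v 0) (v 1))" by (intro mRF_I) (rule assms(1))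
  then show "meaning R (pev v (concl r))" by (simp add: assms(2))
qed


lemma sound_clash: "sound R r_clash"
proof (rule sound_rf_step)
  fix g v assume *: "\<forall>p\<in>set (prems r_clash). meaning R (pev v p)" "v 1 = cg g"
  then have 1: "mMB (pr (pr (pr 0 (pr (v 2) (pr (of_bool True) (v 3)))) (v 4)) (cg g))"
    "mMB (pr (pr (pr 0 (pr (v 2) (pr (of_bool False) (v 5)))) (v 6)) (cg g))"
    "mML (pr (v 4) (pr (v 3) (v 7)))" "mML (pr (v 6) (pr (v 5) (v 7)))"
    by (simp_all add: r_defs)
  obtain e "is" where a: "(Lit (v 2) True is, e) \<in> set g" "v 3 = lc is" "v 4 = ce e"
    using mMB_D[OF 1(1)] by (auto simp: code_Lit simp del: of_bool_eq)
  obtain e' js where b: "(Lit (v 2) False js, e') \<in> set g" "v 5 = lc js" "v 6 = ce e'"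
    using mMB_D[OF 1(2)] by (auto simp: code_Lit simp del: of_bool_eq)
  have "lc (map (lk e) is) = lc (map (lk e') js)"
    using 1(3,4) a b unfolding mML_def by (metis (no_types))
  then have eq: "map (lk e) is = map (lk e') js" by (simp add: lc_inj)
  show "unsat R g"
    unfolding unsat_def
  proof
    assume "\<exists>v. \<forall>x\<in>set g. sem R (fst x) (\<lambda>i. v (lk (snd x) i))"
    then obtain w where w: "\<forall>x\<in>set g. sem R (fst x) (\<lambda>i. w (lk (snd x) i))" by blast
    have "R (v 2) (map w (map (lk e) is))" "\<not> R (v 2) (map w (map (lk e') js))"
      using bspec[OF w a(1)] bspec[OF w b(1)] by (simp_all add: comp_def)
    then show False using eq by simp
  qed
qed (simp add: r_defs)

lemma unsatD: "unsat R g \<Longrightarrow> \<exists>x\<in>set g. \<not> sem R (fst x) (\<lambda>i. v (lk (snd x) i))"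
  unfolding unsat_def by blast

lemma sound_conj: "sound R r_conj"
proof (rule sound_rf_step)
  fix g v assume *: "\<forall>p\<in>set (prems r_conj). meaning R (pev v p)" "v 1 = cg g" "0 < v 0"
    "\<forall>x\<in>set g. \<forall>y\<in>set (snd x). snd y < v 0"
  then have 1: "mMB (pr (pr (pr (Suc 0) (pr (v 2) (v 3))) (v 4)) (cg g))"
    "mRF R (pr (v 0) (Suc (pr (pr (v 2) (v 4)) (Suc (pr (pr (v 3) (v 4)) (cg g))))))"
    by (simp_all add: r_defs)
  obtain e a b where a: "(Bin True a b, e) \<in> set g" "v 2 = code a" "v 3 = code b" "v 4 = ce e"
    using mMB_D[OF 1(1)] by (auto simp: code_Bin)
  have "mRF R (pr (v 0) (cg ((a, e) # (b, e) # g)))" using 1(2) a by simp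
  from mRF_D[OF this *(3)] have u: "unsat R ((a, e) # (b, e) # g)" using *(4) a(1) by auto
  show "unsat R g"
    unfolding unsat_def
  proof
    assume "\<exists>v. \<forall>x\<in>set g. sem R (fst x) (\<lambda>i. v (lk (snd x) i))"
    then obtain w where w: "\<forall>x\<in>set g. sem R (fst x) (\<lambda>i. w (lk (snd x) i))" by blast
    from bspec[OF w a(1)] unsatD[OF u, of w] w show False by auto
  qed
qed (simp add: r_defs)

lemma sound_disj: "sound R r_disj"
proof (rule sound_rf_step)
  fix g v assume *: "\<forall>p\<in>set (prems r_disj). meaning R (pev v p)" "v 1 = cg g" "0 < v 0"
    "\<forall>x\<in>set g. \<forall>y\<in>set (snd x). snd y < v 0"
  then have 1: "mMB (pr (pr (pr 2 (pr (v 2) (v 3))) (v 4)) (cg g))"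
    "mRF R (pr (v 0) (Suc (pr (pr (v 2) (v 4)) (cg g))))" "mRF R (pr (v 0) (Suc (pr (pr (v 3) (v 4)) (cg g))))"
    by (simp_all add: r_defs)
  obtain e a b where a: "(Bin False a b, e) \<in> set g" "v 2 = code a" "v 3 = code b" "v 4 = ce e"
    using mMB_D[OF 1(1)] by (auto simp: code_Bin)
  have "mRF R (pr (v 0) (cg ((a, e) # g)))" "mRF R (pr (v 0) (cg ((b, e) # g)))" using 1(2,3) a by simp_all
  from this[THEN mRF_D[OF _ *(3)]] have u: "unsat R ((a, e) # g)" "unsat R ((b, e) # g)" using *(4) a(1) by auto
  show "unsat R g"
    unfolding unsat_def
  proof
    assume "\<exists>v. \<forall>x\<in>set g. sem R (fst x) (\<lambda>i. v (lk (snd x) i))"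
    then obtain w where w: "\<forall>x\<in>set g. sem R (fst x) (\<lambda>i. w (lk (snd x) i))" by blast
    from bspec[OF w a(1)] unsatD[OF u(1), of w] unsatD[OF u(2), of w] w show False by auto
  qed
qed (simp add: r_defs)

lemma sound_all: "sound R r_all"
proof (rule sound_rf_step)
  fix g v assume *: "\<forall>p\<in>set (prems r_all). meaning R (pev v p)" "v 1 = cg g" "0 < v 0"
    "\<forall>x\<in>set g. \<forall>y\<in>set (snd x). snd y < v 0"
  then have 1: "mMB (pr (pr (pr 4 (pr (v 2) (v 3))) (v 4)) (cg g))" "mLT (pr (v 5) (v 0))"
    "mRF R (pr (v 0) (Suc (pr (pr (v 3) (Suc (pr (pr (v 2) (v 5)) (v 4)))) (cg g))))"
    by (simp_all add: r_defs)
  obtain e a where a: "(Qu False (v 2) a, e) \<in> set g" "v 3 = code a" "v 4 = ce e"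
    using mMB_D[OF 1(1)] by (auto simp: code_Qu)
  have "v 5 < v 0" using 1(2) by (simp add: mLT_def)
  have "mRF R (pr (v 0) (cg ((a, (v 2, v 5) # e) # g)))" using 1(3) a by simp
  from mRF_D[OF this *(3)] have u: "unsat R ((a, (v 2, v 5) # e) # g)" using *(4) a(1) \<open>v 5 < v 0\<close> by auto
  show "unsat R g"
    unfolding unsat_def
  proof
    assume "\<exists>v. \<forall>x\<in>set g. sem R (fst x) (\<lambda>i. v (lk (snd x) i))"
    then obtain w where w: "\<forall>x\<in>set g. sem R (fst x) (\<lambda>i. w (lk (snd x) i))" by blast
    have "sem R a (\<lambda>i. w (lk ((v 2, v 5) # e) i))"
      using bspec[OF w a(1)] unfolding lk_Cons_upd by simp
    with unsatD[OF u, of w] w show False by auto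
  qed
qed (simp add: r_defs)

lemma sound_ex: "sound R r_ex"
proof (rule sound_rf_step)
  fix g v assume *: "\<forall>p\<in>set (prems r_ex). meaning R (pev v p)" "v 1 = cg g" "0 < v 0"
    "\<forall>x\<in>set g. \<forall>y\<in>set (snd x). snd y < v 0"
  then have 1: "mMB (pr (pr (pr 3 (pr (v 2) (v 3))) (v 4)) (cg g))"
    "mRF R (pr (Suc (v 0)) (Suc (pr (pr (v 3) (Suc (pr (pr (v 2) (v 0)) (v 4)))) (cg g))))"
    by (simp_all add: r_defs)
  obtain e a where a: "(Qu True (v 2) a, e) \<in> set g" "v 3 = code a" "v 4 = ce e"
    using mMB_D[OF 1(1)] by (auto simp: code_Qu)
  have "mRF R (pr (Suc (v 0)) (cg ((a, (v 2, v 0) # e) # g)))" using 1(2) a by simp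
  from mRF_D[OF this] have u: "unsat R ((a, (v 2, v 0) # e) # g)"
    using *(4) a(1) by (fastforce intro: less_SucI)
  show "unsat R g"
    unfolding unsat_def
  proof
    assume "\<exists>v. \<forall>x\<in>set g. sem R (fst x) (\<lambda>i. v (lk (snd x) i))"
    then obtain w where w: "\<forall>x\<in>set g. sem R (fst x) (\<lambda>i. w (lk (snd x) i))" by blast
    obtain b where b: "sem R a ((\<lambda>i. w (lk e i))(v 2 := b))" using bspec[OF w a(1)] by auto
    \<comment> \<open>All constants of the sequent, including the default 0, are below
      \<open>v 0\<close>; reassigning \<open>v 0\<close> to the witness does not affect the old
      formulae.\<close>
    let ?w = "w(v 0 := b)"
    have old: "?w (lk (snd x) i) = w (lk (snd x) i)" if "x \<in> set g" for x i
    proof -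
      have "lk (snd x) i < v 0" using *(3,4) that by (intro lk_less) auto
      then show ?thesis by simp
    qed
    have "(\<lambda>i. ?w (lk ((v 2, v 0) # e) i)) = (\<lambda>i. w (lk e i))(v 2 := b)"
      unfolding lk_Cons_upd using old[OF a(1)] by auto
    with b have "sem R a (\<lambda>i. ?w (lk ((v 2, v 0) # e) i))" by simp
    moreover have "sem R (fst x) (\<lambda>i. ?w (lk (snd x) i))" if "x \<in> set g" for x
      using w that old[OF that] by simp
    ultimately show False using unsatD[OF u, of ?w] by (auto simp del: lk.simps fun_upd_apply)
  qed
qed (simp add: r_defs)

lemma sound_up: "sound R (r_up b)"
proof (rule sound_rf_step)
  fix g v assume *: "\<forall>p\<in>set (prems (r_up b)). meaning R (pev v p)" "v 1 = cg g" "0 < v 0"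
    "\<forall>x\<in>set g. \<forall>y\<in>set (snd x). snd y < v 0"
  then have 1: "mMB (pr (pr (pr (if b then 5 else 6) (v 2)) (v 3)) (cg g))"
    "mRF R (pr (v 0) (Suc (pr (pr (v 2) (v 3)) (cg g))))"
    by (simp_all add: r_defs)
  obtain e a where a: "(Up b a, e) \<in> set g" "v 2 = code a" "v 3 = ce e"
    using mMB_D[OF 1(1)] by (auto simp: code_Up split: if_splits)
  have "mRF R (pr (v 0) (cg ((a, e) # g)))" using 1(2) a by simp
  from mRF_D[OF this *(3)] have u: "unsat R ((a, e) # g)" using *(4) a(1) by auto
  show "unsat R g"
    unfolding unsat_def
  proof
    assume "\<exists>v. \<forall>x\<in>set g. sem R (fst x) (\<lambda>i. v (lk (snd x) i))"
    then obtain w where w: "\<forall>x\<in>set g. sem R (fst x) (\<lambda>i. w (lk (snd x) i))" by blast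
    from bspec[OF w a(1)] unsatD[OF u, of w] w show False by auto
  qed
qed (simp add: r_defs)

lemma sound_bump: "sound R r_bump"
proof (rule sound_rf_step)
  fix g v assume *: "\<forall>p\<in>set (prems r_bump). meaning R (pev v p)" "v 1 = cg g"
    "\<forall>x\<in>set g. \<forall>y\<in>set (snd x). snd y < v 0"
  then have "mRF R (pr (Suc (v 0)) (cg g))" by (simp add: r_defs)
  from mRF_D[OF this] show "unsat R g" using *(3) by (fastforce intro: less_SucI)
qed (simp add: r_defs)

lemma sound_ax:
  assumes "\<And>c e. cwf True M 0 c \<Longrightarrow> X (code c) \<Longrightarrow> sem R c e"
  shows "sound R (r_ax M)"
proof (rule sound_rf_step)
  fix g v assume *: "\<forall>p\<in>set (prems (r_ax M)). meaning R (pev v p)" "side X (r_ax M) v" "v 1 = cg g" "0 < v 0"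
    "\<forall>x\<in>set g. \<forall>y\<in>set (snd x). snd y < v 0"
  then have 1: "mWF (pr (of_bool True) (pr M (pr 0 (v 2))))" "mRF R (pr (v 0) (Suc (pr (pr (v 2) 0) (cg g))))" "X (v 2)"
    by (simp_all add: r_defs side_def)
  obtain c where c: "v 2 = code c" "cwf True M 0 c" using mWF_D[OF 1(1)] by blast
  have "mRF R (pr (v 0) (cg ((c, []) # g)))" using 1(2) c by simp
  from mRF_D[OF this *(4)] have u: "unsat R ((c, []) # g)" using *(5) by auto
  show "unsat R g"
    unfolding unsat_def
  proof
    assume "\<exists>v. \<forall>x\<in>set g. sem R (fst x) (\<lambda>i. v (lk (snd x) i))"
    then obtain w where w: "\<forall>x\<in>set g. sem R (fst x) (\<lambda>i. w (lk (snd x) i))" by blast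
    from assms[OF c(2)] 1(3) c(1) unsatD[OF u, of w] w show False by auto
  qed
qed (simp add: r_defs)

lemma sound_prog:
  assumes "\<And>c e. cwf True M 0 c \<Longrightarrow> X (code c) \<Longrightarrow> sem R c e" "r \<in> set prog"
  shows "sound R r"
  using assms(2) unfolding prog_def
  by (auto simp: sound_lk sound_ml sound_mb sound_lt sound_wf sound_nm sound_go sound_clash sound_conj sound_disj
      sound_ex sound_all sound_up sound_bump sound_ax[OF assms(1)] intro: sound_wf_lit)

theorem refutation_sound:
  assumes "\<And>c e. cwf True M 0 c \<Longrightarrow> X (code c) \<Longrightarrow> sem R c e" "hp (pr 7 (pr (code c) p))"
  shows "\<not> sem R (at_num c p) (\<lambda>_. a)"
proof -
  have "meaning R x" if "hp x" for x
    using that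
  proof (induction rule: horn.induct)
    case (horn r v)
    have "sound R r" by (rule sound_prog[OF assms(1) horn.hyps(1)])
    then show ?case using horn.IH horn.hyps(2) unfolding sound_def by blast
  qed
  from this[OF assms(2)] show ?thesis by (simp add: mGO_def)
qed

end

section \<open>Completeness of the tableau calculus\<close>

instance cf :: countable by countable_datatype

text \<open>The closure conditions of a Hintikka set. The number k singles out one instance of a
  universal formula, so that each instance is a task of its own.\<close>

primrec handled :: "(cf \<times> (nat \<times> nat) list) set \<Rightarrow> nat \<Rightarrow> (nat \<times> nat) list \<Rightarrow> cf \<Rightarrow> bool" where
  "handled A k e (Lit q b is) \<longleftrightarrow> True"
| "handled A k e (Bin t a b) \<longleftrightarrow> (if t then (a, e) \<in> A \<and> (b, e) \<in> A else (a, e) \<in> A \<or> (b, e) \<in> A)"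
| "handled A k e (Qu t i a) \<longleftrightarrow> (if t then \<exists>m. (a, (i, m) # e) \<in> A else (a, (i, k) # e) \<in> A)"
| "handled A k e (Up t a) \<longleftrightarrow> (a, e) \<in> A"

lemma handled_mono: "handled A k e c \<Longrightarrow> A \<subseteq> B \<Longrightarrow> handled B k e c"
  by (cases c) (auto split: if_splits)

context refutation
begin

lemma hornI:
  assumes "r \<in> set prog" "\<forall>p\<in>set (prems r). hp (pev ((!) vs) p)" "side X r ((!) vs)" "pev ((!) vs) (concl r) = z"
  shows "hp z"
  using horn.horn[of r prog X "(!) vs"] assms by auto

lemma prog_rules: "r_lk1 \<in> set prog" "r_lk2 \<in> set prog" "r_lk3 \<in> set prog" "r_ml1 \<in> set prog" "r_ml2 \<in> set prog"
  "r_mb1 \<in> set prog" "r_mb2 \<in> set prog" "r_lt1 \<in> set prog" "r_lt2 \<in> set prog" "r_wf_up b \<in> set prog"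
  "r_wf_bin b \<in> set prog" "r_wf_qu b \<in> set prog" "r_nm1 cz \<in> set prog" "r_nm2 cs ceq \<in> set prog" "r_go \<in> set prog"
  "r_clash \<in> set prog" "r_conj \<in> set prog" "r_disj \<in> set prog" "r_ex \<in> set prog" "r_all \<in> set prog"
  "r_up b \<in> set prog" "r_bump \<in> set prog" "r_ax M \<in> set prog" "q < na \<Longrightarrow> r_wf_lit q (arq q) b \<in> set prog"
  by (cases b; simp add: prog_def)+

lemma horn_lk: "hp (pr 0 (pr (ce e) (pr i (lk e i))))"
proof (induction e)
  case Nil
  show ?case by (rule hornI[OF prog_rules(3), of "[i]"]) (simp_all add: r_defs side_def)
next
  case (Cons x e)
  show ?case
  proof (cases "i = fst x")
    case True
    show ?thesis
      by (rule hornI[OF prog_rules(1), of "[ce e, i, snd x]"]) (simp_all add: r_defs side_def True numeral_eq_Suc)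
  next
    case False
    show ?thesis
      by (rule hornI[OF prog_rules(2), of "[ce e, i, lk e i, fst x, snd x]"])
        (use Cons False in \<open>simp_all add: r_defs side_def numeral_eq_Suc\<close>)
  qed
qed

lemma horn_ml: "hp (pr (Suc 0) (pr (ce e) (pr (lc is) (lc (map (lk e) is)))))"
proof (induction "is")
  case Nil
  show ?case by (rule hornI[OF prog_rules(4), of "[ce e]"]) (simp_all add: r_defs side_def)
next
  case (Cons i "is")
  show ?case
    by (rule hornI[OF prog_rules(5), of "[ce e, i, lc is, lk e i, lc (map (lk e) is)]"])
      (use Cons horn_lk[of e i] in \<open>simp_all add: r_defs side_def numeral_eq_Suc\<close>)
qed

lemma horn_mb: "(c, e) \<in> set g \<Longrightarrow> hp (pr 2 (pr (pr (code c) (ce e)) (cg g)))"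
proof (induction g)
  case (Cons x g)
  show ?case
  proof (cases "x = (c, e)")
    case True
    show ?thesis
      by (rule hornI[OF prog_rules(6), of "[pr (code c) (ce e), cg g]"]) (simp_all add: r_defs side_def True)
  next
    case False
    then have "hp (pr 2 (pr (pr (code c) (ce e)) (cg g)))" using Cons by auto
    then show ?thesis
      by (intro hornI[OF prog_rules(7), of "[pr (code c) (ce e), cg g, pr (code (fst x)) (ce (snd x))]"])
        (simp_all add: r_defs side_def)
  qed
qed simp

lemma horn_lt: "a < b \<Longrightarrow> hp (pr 4 (pr a b))"
proof (induction b)
  case (Suc b)
  show ?case
  proof (cases "a = b")
    case True
    show ?thesis by (rule hornI[OF prog_rules(8), of "[a]"]) (simp_all add: r_defs side_def True)
  next
    case False
    then have "hp (pr 4 (pr a b))" using Suc by simp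
    then show ?thesis by (intro hornI[OF prog_rules(9), of "[a, b]"]) (simp_all add: r_defs side_def)
  qed
qed simp

lemma horn_wf: "cwf s m d c \<Longrightarrow> hp (pr 5 (pr (of_bool s) (pr m (pr d (code c)))))"
proof (induction rule: cwf.induct)
  case (1 q "is" d s b)
  let ?vs = "of_bool s # d # is"
  have "map ((!) ?vs) [2..<2 + arq q] = is"
    using 1(2) by (intro nth_equalityI) (simp_all del: upt_Suc)
  moreover have "hp (pr 4 (pr (?vs ! i) d))" if "i \<in> set [2..<2 + arq q]" for i
  proof -
    have "2 \<le> i" "i < 2 + arq q" using that by (simp_all del: upt_Suc)
    then obtain j where "i = 2 + j" "j < length is" using 1(2) by (metis le_iff_add nat_add_left_cancel_less)
    then have "?vs ! i \<in> set is" by simp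
    then show ?thesis using 1(3) horn_lt by blast
  qed
  ultimately show ?case
    by (intro hornI[OF prog_rules(24)[OF 1(1)], where vs = ?vs])
      (simp_all add: r_wf_lit_def side_def pev_list del: upt_Suc)
next
  case (2 b m d c s)
  show ?case
    by (rule hornI[OF prog_rules(10)[of b], of "[of_bool s, m, d, code c]"])
      (use 2 in \<open>simp_all add: r_defs side_def numeral_eq_Suc\<close>)
next
  case (3 s m d a b t)
  show ?case
    by (rule hornI[OF prog_rules(11)[of t], of "[of_bool s, m, d, code a, code b]"])
      (use 3 in \<open>simp_all add: r_defs side_def numeral_eq_Suc\<close>)
next
  case (4 s m d a)
  \<comment> \<open>Variable 0 does not occur in this rule; the first entry of the list is a
    placeholder.\<close>
  show ?case
    by (rule hornI[OF prog_rules(12)[of s], of "[0, m, d, code a]"])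
      (use 4 in \<open>simp_all add: r_defs side_def numeral_eq_Suc\<close>)
qed

lemma horn_nm: "hp (pr 6 (pr p (code (num_cf p))))"
proof (induction p)
  case 0
  show ?case by (rule hornI[OF prog_rules(13), of "[]"]) (simp_all add: r_defs side_def)
next
  case (Suc p)
  show ?case
    by (rule hornI[OF prog_rules(14), of "[p, code (num_cf p)]"]) (use Suc in \<open>simp_all add: r_defs side_def\<close>)
qed

definition RF :: "nat \<Rightarrow> (cf \<times> (nat \<times> nat) list) list \<Rightarrow> bool" where
  "RF n g \<longleftrightarrow> hp (pr 3 (pr n (cg g)))"

lemma horn_go:
  assumes "RF 1 [(at_num c p, [])]"
  shows "hp (pr 7 (pr (code c) p))"
  by (rule hornI[OF prog_rules(15), of "[code c, p, code (num_cf p)]"])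
    (use assms horn_nm[of p] in \<open>simp_all add: RF_def r_defs side_def at_num_def numeral_eq_Suc\<close>)

lemma RF_clash:
  assumes "(Lit q True is, e) \<in> set g" "(Lit q False js, e') \<in> set g" "map (lk e) is = map (lk e') js"
  shows "RF n g"
  unfolding RF_def
  by (rule hornI[OF prog_rules(16), of "[n, cg g, q, lc is, ce e, lc js, ce e', lc (map (lk e) is)]"])
    (use horn_mb[OF assms(1)] horn_mb[OF assms(2)] horn_ml[of e "is"] horn_ml[of e' js] assms(3)
      in \<open>simp_all add: r_defs side_def numeral_eq_Suc\<close>)

lemma RF_conj:
  assumes "(Bin True a b, e) \<in> set g" "RF n ((a, e) # (b, e) # g)"
  shows "RF n g"
  unfolding RF_def
  by (rule hornI[OF prog_rules(17), of "[n, cg g, code a, code b, ce e]"])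
    (use horn_mb[OF assms(1)] assms(2) in \<open>simp_all add: RF_def r_defs side_def numeral_eq_Suc\<close>)

lemma RF_disj:
  assumes "(Bin False a b, e) \<in> set g" "RF n ((a, e) # g)" "RF n ((b, e) # g)"
  shows "RF n g"
  unfolding RF_def
  by (rule hornI[OF prog_rules(18), of "[n, cg g, code a, code b, ce e]"])
    (use horn_mb[OF assms(1)] assms(2,3) in \<open>simp_all add: RF_def r_defs side_def numeral_eq_Suc\<close>)

lemma RF_ex:
  assumes "(Qu True i a, e) \<in> set g" "RF (Suc n) ((a, (i, n) # e) # g)"
  shows "RF n g"
  unfolding RF_def
  by (rule hornI[OF prog_rules(19), of "[n, cg g, i, code a, ce e]"])
    (use horn_mb[OF assms(1)] assms(2) in \<open>simp_all add: RF_def r_defs side_def numeral_eq_Suc\<close>)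

lemma RF_all:
  assumes "(Qu False i a, e) \<in> set g" "k < n" "RF n ((a, (i, k) # e) # g)"
  shows "RF n g"
  unfolding RF_def
  by (rule hornI[OF prog_rules(20), of "[n, cg g, i, code a, ce e, k]"])
    (use horn_mb[OF assms(1)] horn_lt[OF assms(2)] assms(3) in \<open>simp_all add: RF_def r_defs side_def numeral_eq_Suc\<close>)

lemma RF_up:
  assumes "(Up b a, e) \<in> set g" "RF n ((a, e) # g)"
  shows "RF n g"
  unfolding RF_def
  by (rule hornI[OF prog_rules(21)[of b], of "[n, cg g, code a, ce e]"])
    (use horn_mb[OF assms(1)] assms(2) in \<open>simp_all add: RF_def r_defs side_def numeral_eq_Suc\<close>)

lemma RF_bump: "RF (Suc n) g \<Longrightarrow> RF n g"
  unfolding RF_def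
  by (rule hornI[OF prog_rules(22), of "[n, cg g]"]) (simp_all add: RF_def r_defs side_def)

lemma RF_le: "n \<le> n' \<Longrightarrow> RF n' g \<Longrightarrow> RF n g"
  by (induction n' rule: dec_induct) (auto intro: RF_bump)

lemma RF_ax:
  assumes "cwf True M 0 c" "X (code c)" "RF n ((c, []) # g)"
  shows "RF n g"
  unfolding RF_def
  by (rule hornI[OF prog_rules(23), of "[n, cg g, code c]"])
    (use horn_wf[OF assms(1)] assms(2,3) in \<open>simp_all add: RF_def r_defs side_def numeral_eq_Suc\<close>)

lemma handle_step:
  assumes "\<not> RF n g" "(c, e) \<in> set g"
  shows "\<exists>n' g'. \<not> RF n' g' \<and> set g \<subseteq> set g' \<and> handled (set g') k e c"
proof (cases c)
  case (Lit q b "is")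
  then show ?thesis using assms by (intro exI[of _ n] exI[of _ g]) simp
next
  case (Bin t a b)
  show ?thesis
  proof (cases t)
    case True
    then have "\<not> RF n ((a, e) # (b, e) # g)" using assms RF_conj[of a b e g n] Bin by auto
    then show ?thesis using Bin True by (intro exI[of _ n] exI[of _ "(a, e) # (b, e) # g"]) auto
  next
    case False
    then have "\<not> RF n ((a, e) # g) \<or> \<not> RF n ((b, e) # g)" using assms RF_disj[of a b e g n] Bin by auto
    then obtain x where "x = a \<or> x = b" "\<not> RF n ((x, e) # g)" by blast
    then show ?thesis using Bin False by (intro exI[of _ n] exI[of _ "(x, e) # g"]) auto
  qed
next
  case (Qu t i a)
  show ?thesis
  proof (cases t)
    case True
    then have "\<not> RF (Suc n) ((a, (i, n) # e) # g)" using assms RF_ex[of i a e g n] Qu by auto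
    then show ?thesis using Qu True by (intro exI[of _ "Suc n"] exI[of _ "(a, (i, n) # e) # g"]) auto
  next
    case False
    \<comment> \<open>Every natural number will be an element of the countermodel, so the bound is
      first raised above k to permit this instance.\<close>
    let ?n = "max n (Suc k)"
    have "\<not> RF ?n g" using assms(1) RF_le[of n ?n g] by auto
    then have "\<not> RF ?n ((a, (i, k) # e) # g)" using assms RF_all[of i a e g k ?n, OF _ max.strict_coboundedI2[OF lessI]] Qu False by auto
    then show ?thesis using Qu False by (intro exI[of _ ?n] exI[of _ "(a, (i, k) # e) # g"]) auto
  qed
next
  case (Up b a)
  then have "\<not> RF n ((a, e) # g)" using assms RF_up by blast
  then show ?thesis using Up by (intro exI[of _ n] exI[of _ "(a, e) # g"]) auto
qed

lemma task_step:
  assumes "\<not> RF n g"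
  shows "\<exists>n' g'. \<not> RF n' g' \<and> set g \<subseteq> set g' \<and> ((c, e) \<in> set g \<longrightarrow> handled (set g') k e c) \<and>
    (cwf True M 0 c \<longrightarrow> X (code c) \<longrightarrow> (c, []) \<in> set g')"
proof -
  obtain n1 g1 where 1: "\<not> RF n1 g1" "set g \<subseteq> set g1" "(c, e) \<in> set g \<longrightarrow> handled (set g1) k e c"
    using handle_step[OF assms, of c e k] assms by (cases "(c, e) \<in> set g") auto
  show ?thesis
  proof (cases "cwf True M 0 c \<and> X (code c)")
    case True
    then have "\<not> RF n1 ((c, []) # g1)" using RF_ax 1(1) by blast
    then show ?thesis using 1 handled_mono[of "set g1" k e c "set ((c, []) # g1)"]
      by (intro exI[of _ n1] exI[of _ "(c, []) # g1"]) auto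
  next
    case False
    then show ?thesis using 1 by blast
  qed
qed

text \<open>An unclosed tableau is extended forever along one branch, with all tasks dealt with in
  turn; the branch stays free of clashes because two literals already occur together at some finite
  stage.\<close>

lemma hintikka_set:
  assumes "\<not> RF n g"
  shows "\<exists>A. set g \<subseteq> A \<and> (\<forall>c e k. (c, e) \<in> A \<longrightarrow> handled A k e c) \<and>
    (\<forall>c. cwf True M 0 c \<longrightarrow> X (code c) \<longrightarrow> (c, []) \<in> A) \<and>
    (\<forall>q is e js e'. (Lit q True is, e) \<in> A \<longrightarrow> (Lit q False js, e') \<in> A \<longrightarrow> map (lk e) is \<noteq> map (lk e') js)"
proof -
  \<comment> \<open>The second component of the decoded pair is ignored, so that every task recurs
    infinitely often and also reaches formulae that enter the branch late.\<close>
  define task :: "nat \<Rightarrow> (cf \<times> (nat \<times> nat) list) \<times> nat" where "task j = from_nat (fst (prod_decode j))" for j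
  let ?Q = "\<lambda>j s s'. set (snd s) \<subseteq> set (snd s') \<and>
     (fst (task j) \<in> set (snd s) \<longrightarrow> handled (set (snd s')) (snd (task j)) (snd (fst (task j))) (fst (fst (task j)))) \<and>
     (cwf True M 0 (fst (fst (task j))) \<longrightarrow> X (code (fst (fst (task j)))) \<longrightarrow> (fst (fst (task j)), []) \<in> set (snd s'))"
  let ?P = "\<lambda>j :: nat. \<lambda>s. \<not> RF (fst s) (snd s) \<and> set g \<subseteq> set (snd s)"
  have "\<exists>G. \<forall>j. ?P j (G j) \<and> ?Q j (G j) (G (Suc j))"
  proof (rule dependent_nat_choice)
    show "\<exists>s. ?P 0 s" using assms by (intro exI[of _ "(n, g)"]) simp
    fix s j assume s: "?P j s"
    obtain c e k where t: "task j = ((c, e), k)" by (metis prod.exhaust)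
    from task_step[of "fst s" "snd s" c e k] s obtain n' g' where
      "\<not> RF n' g'" "set (snd s) \<subseteq> set g'" "(c, e) \<in> set (snd s) \<longrightarrow> handled (set g') k e c"
      "cwf True M 0 c \<longrightarrow> X (code c) \<longrightarrow> (c, []) \<in> set g'" by blast
    then show "\<exists>s'. ?P (Suc j) s' \<and> ?Q j s s'" using s t by (intro exI[of _ "(n', g')"]) auto
  qed
  then obtain G where G: "\<forall>j. ?P j (G j) \<and> ?Q j (G j) (G (Suc j))" ..
  have P: "?P j (G j)" and Q: "?Q j (G j) (G (Suc j))" for j using G[rule_format, of j] by blast+
  define A where "A = (\<Union>j. set (snd (G j)))"
  have mono: "set (snd (G i)) \<subseteq> set (snd (G j))" if "i \<le> j" for i j
    using that by (rule lift_Suc_mono_le[rotated]) (use Q in blast)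
  have sub: "set (snd (G j)) \<subseteq> A" for j by (auto simp: A_def)
  have task_at: "task (prod_encode (to_nat t, i)) = t" for t i by (simp add: task_def)
  show ?thesis
  proof (intro exI[of _ A] conjI allI impI)
    show "set g \<subseteq> A" using P[of 0] sub[of 0] by blast
  next
    fix c e and k :: nat assume "(c, e) \<in> A"
    then obtain i where i: "(c, e) \<in> set (snd (G i))" by (auto simp: A_def)
    \<comment> \<open>This stage is devoted to the given task and comes no earlier than stage i, at
      which the formula is already present.\<close>
    define j where "j = prod_encode (to_nat ((c, e), k), i)"
    have "(c, e) \<in> set (snd (G j))" using i mono[of i j] le_prod_encode_2 by (auto simp: j_def)
    then have "handled (set (snd (G (Suc j)))) k e c"
      using Q[of j] task_at[of "((c, e), k)" i] by (simp add: j_def)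
    then show "handled A k e c" using sub handled_mono by blast
  next
    fix c assume "cwf True M 0 c" "X (code c)"
    then have "(c, []) \<in> set (snd (G (Suc (prod_encode (to_nat ((c, [] :: (nat \<times> nat) list), 0 :: nat), 0)))))"
      using Q[of "prod_encode (to_nat ((c, [] :: (nat \<times> nat) list), 0 :: nat), 0)"] task_at[of "((c, []), 0)" 0] by simp
    then show "(c, []) \<in> A" using sub by blast
  next
    fix q "is" e js e' assume "(Lit q True is, e) \<in> A" "(Lit q False js, e') \<in> A"
    then obtain i j where "(Lit q True is, e) \<in> set (snd (G i))" "(Lit q False js, e') \<in> set (snd (G j))"
      by (auto simp: A_def)
    then have "(Lit q True is, e) \<in> set (snd (G (max i j)))" "(Lit q False js, e') \<in> set (snd (G (max i j)))"
      using mono[of i "max i j"] mono[of j "max i j"] by auto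
    then show "map (lk e) is \<noteq> map (lk e') js" using RF_clash P[of "max i j"] by blast
  qed
qed

theorem refutation_complete:
  assumes "\<not> hp (pr 7 (pr (code c) p))"
  shows "\<exists>R :: nat \<Rightarrow> nat list \<Rightarrow> bool. sem R (at_num c p) (\<lambda>_. 0) \<and>
    (\<forall>c. cwf True M 0 c \<longrightarrow> X (code c) \<longrightarrow> sem R c (\<lambda>_. 0))"
proof -
  have "\<not> RF 1 [(at_num c p, [])]" using assms horn_go by blast
  from hintikka_set[OF this] obtain A where A: "(at_num c p, []) \<in> A"
    "\<And>c e k. (c, e) \<in> A \<Longrightarrow> handled A k e c" "\<And>c. cwf True M 0 c \<Longrightarrow> X (code c) \<Longrightarrow> (c, []) \<in> A"
    "\<And>q is e js e'. (Lit q True is, e) \<in> A \<Longrightarrow> (Lit q False js, e') \<in> A \<Longrightarrow> map (lk e) is \<noteq> map (lk e') js"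
    by auto
  \<comment> \<open>An atom is true only if a positive literal of A says so; freedom from clashes
    then makes the negative literals of A true as well.\<close>
  define R where "R q as \<longleftrightarrow> (\<exists>is e. (Lit q True is, e) \<in> A \<and> map (lk e) is = as)" for q as
  have upd: "(lk e)(i := k) = lk ((i, k) # e)" for e i k by auto
  have "sem R c (lk e)" if "(c, e) \<in> A" for c e
    using that
  proof (induction c arbitrary: e)
    case (Lit q b "is")
    show ?case
    proof (cases b)
      case True
      then show ?thesis using Lit by (auto simp: R_def)
    next
      case False
      then have "\<not> R q (map (lk e) is)" using Lit A(4) unfolding R_def by metis
      then show ?thesis using False by simp
    qed
  next
    case (Bin t a b)
    then show ?case using A(2)[OF Bin.prems] by (auto split: if_splits)
  next
    case (Qu t i a)
    show ?case
    proof (cases t)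
      case True
      then obtain m where "(a, (i, m) # e) \<in> A" using A(2)[OF Qu.prems] by auto
      from Qu.IH[OF this] have "sem R a ((lk e)(i := m))" unfolding upd .
      then show ?thesis using True by auto
    next
      case False
      have "(a, (i, k) # e) \<in> A" for k using A(2)[OF Qu.prems, of k] False by simp
      from Qu.IH[OF this] have "sem R a ((lk e)(i := k))" for k unfolding upd .
      then show ?thesis using False by simp
    qed
  next
    case (Up b a)
    then show ?case using A(2)[OF Up.prems] by auto
  qed
  moreover have "lk [] = (\<lambda>_. 0)" by auto
  ultimately show ?thesis using A(1,3) by metis
qed

end

section \<open>Incompleteness\<close>

lemma fv_rename_tm: "fv_tm (subst_tm (\<lambda>i. Var (f i)) t) \<subseteq> range f"
  by (induction t) auto

lemma fv_rename: "fv (subst (\<lambda>i. Var (f i)) \<phi>) \<subseteq> range f"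
proof (induction \<phi> arbitrary: f)
  case (Rel p ts)
  then show ?case using fv_rename_tm by fastforce
next
  case (Eq s t)
  then show ?case using fv_rename_tm by fastforce
next
  case (Forall \<phi>)
  have "subst (up_subst (\<lambda>i. Var (f i))) \<phi> = subst (\<lambda>i. Var (case_nat 0 (\<lambda>i. Suc (f i)) i)) \<phi>"
    by (rule subst_fv) (auto simp: up_subst_def split: nat.split)
  then have "fv (subst (up_subst (\<lambda>i. Var (f i))) \<phi>) \<subseteq> range (case_nat 0 (\<lambda>i. Suc (f i)))"
    using Forall[of "case_nat 0 (\<lambda>i. Suc (f i))"] by simp
  moreover have "x \<in> range f" if "Suc x \<in> range (case_nat 0 (\<lambda>i. Suc (f i)))" for x
    using that by (auto split: nat.splits)
  ultimately show ?case by auto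
next
  case (Exists \<phi>)
  have "subst (up_subst (\<lambda>i. Var (f i))) \<phi> = subst (\<lambda>i. Var (case_nat 0 (\<lambda>i. Suc (f i)) i)) \<phi>"
    by (rule subst_fv) (auto simp: up_subst_def split: nat.split)
  then have "fv (subst (up_subst (\<lambda>i. Var (f i))) \<phi>) \<subseteq> range (case_nat 0 (\<lambda>i. Suc (f i)))"
    using Exists[of "case_nat 0 (\<lambda>i. Suc (f i))"] by simp
  moreover have "x \<in> range f" if "Suc x \<in> range (case_nat 0 (\<lambda>i. Suc (f i)))" for x
    using that by (auto split: nat.splits)
  ultimately show ?case by auto
qed auto

text \<open>All variables above k are merged into k. The relation does not notice, and the resulting
  formula has its free variables in the required range.\<close>

lemma defn_fv:
  assumes "defn L S R" "\<And>e e'. (\<And>i. i \<le> k \<Longrightarrow> e i = e' i) \<Longrightarrow> R e = R e'"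
  shows "\<exists>\<phi>. in_lang L \<phi> \<and> fv \<phi> \<subseteq> {..k} \<and> (\<forall>e. sat S e \<phi> \<longleftrightarrow> R e)"
proof -
  obtain \<phi> where \<phi>: "in_lang L \<phi>" "\<And>e. sat S e \<phi> \<longleftrightarrow> R e" using assms(1) unfolding defn_def by blast
  let ?\<phi> = "subst (\<lambda>i. Var (min i k)) \<phi>"
  have "in_lang L ?\<phi>" using \<phi>(1) by (intro in_lang_subst) auto
  moreover have "fv ?\<phi> \<subseteq> {..k}" using fv_rename[of "\<lambda>i. min i k" \<phi>] by auto
  moreover have "sat S e ?\<phi> \<longleftrightarrow> R e" for e
    unfolding sat_subst \<phi>(2) by (rule assms(2)) simp
  ultimately show ?thesis by blast
qed

text \<open>The assumption \<open>bounded\<close> is the form in which completeness of T and its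
  axiomatization enter. It speaks of structures on the carrier of S, as a locale assumption cannot
  quantify over types; the surjection h brings countermodels on \<open>nat\<close> to that
  carrier.\<close>

locale bounded_model = coded_model L S I \<beta> ats
  for L :: "('f, 'p) lang" and S :: "('a, 'f, 'p) struct" and I \<beta> ats +
  fixes M :: nat and h :: "'a \<Rightarrow> nat"
  assumes h: "surj h"
    and bounded: "\<And>(K :: ('a, 'f, 'p) struct) \<psi> e.
      cong_struct K \<Longrightarrow> (\<And>c e. cwf True M 0 c \<Longrightarrow> sem (RS S) c e \<Longrightarrow> \<exists>e'. sem (RS K) c e') \<Longrightarrow>
      \<psi> \<in> sentences L \<Longrightarrow> sat K e \<psi> = sat S e \<psi>"
begin

definition zero_fm :: "('f, 'p) fm" where
  "zero_fm = (SOME \<phi>. in_lang L \<phi> \<and> fv \<phi> \<subseteq> {..0} \<and> (\<forall>e. sat S e \<phi> \<longleftrightarrow> nm (e 0) 0))"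

definition succ_fm :: "('f, 'p) fm" where
  "succ_fm = (SOME \<phi>. in_lang L \<phi> \<and> fv \<phi> \<subseteq> {..1} \<and> (\<forall>e. sat S e \<phi> \<longleftrightarrow> succM (e 0) (e 1)))"

lemma zero_fm: "in_lang L zero_fm" "fv zero_fm \<subseteq> {..0}" "sat S e zero_fm \<longleftrightarrow> nm (e 0) 0"
  using someI_ex[OF defn_fv[OF df_nm[of 0 0], of 0]] unfolding zero_fm_def by auto

lemma succ_fm: "in_lang L succ_fm" "fv succ_fm \<subseteq> {..1}" "sat S e succ_fm \<longleftrightarrow> succM (e 0) (e 1)"
  using someI_ex[OF defn_fv[OF df_succM[of 0 1], of 1]] unfolding succ_fm_def by auto

primrec num_fm :: "nat \<Rightarrow> ('f, 'p) fm" where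
  "num_fm 0 = zero_fm"
| "num_fm (Suc p) = Exists (Conj succ_fm (num_fm p))"

lemma num_fm: "in_lang L (num_fm p)" "fv (num_fm p) \<subseteq> {0}" "sat S e (num_fm p) \<longleftrightarrow> nm (e 0) p"
proof (induction p arbitrary: e)
  case 0
  { case 1 then show ?case using zero_fm by simp }
  { case 2 then show ?case using zero_fm by auto }
  { case 3 then show ?case using zero_fm by simp }
next
  case (Suc p)
  { case 1 then show ?case using Suc succ_fm by simp }
  { case 2 then show ?case using Suc succ_fm(2) by fastforce }
  { case 3
    have "sat S e (num_fm (Suc p)) \<longleftrightarrow> (\<exists>a. succM a (e 0) \<and> nm a p)" using Suc succ_fm by simp
    also have "\<dots> \<longleftrightarrow> nm (e 0) (Suc p)" using succM_nm1 nm_std[of p] by blast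
    finally show ?case . }
qed

definition represents :: "nat \<Rightarrow> ('f, 'p) fm \<Rightarrow> cf \<Rightarrow> bool" where
  "represents d \<phi> c \<longleftrightarrow> ok c \<and> (\<forall>(K :: ('a, 'f, 'p) struct) e. cong_struct K \<longrightarrow> sem (RS K) c e = sat K (lv d e) \<phi>)"

lemma represents_exists: "in_lang L \<phi> \<Longrightarrow> fv \<phi> \<subseteq> {..<d} \<Longrightarrow> \<exists>c. represents d \<phi> c"
  using repr_sat[of \<phi> d] unfolding repr_def represents_def by blast

definition "cz = (SOME c. represents 1 zero_fm c)"
definition "cs = (SOME c. represents 2 succ_fm c)"
definition "ceq = Lit qe True [0, 1]"

lemma cz: "represents 1 zero_fm cz"
proof -
  have "fv zero_fm \<subseteq> {..<1}" using zero_fm(2) by auto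
  then show ?thesis unfolding cz_def by (rule someI_ex[OF represents_exists[OF zero_fm(1)]])
qed

lemma cs: "represents 2 succ_fm cs"
proof -
  have "fv succ_fm \<subseteq> {..<2}" using succ_fm(2) by auto
  then show ?thesis unfolding cs_def by (rule someI_ex[OF represents_exists[OF succ_fm(1)]])
qed

definition true_code :: "nat \<Rightarrow> bool" where "true_code n \<longleftrightarrow> TruM M (std n)"

sublocale refutation L ats M cz cs ceq true_code
  by unfold_locales

lemma sat_fv0: "fv \<phi> \<subseteq> {0} \<Longrightarrow> e 0 = e' 0 \<Longrightarrow> sat K e \<phi> = sat K e' \<phi>"
  by (rule sat_fv) auto

lemma num_cf: "cong_struct K \<Longrightarrow> sem (RS K) (num_cf p) e \<longleftrightarrow> sat (K :: ('a, 'f, 'p) struct) (\<lambda>_. e 0) (num_fm p)"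
  and ok_num_cf: "ok (num_cf p)"
proof (induction p arbitrary: e)
  case 0
  { case 1
    then have "sem (RS K) cz e = sat K (lv 1 e) zero_fm" using cz unfolding represents_def by blast
    also have "lv 1 e = (\<lambda>_. e 0)" by (simp add: lv_def)
    finally show ?case by simp }
  { case 2 show ?case using cz by (simp add: represents_def) }
next
  case (Suc p)
  { case 1
    note K = 1
    have eq: "sem (RS K) ceq e' \<longleftrightarrow> eqr K (e' 0) (e' 1)" for e' using qe by (simp add: RS_def ceq_def)
    have "sem (RS K) cs e' = sat K (\<lambda>i. if i = 0 then e' (Suc 0) else e' 0) succ_fm" for e'
    proof -
      have "sem (RS K) cs e' = sat K (lv 2 e') succ_fm" using cs K unfolding represents_def by blast
      also have "\<dots> = sat K (\<lambda>i. if i = 0 then e' (Suc 0) else e' 0) succ_fm"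
        by (rule sat_fv) (simp add: lv_def numeral_2_eq_2)
      finally show ?thesis .
    qed
    then have "sem (RS K) (num_cf (Suc p)) e \<longleftrightarrow>
      (\<exists>a. sat K (\<lambda>i. if i = 0 then a else e 0) succ_fm \<and> (\<exists>b. eqr K b a \<and> sat K (\<lambda>_. b) (num_fm p)))"
      using Suc.IH(1)[OF K] by (simp add: eq cong: if_cong)
    also have "\<dots> \<longleftrightarrow> (\<exists>a. sat K (\<lambda>i. if i = 0 then a else e 0) succ_fm \<and> sat K (\<lambda>_. a) (num_fm p))"
      using sat_cong[OF K, of "\<lambda>_. _" "\<lambda>_. _" "num_fm p"] eqr_refl[OF K] by metis
    also have "\<dots> \<longleftrightarrow> (\<exists>a. sat K (case_nat a (\<lambda>_. e 0)) succ_fm \<and> sat K (case_nat a (\<lambda>_. e 0)) (num_fm p))"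
    proof -
      have "(\<lambda>i. if i = 0 then a else e 0) = case_nat a (\<lambda>_. e 0)" for a by (auto simp: fun_eq_iff split: nat.split)
      moreover have "sat K (\<lambda>_. a) (num_fm p) = sat K (case_nat a (\<lambda>_. e 0)) (num_fm p)" for a
        by (rule sat_fv0[OF num_fm(2)]) simp
      ultimately show ?thesis by simp
    qed
    finally show ?case by simp }
  { case 2
    have "ok ceq" using qe by (simp add: ceq_def)
    then show ?case using Suc.IH(2) cs by (simp add: represents_def) }
qed

text \<open>The language need not have terms for numerals, so p is substituted by means of a formula
  that defines it.\<close>

definition applied :: "('f, 'p) fm \<Rightarrow> nat \<Rightarrow> ('f, 'p) fm" where
  "applied \<phi> p = Exists (Conj (num_fm p) \<phi>)"

lemma applied_sentence: "in_lang L \<phi> \<Longrightarrow> fv \<phi> \<subseteq> {0} \<Longrightarrow> applied \<phi> p \<in> sentences L"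
  using num_fm(1,2)[of p] by (fastforce simp: applied_def sentences_def)

lemma sat_applied: "fv \<phi> \<subseteq> {0} \<Longrightarrow> sat S e (applied \<phi> p) \<longleftrightarrow> (\<exists>x. nm x p \<and> sat S (\<lambda>_. x) \<phi>)"
  using sat_fv0[of \<phi> "case_nat _ e" "\<lambda>_. _" S] by (simp add: applied_def num_fm(3))

lemma sem_at_num:
  assumes "cong_struct K" "represents 1 \<phi> c" "fv \<phi> \<subseteq> {0}"
  shows "sem (RS K) (at_num (Bin True eq_ax c) p) e \<longleftrightarrow> sat (K :: ('a, 'f, 'p) struct) e' (applied \<phi> p)"
proof -
  have "sem (RS K) c (e(0 := x)) = sat K (lv 1 (e(0 := x))) \<phi>" for x
    using assms unfolding represents_def by blast
  moreover have "sat K (lv 1 (e(0 := x))) \<phi> = sat K (case_nat x e') \<phi>" for x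
    by (rule sat_fv0[OF assms(3)]) (simp add: lv_def)
  moreover have "sat K (\<lambda>_. (e(0 := x)) 0) (num_fm p) = sat K (case_nat x e') (num_fm p)" for x
    by (rule sat_fv0[OF num_fm(2)]) simp
  ultimately show ?thesis
    using RS_eq_ax[OF assms(1)] num_cf[OF assms(1)] by (simp add: at_num_def applied_def)
qed

text \<open>Quantifiers agree because h is onto. Elements with the same image become
  indistinguishable, which is harmless as equality is only a congruence.\<close>

lemma sem_pullback: "sem (\<lambda>q as. R q (map h as)) c e \<longleftrightarrow> sem R c (\<lambda>i. h (e i))"
proof (induction c arbitrary: e)
  case (Qu t i c)
  have "(\<lambda>j. h ((e(i := x)) j)) = (\<lambda>j. h (e j))(i := h x)" for x by auto
  then have "sem (\<lambda>q as. R q (map h as)) c (e(i := x)) \<longleftrightarrow> sem R c ((\<lambda>j. h (e j))(i := h x))" for x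
    using Qu by simp
  moreover have quant: "(\<forall>x. P (h x)) \<longleftrightarrow> (\<forall>y. P y)" "(\<exists>x. P (h x)) \<longleftrightarrow> (\<exists>y. P y)" for P
    using h by (metis surjD)+
  ultimately show ?case
    using quant[of "\<lambda>y. sem R c ((\<lambda>j. h (e j))(i := y))"] by simp
qed (auto simp: comp_def)

text \<open>Refutations are sound because all queried sentences are true in S. Conversely, an
  irrefutable formula holds in a countermodel that satisfies the true sentences of level M; by
  \<open>bounded\<close> it agrees with S on all sentences, so the formula is true in S.\<close>

theorem refutable_iff:
  assumes "represents 1 \<phi> c" "in_lang L \<phi>" "fv \<phi> \<subseteq> {0}"
  shows "hp (pr 7 (pr (code (Bin True eq_ax c)) p)) \<longleftrightarrow> \<not> sat S e (applied \<phi> p)"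
proof
  assume hp: "hp (pr 7 (pr (code (Bin True eq_ax c)) p))"
  have "sem (RS S) c e" if "cwf True M 0 c" "true_code (code c)" for c e
    using TruM_correct[OF that(1)] that(2) unfolding true_code_def by blast
  from refutation_sound[OF this hp, of "e 0"] show "\<not> sat S e (applied \<phi> p)"
    using sem_at_num[OF cong assms(1,3), of p "\<lambda>_. e 0" e] by simp
next
  assume no: "\<not> sat S e (applied \<phi> p)"
  show "hp (pr 7 (pr (code (Bin True eq_ax c)) p))"
  proof (rule ccontr)
    assume "\<not> ?thesis"
    from refutation_complete[OF this] obtain R :: "nat \<Rightarrow> nat list \<Rightarrow> bool" where
      R: "sem R (at_num (Bin True eq_ax c) p) (\<lambda>_. 0)" "\<And>c. cwf True M 0 c \<Longrightarrow> true_code (code c) \<Longrightarrow> sem R c (\<lambda>_. 0)" by blast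
    obtain x0 where x0: "h x0 = 0" using h by (metis surjD)
    \<comment> \<open>The countermodel lives on \<open>nat\<close>, while \<open>bounded\<close>
      speaks of the carrier of S; it is therefore pulled back along h.\<close>
    define R' where "R' = (\<lambda>q as. R q (map h as))"
    have R': "sem R' c (\<lambda>_. x0) \<longleftrightarrow> sem R c (\<lambda>_. 0)" for c
      unfolding R'_def sem_pullback x0 ..
    have "sem R' (at_num (Bin True eq_ax c) p) (\<lambda>_. x0)" using R(1) R' by simp
    then obtain e0 where eq: "sem R' eq_ax e0" by (auto simp: at_num_def)
    define K where "K = struct_of R'"
    have K: "cong_struct K" unfolding K_def by (rule cong_struct_of[OF eq])
    have RS: "sem (RS K) d = sem R' d" if "ok d" for d
      by (rule ext, rule sem_ok[OF that]) (simp add: K_def RS_struct_of[OF eq])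
    have "sat K e \<psi> = sat S e \<psi>" if "\<psi> \<in> sentences L" for \<psi>
    proof (rule bounded[OF K _ that])
      fix d e assume d: "cwf True M 0 d" "sem (RS S) d e"
      then have "true_code (code d)" using TruM_correct[OF d(1)] unfolding true_code_def by blast
      from R(2)[OF d(1) this] have "sem R' d (\<lambda>_. x0)" unfolding R' .
      then show "\<exists>e'. sem (RS K) d e'" using RS[OF cwf_ok[OF d(1)]] by auto
    qed
    then have "\<not> sat K e (applied \<phi> p)" using no applied_sentence[OF assms(2,3)] by simp
    then have "\<not> sem (RS K) (at_num (Bin True eq_ax c) p) (\<lambda>_. x0)"
      using sem_at_num[OF K assms(1,3), of p "\<lambda>_. x0" e] by simp
    moreover have "ok (at_num (Bin True eq_ax c) p)"
      using ok_num_cf ok_eq_ax assms(1) by (simp add: at_num_def represents_def)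
    ultimately show False using RS R(1) R' by simp
  qed
qed

definition nvars :: nat where
  "nvars = Suc (Max (insert 0 (\<Union> (rvars ` set prog))))"

lemma rvars_prog: "r \<in> set prog \<Longrightarrow> rvars r \<subseteq> {..<nvars}"
proof -
  have "finite (rvars r)" for r unfolding rvars_def by (auto intro: finite_pvars)
  then have "finite (insert 0 (\<Union> (rvars ` set prog)))" by auto
  from Max_ge[OF this] show "r \<in> set prog \<Longrightarrow> rvars r \<subseteq> {..<nvars}"
    unfolding nvars_def by (force simp: less_Suc_eq_le)
qed

abbreviation "hM \<equiv> hornM prog nvars (TruM M)"

lemma df_hM [defn_intros]: "df (\<lambda>e. hM (e i) (e j))"
  by (rule df_hornM[OF rvars_prog df_TruM TruM_nm])

lemma hM_sound: "hM y n \<Longrightarrow> nm y b \<Longrightarrow> nm n z \<Longrightarrow> hp z"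
  using hornM_sound[OF rvars_prog df_TruM TruM_nm] unfolding true_code_def by blast

lemma hM_complete: "hp z \<Longrightarrow> \<exists>b. \<forall>y n. nm y b \<longrightarrow> nm n z \<longrightarrow> hM y n"
  using hornM_complete[OF rvars_prog df_TruM TruM_nm] unfolding true_code_def by blast

text \<open>Rosser's trick: \<open>x\<close> codes a pair of formulae such that the first one, applied to \<open>x\<close>, has a
  refutation which is not preceded by a refutation of the second one.\<close>

definition rosser :: "'a \<Rightarrow> bool" where
  "rosser x \<longleftrightarrow> (\<exists>c c' g g' y. pairM c c' x \<and> tag2M 7 c x g \<and> tag2M 7 c' x g' \<and> N y \<and> hM y g \<and>
     (\<forall>z. leM z y \<longrightarrow> \<not> hM z g'))"

lemma rosser_nm:
  assumes "nm x (pr m m')"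
  shows "rosser x \<longleftrightarrow> (\<exists>g g' y. nm g (pr 7 (pr m (pr m m'))) \<and> nm g' (pr 7 (pr m' (pr m m'))) \<and> N y \<and> hM y g \<and>
     (\<forall>z. leM z y \<longrightarrow> \<not> hM z g'))"
proof -
  have tag: "tag2M 7 c x g \<longleftrightarrow> nm g (pr 7 (pr k (pr m m')))" if c: "nm c k" for c g k
  proof -
    have "tag2M 7 c x g \<longleftrightarrow> (\<exists>p. nm p (pr k (pr m m')) \<and> (\<exists>t. nm t 7 \<and> pairM t p g))"
      unfolding tag2M_def tagM_def pairM_nm1[OF c assms] ..
    also have "\<dots> \<longleftrightarrow> nm g (pr 7 (pr k (pr m m')))" using pairM_nm1 nm_std by blast
    finally show ?thesis .
  qed
  have "rosser x \<longleftrightarrow> (\<exists>c c' g g' y. nm c m \<and> nm c' m' \<and> tag2M 7 c x g \<and> tag2M 7 c' x g' \<and> N y \<and> hM y g \<and>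
     (\<forall>z. leM z y \<longrightarrow> \<not> hM z g'))"
    unfolding rosser_def pairM_nm2[OF assms] by auto
  also have "\<dots> \<longleftrightarrow> (\<exists>c c' g g' y. nm c m \<and> nm c' m' \<and> nm g (pr 7 (pr m (pr m m'))) \<and>
      nm g' (pr 7 (pr m' (pr m m'))) \<and> N y \<and> hM y g \<and> (\<forall>z. leM z y \<longrightarrow> \<not> hM z g'))"
    by (intro ex_cong1 conj_cong refl) (simp_all add: tag[of _ m] tag[of _ m'])
  also have "\<dots> \<longleftrightarrow> (\<exists>g g' y. nm g (pr 7 (pr m (pr m m'))) \<and> nm g' (pr 7 (pr m' (pr m m'))) \<and> N y \<and> hM y g \<and>
     (\<forall>z. leM z y \<longrightarrow> \<not> hM z g'))"
    using nm_std by blast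
  finally show ?thesis .
qed

theorem bounded_model_inconsistent: False
proof -
  have "df (\<lambda>e. rosser (e 0))" unfolding rosser_def by (intro defn_intros)
  from defn_fv[OF this, of 0] obtain \<theta> where \<theta>: "in_lang L \<theta>" "fv \<theta> \<subseteq> {0}" "\<And>e. sat S e \<theta> \<longleftrightarrow> rosser (e 0)"
    by auto
  have "fv \<theta> \<subseteq> {..<1}" "fv (Neg \<theta>) \<subseteq> {..<1}" using \<theta>(2) by auto
  then obtain c c' where c: "represents 1 \<theta> c" "represents 1 (Neg \<theta>) c'"
    using represents_exists[of \<theta> 1] represents_exists[of "Neg \<theta>" 1] \<theta>(1) by auto
  define m m' where "m = code (Bin True eq_ax c)" and "m' = code (Bin True eq_ax c')"
  let ?p = "pr m m'" and ?G = "pr 7 (pr m (pr m m'))" and ?G' = "pr 7 (pr m' (pr m m'))"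
  have same: "rosser x \<longleftrightarrow> rosser (std ?p)" if "nm x ?p" for x
    unfolding rosser_nm[OF that] rosser_nm[OF nm_std] ..
  have "hp ?G \<longleftrightarrow> \<not> sat S undefined (applied \<theta> ?p)"
    unfolding m_def by (rule refutable_iff) (use c \<theta> in auto)
  also have "sat S undefined (applied \<theta> ?p) \<longleftrightarrow> rosser (std ?p)"
    unfolding sat_applied[OF \<theta>(2)] \<theta>(3) using same nm_std by blast
  finally have 1: "hp ?G \<longleftrightarrow> \<not> rosser (std ?p)" .
  have "hp ?G' \<longleftrightarrow> \<not> sat S undefined (applied (Neg \<theta>) ?p)"
    unfolding m'_def by (rule refutable_iff) (use c \<theta> in auto)
  also have "sat S undefined (applied (Neg \<theta>) ?p) \<longleftrightarrow> \<not> rosser (std ?p)"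
  proof -
    have "fv (Neg \<theta>) \<subseteq> {0}" using \<theta>(2) by simp
    from sat_applied[OF this] show ?thesis unfolding sat.simps(3) \<theta>(3) using same nm_std by blast
  qed
  finally have 2: "hp ?G' \<longleftrightarrow> rosser (std ?p)" by simp
  show False
  proof (cases "rosser (std ?p)")
    case True
    then obtain g g' y where *: "nm g ?G" "nm g' ?G'" "N y" "hM y g" "\<And>z. leM z y \<Longrightarrow> \<not> hM z g'"
      unfolding rosser_nm[OF nm_std] by blast
    \<comment> \<open>The negation is false at the pair, so it has a refutation of standard size b.
      If y is at least b, then y does not come first; otherwise y is standard and yields an actual
      refutation of a true sentence.\<close>
    obtain b where b: "\<And>y n. nm y b \<Longrightarrow> nm n ?G' \<Longrightarrow> hM y n" using hM_complete 2 True by blast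
    from leM_total[OF nm_std[of b] *(3)] show False
    proof
      assume "leM (std b) y"
      then show False using *(2,5) b nm_std by blast
    next
      assume "\<exists>k<b. nm y k"
      then show False using hM_sound *(1,4) 1 True by blast
    qed
  next
    case False
    \<comment> \<open>Now the first formula has a refutation of standard size b. A refutation of its
      negation bounded by b would be standard, hence an actual refutation of a true sentence; so b
      is the witness that \<open>rosser\<close> asks for.\<close>
    obtain b where b: "\<And>y n. nm y b \<Longrightarrow> nm n ?G \<Longrightarrow> hM y n" using hM_complete 1 False by blast
    have "\<not> hM z (std ?G')" if "leM z (std b)" for z
      using leM_nm[OF nm_std] that hM_sound nm_std 2 False by blast
    then have "rosser (std ?p)"
      unfolding rosser_nm[OF nm_std] using b nm_std N_std by blast
    with False show False by simp
  qed
qed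

end

theorem theoremA:
  fixes n :: nat and L :: "('f, 'p) lang" and T :: "('f, 'p) fm set"
  assumes "finite_lang L"
    and "T \<subseteq> sentences L"
    and "consistent L T"
    and "sequential L T"
    and "\<exists>A. A \<subseteq> sentences L \<and> (\<forall>\<phi> \<in> A. SigmaStar n \<phi>) \<and>
             (\<forall>\<psi> \<in> sentences L. \<psi> \<in> T \<longleftrightarrow> prv L A \<psi>)"
  shows "\<exists>\<psi> \<in> sentences L. \<not> prv L T \<psi> \<and> \<not> prv L T (Neg \<psi>)"
proof (rule ccontr)
  assume "\<not> ?thesis"
  then have complete: "prv L T \<psi> \<or> prv L T (Neg \<psi>)" if "\<psi> \<in> sentences L" for \<psi> using that by blast
  obtain A where A: "A \<subseteq> sentences L" "\<forall>\<phi> \<in> A. SigmaStar n \<phi>" "\<forall>\<psi> \<in> sentences L. \<psi> \<in> T \<longleftrightarrow> prv L A \<psi>"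
    using assms(5) by blast
  obtain S :: "('f tm, 'f, 'p) struct" where S: "cong_struct S" "\<And>\<phi> e. \<phi> \<in> T \<Longrightarrow> sat S e \<phi>"
    using model_existence[OF assms(1-3)] by blast
  have TS: "sat S e \<phi>" if "prv L T \<phi>" for \<phi> e using prv_sound[OF S(1) that] S(2) by blast
  obtain I \<beta> where I: "interprets L T arith_lang Q I" "in_lang L \<beta>" "fv \<beta> \<subseteq> {0, 1, 2}" "prv L T (sequence_ax I \<beta>)"
    using assms(4) unfolding sequential_def by blast
  let ?ats = "{EqA} \<union> (\<lambda>(p, k). RelA p k) ` rels L \<union> (\<lambda>(f, k). FunA f k) ` funs L"
  have "finite ?ats" using assms(1) by (simp add: finite_lang_def)
  from finite_distinct_list[OF this] obtain ats where ats: "set ats = ?ats" "distinct ats" by (elim exE conjE)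
  have I': "interp_wf L arith_lang I" "\<And>\<phi>. \<phi> \<in> interp_axs arith_lang I \<Longrightarrow> prv L T \<phi>" "\<And>\<phi>. \<phi> \<in> Q \<Longrightarrow> prv L T (tr I \<phi>)"
    using I(1) unfolding interprets_def by blast+
  interpret coded_model L S I \<beta> ats
    by unfold_locales (fact S(1) I'(1) TS[OF I'(2)] TS[OF I'(3)] I(2,3) TS[OF I(4)] ats)+
  have "A \<subseteq> T"
  proof
    fix \<sigma> assume "\<sigma> \<in> A"
    then have "\<sigma> \<in> sentences L" "in_lang L \<sigma>" using A(1) by (auto simp: sentences_def)
    with prv.Asm[OF \<open>\<sigma> \<in> A\<close>, of L] show "\<sigma> \<in> T" using A(3) by blast
  qed
  \<comment> \<open>Variables alone already map onto the natural numbers; the value at compound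
    terms is arbitrary.\<close>
  let ?h = "case_tm (\<lambda>i. i) (\<lambda>_ _. 0) :: 'f tm \<Rightarrow> nat"
  have surj: "surj ?h" by (metis surjI tm.case(1))
  have equiv: "sat K e \<psi> = sat S e \<psi>"
    if K: "cong_struct K" "\<And>c e. cwf True (n + 2) 0 c \<Longrightarrow> sem (RS S) c e \<Longrightarrow> \<exists>e'. sem (RS K) c e'"
      and \<psi>: "\<psi> \<in> sentences L" for K :: "('f tm, 'f, 'p) struct" and \<psi> e
  proof -
    \<comment> \<open>The stratified form of an axiom is true in S and therefore in K. Thus K is a
      model of A, then of T, and completeness of T leaves no sentence on which K and S
      differ.\<close>
    have KA: "sat K e \<sigma>" if "\<sigma> \<in> A" for \<sigma> e
    proof -
      have \<sigma>: "SigmaStar n \<sigma>" "in_lang L \<sigma>" "fv \<sigma> = {}" using A that by (auto simp: sentences_def)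
      from rep_SigmaStar_sentence[OF this] obtain c where c: "cwf True (n + 2) 0 c"
        "\<And>(S :: ('f tm, 'f, 'p) struct) e e'. cong_struct S \<Longrightarrow> sem (RS S) c e = sat S e' \<sigma>" by blast
      have "sem (RS S) c e" using c(2)[OF S(1)] S(2) \<open>A \<subseteq> T\<close> that by blast
      then show ?thesis using K(2)[OF c(1)] c(2)[OF K(1)] by blast
    qed
    have KT: "sat K e \<phi>" if "\<phi> \<in> T" for \<phi> e
      using prv_sound[OF K(1), of L A \<phi>] KA that A(3) assms(2) by blast
    have "sat K e \<phi>" if "prv L T \<phi>" for \<phi> using prv_sound[OF K(1) that] KT by blast
    then show ?thesis using complete[OF \<psi>] TS by force
  qed
  interpret bounded_model L S I \<beta> ats "n + 2" ?h
    by unfold_locales (fact surj, rule equiv)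
  show False by (rule bounded_model_inconsistent)
qed

end
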